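(* For any $\beta,h\in\mathbb R$ and $k,k'\ge1$ there exists $C=C(k,k',\beta,h)>0$ such that for all $N\in\mathbb N$ $$\mathbb E\left[\left(q^{(k+1,k'+1)}_N-\psi\big(q^{(k,k')}_N,q^{(k)}_N,q^{(k')}_N\big)\right)^2\right]\le\frac{C}{\sqrt N}$$ and $$\mathbb E\left[\left(q^{(k+1,1)}_N-\chi\big(q^{(k)}_N\big)\frac1N\sum_{i=1}^Nm^{(1)}_i\right)^2\right]\le\frac{C}{\sqrt N}.$$
   Context: Setup. For each $N\in\mathbb{N}$ let $\{g_{ij}\}_{1\le i<j\le N}$ be independent standard Gaussians, $g_{ji}:=g_{ij}$, $g_{ii}:=0$. For a smooth function $F$ of these variables, $\mathfrak d_{ij}F:=dF/dg_{ij}$ (derivative with respect to the single variable $g_{ij}=g_{ji}$), and $\mathfrak d_{ii}:=0$. For each $N$ a starting value $\mathbf m^{(1)}\in[-1,1]^N$ is given, deterministic or independent of the $g_{ij}$; $\mathbb E$ denotes expectation with respect to the $g_{ij}$, with $\mathbf m^{(1)}$ held fixed, and constants do not depend on $\mathbf m^{(1)}$. For $k\ge1$ define $$m^{(k+1)}_i:=\tanh(h+Y^{(k)}_i),\qquad Y^{(k)}_i:=\frac{\beta}{\sqrt N}\sum_{j=1}^N g_{ij}m^{(k)}_j-\mathrm{On}^{(k)}_i,$$ where $\mathrm{On}^{(k)}_i$ is (consistently for all $k$) one of the following: (I) $\mathrm{On}^{(k)}_i:=\beta^2(1-q^{(k)}_N)m^{(k-1)}_i$ with $\mathbf m^{(0)}:=0$;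 (II) $\mathrm{On}^{(k)}_i:=\frac{\beta}{\sqrt N}\sum_{j=1}^N\mathfrak d_{ij}m^{(k)}_j$. The result holds for both choices. Here $q^{(k,k')}_N:=\frac1N\sum_{i=1}^N m^{(k)}_im^{(k')}_i$ and $q^{(k)}_N:=q^{(k,k)}_N$. For $t',t''\in[0,1]$ and $|t|\le\sqrt{t't''}$, $\psi(t,t',t''):=\mathsf E[\tanh(h+\beta Z')\tanh(h+\beta Z'')]$, where $(Z',Z'')$ is centered Gaussian with $\mathrm{Var}(Z')=t'$, $\mathrm{Var}(Z'')=t''$, $\mathrm{Cov}(Z',Z'')=t$. For $t\ge0$, $\chi(t):=\mathsf E[\tanh(h+\beta\sqrt tZ)]$ with $Z$ standard Gaussian. *)

theory Defs
  imports "HOL-Probability.Probability"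
begin

section \<open>The Gaussian disorder\<close>

text \<open>Sites are \<open>1, \<dots>, N\<close>. A configuration of the disorder stores only the coordinates
  \<open>(i, j)\<close> with \<open>i < j\<close>; the symmetric matrix is read off from it by \<open>coupling\<close>.\<close>

type_synonym disorder = "nat \<times> nat \<Rightarrow> real"

definition site_pairs :: "nat \<Rightarrow> (nat \<times> nat) set" where
  "site_pairs N = {(i, j). 1 \<le> i \<and> i < j \<and> j \<le> N}"

definition disorder_measure :: "nat \<Rightarrow> disorder measure" where
  "disorder_measure N = (\<Pi>\<^sub>M p\<in>site_pairs N. std_normal_distribution)"

definition coupling :: "disorder \<Rightarrow> nat \<Rightarrow> nat \<Rightarrow> real" where
  "coupling g i j = (if i = j then 0 else g (min i j, max i j))"

text \<open>Derivative with respect to the single variable \<open>g\<^sub>i\<^sub>j = g\<^sub>j\<^sub>i\<close>.\<close>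

definition partial_deriv :: "nat \<Rightarrow> nat \<Rightarrow> (disorder \<Rightarrow> real) \<Rightarrow> disorder \<Rightarrow> real" where
  "partial_deriv i j F g =
     (if i = j then 0
      else deriv (\<lambda>x. F (g((min i j, max i j) := x))) (g (min i j, max i j)))"

section \<open>The iteration\<close>

definition overlap :: "nat \<Rightarrow> (nat \<Rightarrow> real) \<Rightarrow> (nat \<Rightarrow> real) \<Rightarrow> real" where
  "overlap N u v = (1 / real N) * (\<Sum>i = 1..N. u i * v i)"

datatype onsager_choice = Onsager_Overlap | Onsager_Derivative

text \<open>Here \<open>m\<close> and \<open>m'\<close> are the current and the preceding iterate, as functions of the disorder.\<close>

fun onsager ::
  "onsager_choice \<Rightarrow> real \<Rightarrow> nat \<Rightarrow> (disorder \<Rightarrow> nat \<Rightarrow> real) \<Rightarrow> (disorder \<Rightarrow> nat \<Rightarrow> real)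
    \<Rightarrow> disorder \<Rightarrow> nat \<Rightarrow> real" where
  "onsager Onsager_Overlap \<beta> N m m' g i = \<beta>\<^sup>2 * (1 - overlap N (m g) (m g)) * m' g i"
| "onsager Onsager_Derivative \<beta> N m m' g i =
     \<beta> / sqrt (real N) * (\<Sum>j = 1..N. partial_deriv i j (\<lambda>g'. m g' j) g)"

definition local_field ::
  "onsager_choice \<Rightarrow> real \<Rightarrow> nat \<Rightarrow> (disorder \<Rightarrow> nat \<Rightarrow> real) \<Rightarrow> (disorder \<Rightarrow> nat \<Rightarrow> real)
    \<Rightarrow> disorder \<Rightarrow> nat \<Rightarrow> real" where
  "local_field c \<beta> N m m' g i =
     \<beta> / sqrt (real N) * (\<Sum>j = 1..N. coupling g i j * m g j) - onsager c \<beta> N m m' g i"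

text \<open>\<open>iterate c \<beta> h N m1 k g i\<close> is \<open>m\<^sub>i\<^sup>(\<^sup>k\<^sup>)\<close> for the starting value \<open>m\<^sup>(\<^sup>1\<^sup>) = m1\<close>;
  the value at \<open>k = 0\<close> enters only through the first choice of the Onsager term.\<close>

fun iterate ::
  "onsager_choice \<Rightarrow> real \<Rightarrow> real \<Rightarrow> nat \<Rightarrow> (nat \<Rightarrow> real) \<Rightarrow> nat \<Rightarrow> disorder \<Rightarrow> nat \<Rightarrow> real" where
  "iterate c \<beta> h N m1 0 = (\<lambda>g i. 0)"
| "iterate c \<beta> h N m1 (Suc 0) = (\<lambda>g i. m1 i)"
| "iterate c \<beta> h N m1 (Suc (Suc k)) =
     (\<lambda>g i. tanh (h + local_field c \<beta> N (iterate c \<beta> h N m1 (Suc k)) (iterate c \<beta> h N m1 k) g i))"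

definition iterate_overlap ::
  "onsager_choice \<Rightarrow> real \<Rightarrow> real \<Rightarrow> nat \<Rightarrow> (nat \<Rightarrow> real) \<Rightarrow> nat \<Rightarrow> nat \<Rightarrow> disorder \<Rightarrow> real" where
  "iterate_overlap c \<beta> h N m1 k k' g =
     overlap N (iterate c \<beta> h N m1 k g) (iterate c \<beta> h N m1 k' g)"

section \<open>Gaussian averages\<close>

text \<open>The centered Gaussian law on the plane with variances \<open>t'\<close>, \<open>t''\<close> and covariance \<open>t\<close>,
  as a linear image of two independent standard Gaussians. If \<open>t' = 0\<close> then
  \<open>\<bar>t\<bar> \<le> sqrt (t' * t'')\<close> forces \<open>t = 0\<close> and the convention \<open>x / 0 = 0\<close> gives the degenerate law.
  The characteristic function is computed in \<open>char_gaussian_pair\<close> below.\<close>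

definition gaussian_pair :: "real \<Rightarrow> real \<Rightarrow> real \<Rightarrow> (real \<times> real) measure" where
  "gaussian_pair t t' t'' =
     distr (std_normal_distribution \<Otimes>\<^sub>M std_normal_distribution) borel
       (\<lambda>(x, y). (sqrt t' * x, t / sqrt t' * x + sqrt (t'' - t\<^sup>2 / t') * y))"

definition psi :: "real \<Rightarrow> real \<Rightarrow> real \<Rightarrow> real \<Rightarrow> real \<Rightarrow> real" where
  "psi \<beta> h t t' t'' =
     (LINT (z', z'')|gaussian_pair t t' t''. tanh (h + \<beta> * z') * tanh (h + \<beta> * z''))"

definition chi :: "real \<Rightarrow> real \<Rightarrow> real \<Rightarrow> real" where
  "chi \<beta> h t = (LINT z|std_normal_distribution. tanh (h + \<beta> * sqrt t * z))"

lemma char_gaussian_pair: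
  assumes "0 \<le> t'" "0 \<le> t''" "\<bar>t\<bar> \<le> sqrt (t' * t'')"
  shows "(CLINT (z', z'')|gaussian_pair t t' t''. iexp (a * z' + b * z'')) =
           exp (- (a\<^sup>2 * t' + 2 * a * b * t + b\<^sup>2 * t'') / 2)"
proof -
  let ?S = std_normal_distribution
  define u where "u = a * sqrt t' + b * (t / sqrt t')"
  define v where "v = b * sqrt (t'' - t\<^sup>2 / t')"
  interpret S: real_distribution ?S
    by (rule real_dist_normal_dist)
  interpret P: pair_prob_space ?S ?S ..
  have t2: "t\<^sup>2 \<le> t' * t''"
    using assms real_le_rsqrt abs_le_square_iff[of t "sqrt (t' * t'')"] by simp
  have uv: "u\<^sup>2 + v\<^sup>2 = a\<^sup>2 * t' + 2 * a * b * t + b\<^sup>2 * t''"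
  proof (cases "t' = 0")
    case True
    then show ?thesis using t2 assms(2) by (simp add: u_def v_def power_mult_distrib)
  next
    case False
    then have "t\<^sup>2 / t' \<le> t''" using t2 assms(1) by (simp add: field_simps)
    moreover have "sqrt t' * (t / sqrt t') = t" "(t / sqrt t')\<^sup>2 = t\<^sup>2 / t'"
      using False assms(1) by (auto simp: power_divide)
    ultimately show ?thesis
      using assms(1) False
      by (simp add: u_def v_def power2_sum power_mult_distrib power_divide algebra_simps)
  qed
  have c: "(CLINT x|?S. iexp (w * x)) = exp (- (w\<^sup>2) / 2)" for w
    using fun_cong[OF char_std_normal_distribution, of w] by (simp add: char_def)
  have int: "integrable (?S \<Otimes>\<^sub>M ?S) (\<lambda>(x, y). iexp (u * x) * iexp (v * y))"
    by (rule P.P.integrable_const_bound[where B = 1]) (auto simp: norm_mult split_beta)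
  have "(CLINT (z', z'')|gaussian_pair t t' t''. iexp (a * z' + b * z'')) =
      (CLINT (x, y)|?S \<Otimes>\<^sub>M ?S. iexp (u * x) * iexp (v * y))"
    unfolding gaussian_pair_def
    by (subst integral_distr)
      (auto simp: split_beta u_def v_def algebra_simps borel_prod[symmetric]
        simp flip: exp_add intro!: Bochner_Integration.integral_cong)
  also have "\<dots> = (CLINT x|?S. CLINT y|?S. iexp (u * x) * iexp (v * y))"
    using P.integral_fst[OF int] by simp
  also have "\<dots> = exp (- (u\<^sup>2) / 2) * exp (- (v\<^sup>2) / 2)"
    using c[of u] c[of v] by simp
  also have "\<dots> = exp (- (a\<^sup>2 * t' + 2 * a * b * t + b\<^sup>2 * t'') / 2)"
    unfolding uv[symmetric] by (simp add: exp_add[symmetric] add_divide_distrib diff_divide_distrib flip: of_real_mult)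
  finally show ?thesis .
qed

end

theory Submission
  imports Defs "HOL-Real_Asymp.Real_Asymp"
begin

text \<open>The field \<open>Y\<^sub>i\<close> is, up to a remainder, the divergence of the vector field \<open>\<beta> / sqrt N * m\<close> along the couplings of
  site \<open>i\<close>; this is exactly the effect of the Onsager term. Conditionally on the disorder let \<open>Z\<close> be
  \<open>\<beta> / sqrt N * (\<Sum>l. z\<^sub>l m\<^sub>l)\<close> with fresh standard Gaussians \<open>z\<^sub>l\<close>, so that \<open>psi\<close> and \<open>chi\<close> at the random overlaps are
  conditional expectations of functions of \<open>Z\<close>. With two such copies the mean square in question becomes
  the expectation of \<open>(A - B(Z)) * (A - B(Z'))\<close>, where \<open>A\<close> is the average over the sites. Rotating \<open>Y\<^sub>i\<close> into \<open>Z\<close> and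
  integrating by parts, the leading terms cancel. All that remains is bounded by moments of derivatives
  of the iterates, which are controlled by induction on the iteration since moments of a divergence can
  be computed by repeated integration by parts without loss.\<close>

section \<open>Tame functions of a Gaussian vector\<close>

text \<open>The function \<open>psi\<close> contains \<open>sqrt t'\<close> and is evaluated at a
  random overlap that may vanish, so it is never differentiated: it enters only as a conditional
  law, and all calculus is done on tanh. Two copies are needed because the square of A - B(Z) would
  also contain the conditional variance of B(Z). Only the first factor is moved along the rotation;
  the second is a bounded test function whose derivative in a coupling of site i is of order 1 / N.
  The obstacle is that Y_i is a sum of N terms, and naive bounds on its derivatives lose powers of
  sqrt N. The bounds therefore record which sites the differentiated couplings touch. All even
  moments are carried along, since every product doubles the exponent by Cauchy-Schwarz. The class
  \<open>tame\<close> takes the place of smoothness and integrability hypotheses: it is closed under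
  partial derivatives and its members have all moments. The rate 1 / sqrt N has two sources: the
  size of the Onsager remainder, and at most N errors of order 1 / N with the common prefactor beta
  / sqrt N.\<close>

inductive_set tame :: "'e set \<Rightarrow> (('e \<Rightarrow> real) \<Rightarrow> real) set" for I where
  tame_const [simp, intro]: "(\<lambda>g. a) \<in> tame I"
| tame_coord [intro]: "e \<in> I \<Longrightarrow> (\<lambda>g. g e) \<in> tame I"
| tame_add [intro]: "F \<in> tame I \<Longrightarrow> G \<in> tame I \<Longrightarrow> (\<lambda>g. F g + G g) \<in> tame I"
| tame_mult [intro]: "F \<in> tame I \<Longrightarrow> G \<in> tame I \<Longrightarrow> (\<lambda>g. F g * G g) \<in> tame I"
| tame_tanh [intro]: "F \<in> tame I \<Longrightarrow> (\<lambda>g. tanh (F g)) \<in> tame I"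

definition pd :: "'e \<Rightarrow> (('e \<Rightarrow> real) \<Rightarrow> real) \<Rightarrow> ('e \<Rightarrow> real) \<Rightarrow> real" where
  "pd e F g = deriv (\<lambda>x. F (g(e := x))) (g e)"

definition gauss_measure :: "'e set \<Rightarrow> ('e \<Rightarrow> real) measure" where
  "gauss_measure I = (\<Pi>\<^sub>M e\<in>I. std_normal_distribution)"

definition gE :: "'e set \<Rightarrow> (('e \<Rightarrow> real) \<Rightarrow> real) \<Rightarrow> real" where
  "gE I F = (\<integral>g. F g \<partial>gauss_measure I)"

lemma tame_mono: "F \<in> tame I \<Longrightarrow> I \<subseteq> J \<Longrightarrow> F \<in> tame J"
  by (induction rule: tame.induct) auto

lemma tame_minus [intro]: "F \<in> tame I \<Longrightarrow> (\<lambda>g. - F g) \<in> tame I"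
  using tame_mult[OF tame_const[of "-1"], of F I] by simp

lemma tame_diff [intro]: "F \<in> tame I \<Longrightarrow> G \<in> tame I \<Longrightarrow> (\<lambda>g. F g - G g) \<in> tame I"
  using tame_add[of F I "\<lambda>g. - G g"] by auto

lemma tame_power [intro]: "F \<in> tame I \<Longrightarrow> (\<lambda>g. F g ^ n) \<in> tame I"
  by (induction n) auto

lemma tame_sum [intro]: "(\<And>a. a \<in> A \<Longrightarrow> F a \<in> tame I) \<Longrightarrow> (\<lambda>g. \<Sum>a\<in>A. F a g) \<in> tame I"
  by (induction A rule: infinite_finite_induct) auto

lemma tame_prod [intro]: "(\<And>a. a \<in> A \<Longrightarrow> F a \<in> tame I) \<Longrightarrow> (\<lambda>g. \<Prod>a\<in>A. F a g) \<in> tame I"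
  by (induction A rule: infinite_finite_induct) auto

lemma DERIV_tanh_real: "(tanh has_real_derivative 1 - (tanh x)\<^sup>2) (at x)"
  by (auto intro!: derivative_eq_intros)

lemma tame_differentiable:
  "F \<in> tame I \<Longrightarrow> (\<lambda>x. F (g(e := x))) differentiable (at x)"
proof (induction rule: tame.induct)
  case (tame_coord e')
  then show ?case by (cases "e' = e") auto
next
  case (tame_tanh F)
  have "tanh differentiable at (F (g(e := x)))"
    using DERIV_tanh_real real_differentiable_def by blast
  from differentiable_chain_at[OF tame_tanh.IH this] show ?case by (simp add: o_def)
qed auto

lemma tame_has_pd:
  assumes "F \<in> tame I"
  shows "((\<lambda>x. F (g(e := x))) has_real_derivative pd e F (g(e := x))) (at x within S)"
  using tame_differentiable[OF assms, of g e x] unfolding pd_def fun_upd_upd fun_upd_same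
  by (intro DERIV_subset[OF DERIV_deriv_iff_real_differentiable[THEN iffD2] subset_UNIV])

lemma pd_eqI:
  assumes "((\<lambda>x. F (g(e := x))) has_real_derivative D) (at (g e))"
  shows "pd e F g = D"
  unfolding pd_def using assms by (rule DERIV_imp_deriv)

lemma tame_has_pd': "F \<in> tame I \<Longrightarrow>
  ((\<lambda>x. F (g(e := x))) has_real_derivative pd e F g) (at (g e))"
  using tame_has_pd[of F I g e "g e"] by simp

lemma pd_const [simp]: "pd e (\<lambda>g. a) = (\<lambda>g. 0)"
  by (auto simp: pd_def)

lemma pd_coord: "pd e (\<lambda>g. g e') = (\<lambda>g. if e = e' then 1 else 0)"
  by (intro ext pd_eqI) (auto intro!: derivative_eq_intros)

lemma pd_add: "F \<in> tame I \<Longrightarrow> G \<in> tame I \<Longrightarrow> pd e (\<lambda>g. F g + G g) = (\<lambda>g. pd e F g + pd e G g)"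
  by (intro ext pd_eqI) (auto intro!: derivative_eq_intros tame_has_pd')

lemma pd_mult: "F \<in> tame I \<Longrightarrow> G \<in> tame I \<Longrightarrow>
  pd e (\<lambda>g. F g * G g) = (\<lambda>g. pd e F g * G g + F g * pd e G g)"
  by (intro ext pd_eqI DERIV_cong[OF DERIV_mult[OF tame_has_pd' tame_has_pd']]) auto

lemma pd_tanh: "F \<in> tame I \<Longrightarrow> pd e (\<lambda>g. tanh (F g)) = (\<lambda>g. (1 - (tanh (F g))\<^sup>2) * pd e F g)"
  by (intro ext pd_eqI DERIV_cong[OF DERIV_chain2[OF DERIV_tanh_real tame_has_pd']]) auto

text \<open>The identity tanh' = 1 - tanh^2 makes the derivative a polynomial in functions that are
  already in the class; this is why tanh can be the only nonpolynomial generator.\<close>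

lemma tame_pd [intro]: "F \<in> tame I \<Longrightarrow> pd e F \<in> tame I"
proof (induction rule: tame.induct)
  case (tame_tanh F)
  show ?case unfolding pd_tanh[OF tame_tanh.hyps] using tame_tanh by (intro tame_mult tame_diff) auto
qed (auto simp: pd_coord pd_add pd_mult)

lemma pd_minus: "F \<in> tame I \<Longrightarrow> pd e (\<lambda>g. - F g) = (\<lambda>g. - pd e F g)"
  using pd_mult[OF tame_const[of "-1"], of F I e] by simp

lemma pd_diff: "F \<in> tame I \<Longrightarrow> G \<in> tame I \<Longrightarrow> pd e (\<lambda>g. F g - G g) = (\<lambda>g. pd e F g - pd e G g)"
  using pd_add[of F I "\<lambda>g. - G g" e] by (auto simp: pd_minus)

lemma pd_cmult: "F \<in> tame I \<Longrightarrow> pd e (\<lambda>g. a * F g) = (\<lambda>g. a * pd e F g)"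
  using pd_mult[OF tame_const[of a], of F I e] by simp

lemma pd_sum:
  assumes "\<And>a. a \<in> A \<Longrightarrow> F a \<in> tame I"
  shows "pd e (\<lambda>g. \<Sum>a\<in>A. F a g) = (\<lambda>g. \<Sum>a\<in>A. pd e (F a) g)"
  using assms
proof (induction A rule: infinite_finite_induct)
  case (insert x A)
  then show ?case by (auto simp: pd_add[of _ I] tame_sum)
qed auto

lemma pd_prod:
  assumes "finite A" "\<And>a. a \<in> A \<Longrightarrow> F a \<in> tame I"
  shows "pd e (\<lambda>g. \<Prod>a\<in>A. F a g) = (\<lambda>g. \<Sum>a\<in>A. pd e (F a) g * (\<Prod>b\<in>A - {a}. F b g))"
proof (intro ext pd_eqI)
  fix g
  have "((\<lambda>x. \<Prod>a\<in>A. F a (g(e := x))) has_real_derivative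
      (\<Sum>a\<in>A. pd e (F a) g * (\<Prod>b\<in>A - {a}. F b (g(e := g e))))) (at (g e))"
    using assms by (intro has_field_derivative_prod tame_has_pd') auto
  then show "((\<lambda>x. \<Prod>a\<in>A. F a (g(e := x))) has_real_derivative
      (\<Sum>a\<in>A. pd e (F a) g * (\<Prod>b\<in>A - {a}. F b g))) (at (g e))" by simp
qed

text \<open>Structural induction reduces the symmetry of mixed derivatives to the product and chain
  rules. Only the tanh case has content: there both orders produce the symmetric term -2 tanh (1 -
  tanh^2) \<open>pd e F\<close> \<open>pd e' F\<close> besides the mixed derivative of
  \<open>F\<close>.\<close>

lemma pd_commute: "F \<in> tame I \<Longrightarrow> pd e (pd e' F) = pd e' (pd e F)"
proof (induction rule: tame.induct)
  case (tame_coord e'')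
  then show ?case by (simp add: pd_coord)
next
  case (tame_add F G)
  then show ?case by (simp add: pd_add[of _ I] tame_pd)
next
  case (tame_mult F G)
  then show ?case
    by (simp add: pd_add[of _ I] pd_mult[of _ I] tame_pd tame.tame_mult algebra_simps)
next
  case (tame_tanh F)
  have T: "(\<lambda>g. 1 - (tanh (F g))\<^sup>2) \<in> tame I" "(\<lambda>g. tanh (F g)) \<in> tame I" 
    by (intro tame_diff tame_power tame.tame_tanh tame_const tame_tanh.hyps)+
  have *: "pd a (\<lambda>g. 1 - (tanh (F g))\<^sup>2) = (\<lambda>g. - 2 * tanh (F g) * (1 - (tanh (F g))\<^sup>2) * pd a F g)" for a
    unfolding power2_eq_square using T
    by (subst pd_diff[of _ I] pd_mult[of _ I] pd_const pd_tanh[OF tame_tanh.hyps] | force)+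
       (simp add: fun_eq_iff pd_tanh[OF tame_tanh.hyps] power2_eq_square algebra_simps)
  show ?case
    unfolding pd_tanh[OF tame_tanh.hyps] pd_mult[OF T(1) tame_pd[OF tame_tanh.hyps]] *
    by (simp add: tame_tanh.IH algebra_simps)
qed auto

lemma pd_outside:
  assumes "F \<in> tame I" "e \<notin> I" shows "pd e F = (\<lambda>g. 0)"
  using assms
proof (induction rule: tame.induct)
  case (tame_coord e') then show ?case by (auto simp: pd_coord)
next
  case (tame_add F G) then show ?case by (simp add: pd_add[of _ I])
next
  case (tame_mult F G) then show ?case by (simp add: pd_mult[of _ I])
next
  case (tame_tanh F) then show ?case by (simp add: pd_tanh[of _ I])
qed auto

lemma abs_tanh_le_1: "\<bar>tanh (x :: real)\<bar> \<le> 1"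
  using tanh_real_bounds[of x] by auto

text \<open>The other coordinates are frozen, so \<open>C\<close> and \<open>n\<close> may depend on
  \<open>g\<close> and \<open>e\<close>. This is enough to remove the boundary terms in the
  one-dimensional integration by parts.\<close>

lemma tame_growth:
  assumes "F \<in> tame I"
  shows "\<exists>C n. \<forall>x. \<bar>F (g(e := x))\<bar> \<le> C * (1 + \<bar>x\<bar>) ^ n"
  using assms
proof (induction rule: tame.induct)
  case (tame_const a)
  show ?case by (rule exI[of _ "\<bar>a\<bar>"], rule exI[of _ 0]) auto
next
  case (tame_coord e')
  show ?case
    by (rule exI[of _ "1 + \<bar>g e'\<bar>"], rule exI[of _ 1]) (auto simp: algebra_simps)
next
  case (tame_add F G)
  then obtain C n D m where *: "\<bar>F (g(e := x))\<bar> \<le> C * (1 + \<bar>x\<bar>) ^ n" 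
    "\<bar>G (g(e := x))\<bar> \<le> D * (1 + \<bar>x\<bar>) ^ m" for x by blast
  have "0 \<le> C" "0 \<le> D" using *(1)[of 0] *(2)[of 0] by auto
  have "\<bar>F (g(e := x)) + G (g(e := x))\<bar> \<le> (C + D) * (1 + \<bar>x\<bar>) ^ (max n m)" for x
  proof -
    have "\<bar>F (g(e := x)) + G (g(e := x))\<bar> \<le> C * (1 + \<bar>x\<bar>) ^ n + D * (1 + \<bar>x\<bar>) ^ m"
      using *(1)[of x] *(2)[of x] by auto
    also have "\<dots> \<le> C * (1 + \<bar>x\<bar>) ^ (max n m) + D * (1 + \<bar>x\<bar>) ^ (max n m)"
      using \<open>0 \<le> C\<close> \<open>0 \<le> D\<close> by (intro add_mono mult_left_mono power_increasing) auto
    finally show ?thesis by (simp add: algebra_simps)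
  qed
  then show ?case by blast
next
  case (tame_mult F G)
  then obtain C n D m where *: "\<bar>F (g(e := x))\<bar> \<le> C * (1 + \<bar>x\<bar>) ^ n" 
    "\<bar>G (g(e := x))\<bar> \<le> D * (1 + \<bar>x\<bar>) ^ m" for x by blast
  have "\<bar>F (g(e := x)) * G (g(e := x))\<bar> \<le> (C * D) * (1 + \<bar>x\<bar>) ^ (n + m)" for x
  proof -
    have "\<bar>F (g(e := x)) * G (g(e := x))\<bar> \<le> (C * (1 + \<bar>x\<bar>) ^ n) * (D * (1 + \<bar>x\<bar>) ^ m)"
      unfolding abs_mult using * order_trans[OF abs_ge_zero *(1)[of x]] by (intro mult_mono) auto
    then show ?thesis by (simp only: power_add mult_ac)
  qed
  then show ?case by blast
next
  case (tame_tanh F)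
  show ?case
    using abs_tanh_le_1 by (intro exI[of _ 1] exI[of _ 0]) simp
qed

section \<open>Integrability and Gaussian integration by parts\<close>

lemma prob_space_std_normal [simp]: "prob_space std_normal_distribution"
  by (rule prob_space_normal_density) auto

lemma product_prob_space_gauss_measure: "product_prob_space (\<lambda>e. std_normal_distribution)"
  by (rule product_prob_spaceI) auto

lemma prob_space_gauss_measure: "prob_space (gauss_measure I)"
  unfolding gauss_measure_def by (rule prob_space_PiM) auto

lemma tame_measurable [measurable]: "F \<in> tame I \<Longrightarrow> F \<in> borel_measurable (gauss_measure I)"
proof (induction rule: tame.induct)
  case (tame_coord e)
  then have "(\<lambda>g. g e) \<in> measurable (gauss_measure I) std_normal_distribution"
    unfolding gauss_measure_def by (rule measurable_component_singleton)
  then show ?case by (simp cong: measurable_cong_sets)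
next
  case (tame_tanh F)
  have "tanh \<in> borel_measurable (borel :: real measure)"
    by (intro borel_measurable_continuous_onI continuous_intros) auto
  then show ?case using tame_tanh.IH by (rule measurable_compose[rotated])
qed auto

lemma integrable_std_normal_power: "integrable std_normal_distribution (\<lambda>x. x ^ k)"
  by (subst integrable_density) (auto intro!: integrable_std_normal_moment)

lemma integrable_gauss_measure_coord:
  assumes "e \<in> I"
  shows "integrable (gauss_measure I) (\<lambda>g. (g e) ^ k)"
proof -
  have "distr (gauss_measure I) std_normal_distribution (\<lambda>g. g e) = std_normal_distribution"
    unfolding gauss_measure_def using assms by (intro distr_PiM_component) auto
  then have "integrable (distr (gauss_measure I) std_normal_distribution (\<lambda>g. g e)) (\<lambda>x. x ^ k)"
    using integrable_std_normal_power by simp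
  moreover have "(\<lambda>g. g e) \<in> measurable (gauss_measure I) std_normal_distribution"
    unfolding gauss_measure_def using assms by (rule measurable_component_singleton)
  ultimately show ?thesis by (simp add: integrable_distr_eq)
qed

lemma even_power_add_le: "((a::real) + b) ^ (2 * q) \<le> 2 ^ (2 * q) * (a ^ (2 * q) + b ^ (2 * q))"
proof -
  have "\<bar>a + b\<bar> \<le> 2 * max \<bar>a\<bar> \<bar>b\<bar>" by auto
  then have "\<bar>a + b\<bar> ^ (2*q) \<le> (2 * max \<bar>a\<bar> \<bar>b\<bar>) ^ (2*q)" by (intro power_mono) auto
  also have "\<dots> = 2 ^ (2*q) * max \<bar>a\<bar> \<bar>b\<bar> ^ (2*q)" by (simp add: power_mult_distrib)
  also have "max \<bar>a\<bar> \<bar>b\<bar> ^ (2*q) \<le> \<bar>a\<bar> ^ (2*q) + \<bar>b\<bar> ^ (2*q)" by (auto simp: max_def)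
  finally show ?thesis by (simp add: power_even_abs)
qed

text \<open>The exponent is generalised in the induction because a product needs the moments of its
  factors at twice the exponent: (F G)^(2q) is at most F^(4q) + G^(4q).\<close>

lemma tame_integrable_even:
  assumes "F \<in> tame I"
  shows "integrable (gauss_measure I) (\<lambda>g. F g ^ (2 * q))"
  using assms
proof (induction arbitrary: q rule: tame.induct)
  case (tame_const a)
  interpret prob_space "gauss_measure I" by (rule prob_space_gauss_measure)
  show ?case by simp
next
  case (tame_coord e)
  then show ?case by (rule integrable_gauss_measure_coord)
next
  case (tame_add F G)
  have "integrable (gauss_measure I) (\<lambda>g. 2 ^ (2 * q) * (F g ^ (2 * q) + G g ^ (2 * q)))"
    using tame_add.IH by auto
  then show ?case
    by (rule Bochner_Integration.integrable_bound)
      (use tame_add.hyps in \<open>auto intro!: even_power_add_le simp: power_even_abs\<close>)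
next
  case (tame_mult F G)
  have "integrable (gauss_measure I) (\<lambda>g. F g ^ (2 * (2 * q)) + G g ^ (2 * (2 * q)))"
    using tame_mult.IH[of "2 * q"] by auto
  then show ?case
  proof (rule Bochner_Integration.integrable_bound)
    have "\<bar>(a * b) ^ (2 * q)\<bar> \<le> a ^ (2 * (2 * q)) + b ^ (2 * (2 * q))" for a b :: real
    proof -
      define u v where "u = a ^ (2*q)" and "v = b ^ (2*q)"
      have "a ^ (2 * (2 * q)) = u\<^sup>2" "b ^ (2 * (2 * q)) = v\<^sup>2" "(a * b) ^ (2 * q) = u * v"
        by (simp_all only: u_def v_def power_mult_distrib power_mult[symmetric] mult_ac)
      moreover have "\<bar>u * v\<bar> \<le> u\<^sup>2 + v\<^sup>2"
        using sum_squares_bound[of u v] sum_squares_bound[of u "-v"] zero_le_power2[of u] zero_le_power2[of v] 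
        by (simp add: abs_if)
      ultimately show ?thesis by (simp only:)
    qed
    then show "AE g in gauss_measure I. norm ((F g * G g) ^ (2*q)) \<le> norm (F g ^ (2 * (2 * q)) + G g ^ (2 * (2 * q)))"
      by (intro AE_I2) (simp only: real_norm_def, rule order_trans[OF _ abs_ge_self], blast)
    show "(\<lambda>g. (F g * G g) ^ (2 * q)) \<in> borel_measurable (gauss_measure I)"
      by (intro tame_measurable tame_power tame.tame_mult tame_mult.hyps)
  qed
next
  case (tame_tanh F)
  interpret prob_space "gauss_measure I" by (rule prob_space_gauss_measure)
  show ?case
  proof (rule integrable_const_bound[of _ 1])
    show "AE g in gauss_measure I. norm (tanh (F g) ^ (2 * q)) \<le> 1"
      by (intro AE_I2) (simp only: real_norm_def power_abs power_le_one abs_tanh_le_1 abs_ge_zero)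
    show "(\<lambda>g. tanh (F g) ^ (2 * q)) \<in> borel_measurable (gauss_measure I)"
      by (intro tame_measurable tame_power tame.tame_tanh tame_tanh.hyps)
  qed
qed

lemma tame_integrable [intro]:
  assumes "F \<in> tame I" shows "integrable (gauss_measure I) F"
proof -
  interpret prob_space "gauss_measure I" by (rule prob_space_gauss_measure)
  have "integrable (gauss_measure I) (\<lambda>g. 1 + F g ^ (2 * 1))" using tame_integrable_even[OF assms, of 1] by auto
  then show ?thesis
  proof (rule Bochner_Integration.integrable_bound)
    have "\<bar>a\<bar> \<le> \<bar>1 + a ^ (2*1)\<bar>" for a :: real
      using sum_squares_bound[of 1 a] sum_squares_bound[of 1 "-a"] by (auto simp: power2_eq_square abs_if)
    then show "AE g in gauss_measure I. norm (F g) \<le> norm (1 + F g ^ (2*1))" by (auto)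
  qed (use assms in auto)
qed

lemma poly_times_gaussian_tendsto:
  fixes f :: "real \<Rightarrow> real"
  assumes "\<And>x. \<bar>f x\<bar> \<le> C * (1 + \<bar>x\<bar>) ^ n"
  shows "((\<lambda>x. f x * std_normal_density x) \<longlongrightarrow> 0) at_top"
    and "((\<lambda>x. f x * std_normal_density x) \<longlongrightarrow> 0) at_bot"
proof -
  have *: "\<bar>f x * std_normal_density x\<bar> \<le> C * (1 + \<bar>x\<bar>) ^ n * std_normal_density x" for x
    using assms[of x] by (simp add: abs_mult mult_right_mono)
  have 1: "((\<lambda>x. C * (1 + x) ^ n * std_normal_density x) \<longlongrightarrow> 0) at_top"
    unfolding std_normal_density_def by real_asymp
  show "((\<lambda>x. f x * std_normal_density x) \<longlongrightarrow> 0) at_top"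
    by (rule Lim_null_comparison[OF _ 1])
      (use * in \<open>auto intro!: eventually_mono[OF eventually_ge_at_top[of 0]] simp: abs_mult\<close>, smt (verit) *)
  have 2: "((\<lambda>x. C * (1 - x) ^ n * std_normal_density x) \<longlongrightarrow> 0) at_bot"
    unfolding std_normal_density_def by real_asymp
  show "((\<lambda>x. f x * std_normal_density x) \<longlongrightarrow> 0) at_bot"
    by (rule Lim_null_comparison[OF _ 2])
      (use * in \<open>auto intro!: eventually_mono[OF eventually_le_at_bot[of 0]] simp: abs_mult\<close>, smt (verit) *)
qed

text \<open>The product of f with the density phi has derivative phi f' - phi x f, and its limits at
  both ends are zero by the growth bound; the fundamental theorem of calculus on the whole line then
  equates the two integrals.\<close>

lemma ibp_1d:
  assumes f: "\<And>x. (f has_real_derivative f' x) (at x)" and cont: "\<And>x. isCont f' x"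
    and growth: "\<And>x. \<bar>f x\<bar> \<le> C * (1 + \<bar>x\<bar>) ^ n"
    and i1: "integrable std_normal_distribution (\<lambda>x. x * f x)"
    and i2: "integrable std_normal_distribution f'"
  shows "(\<integral>x. x * f x \<partial>std_normal_distribution) = (\<integral>x. f' x \<partial>std_normal_distribution)"
proof -
  let ?d = std_normal_density
  have cf: "isCont f x" for x using f DERIV_isCont by blast
  have [measurable]: "f \<in> borel_measurable borel" "f' \<in> borel_measurable borel"
    using cf cont by (auto intro!: borel_measurable_continuous_onI continuous_at_imp_continuous_on)
  have j1: "integrable lborel (\<lambda>x. ?d x * (x * f x))" and j2: "integrable lborel (\<lambda>x. ?d x * f' x)"
    using i1 i2 by (auto simp: integrable_density)
  have D: "((\<lambda>x. f x * ?d x) has_vector_derivative ?d x * f' x - ?d x * (x * f x)) (at x)" for x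
  proof -
    have "((\<lambda>x. a * exp (- x\<^sup>2 / 2)) has_real_derivative - x * (a * exp (- x\<^sup>2 / 2))) (at x)" for a
      by (auto intro!: derivative_eq_intros)
    then have "(?d has_real_derivative - x * ?d x) (at x)"
      unfolding std_normal_density_def[abs_def] .
    then show ?thesis unfolding has_real_derivative_iff_has_vector_derivative[symmetric]
      by (auto intro!: derivative_eq_intros f)
  qed
  have "(LBINT x=-\<infinity>..\<infinity>. ?d x * f' x - ?d x * (x * f x)) = 0 - 0"
  proof (rule interval_integral_FTC_integrable[OF _ D])
    show "isCont (\<lambda>x. ?d x * f' x - ?d x * (x * f x)) x" for x
      unfolding std_normal_density_def using cf cont by (intro continuous_intros) auto
    show "set_integrable lborel (einterval (- \<infinity>) \<infinity>) (\<lambda>x. ?d x * f' x - ?d x * (x * f x))"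
      using j1 j2 by (simp add: set_integrable_def)
    show "(((\<lambda>x. f x * ?d x) \<circ> real_of_ereal) \<longlongrightarrow> 0) (at_right (- \<infinity>))"
      "(((\<lambda>x. f x * ?d x) \<circ> real_of_ereal) \<longlongrightarrow> 0) (at_left \<infinity>)"
      using poly_times_gaussian_tendsto[OF growth]
      by (simp_all add: ereal_tendsto_simps)
  qed auto
  then have "(\<integral>x. ?d x * f' x - ?d x * (x * f x) \<partial>lborel) = 0"
    by (simp add: interval_lebesgue_integral_def set_lebesgue_integral_def)
  then show ?thesis using j1 j2 by (simp add: integral_density)
qed

lemma gauss_measure_insert:
  assumes "finite J" "e \<notin> J" "F \<in> tame (insert e J)"
  shows "gE (insert e J) F = (\<integral>g. (\<integral>x. F (g(e := x)) \<partial>std_normal_distribution) \<partial>gauss_measure J)"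
proof -
  interpret product_prob_space "\<lambda>e. std_normal_distribution" UNIV
    by (rule product_prob_space_gauss_measure)
  show ?thesis
    using assms tame_integrable[OF assms(3)] unfolding gE_def gauss_measure_def
    by (intro product_integral_insert) auto
qed

lemma tame_section_integrable:
  assumes "F \<in> tame I"
  shows "integrable std_normal_distribution (\<lambda>x. F (g(e := x)))"
proof -
  obtain C n where *: "\<And>x. \<bar>F (g(e := x))\<bar> \<le> C * (1 + \<bar>x\<bar>) ^ n" using tame_growth[OF assms] by blast
  have "0 \<le> C" using *[of 0] by auto
  have m: "(\<lambda>x. F (g(e := x))) \<in> borel_measurable borel"
    using tame_has_pd[OF assms] DERIV_isCont
    by (intro borel_measurable_continuous_onI continuous_at_imp_continuous_on) blast
  have "integrable std_normal_distribution (\<lambda>x. C * (2 ^ (2 * n) * (1 ^ (2 * n) + x ^ (2 * n))))"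
    using integrable_std_normal_power by (auto simp: integrable_density)
  then show ?thesis
  proof (rule Bochner_Integration.integrable_bound)
    have "norm (F (g(e := x))) \<le> norm (C * (2 ^ (2 * n) * (1 ^ (2 * n) + x ^ (2 * n))))" for x
    proof -
      have "(1 + \<bar>x\<bar>) ^ n \<le> (1 + \<bar>x\<bar>) ^ (2 * n)" by (rule power_increasing) auto
      also have "\<dots> \<le> 2 ^ (2 * n) * (1 ^ (2 * n) + \<bar>x\<bar> ^ (2 * n))" by (rule even_power_add_le)
      finally show ?thesis using *[of x] \<open>0 \<le> C\<close> 
        by (simp add: abs_mult power_even_abs) (smt (verit) mult_left_mono zero_le_even_power even_mult_iff even_numeral)
    qed
    then show "AE x in std_normal_distribution. norm (F (g(e := x))) \<le> norm (C * (2 ^ (2 * n) * (1 ^ (2 * n) + x ^ (2 * n))))"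
      by simp
  qed (use m in auto)
qed

text \<open>Fubini isolates the coordinate \<open>e\<close>, and \<open>ibp_1d\<close> applies for
  each fixed value of the others. The growth constants vary with those values, which is harmless
  since the identity is applied pointwise.\<close>

lemma ibp:
  assumes "finite I" "e \<in> I" "F \<in> tame I"
  shows "gE I (\<lambda>g. g e * F g) = gE I (pd e F)"
proof -
  define J where "J = I - {e}"
  have I: "I = insert e J" "finite J" "e \<notin> J" using assms J_def by auto
  have t: "(\<lambda>g. g e * F g) \<in> tame I" using assms by auto
  have "(\<integral>x. x * F (g(e := x)) \<partial>std_normal_distribution) = (\<integral>x. pd e F (g(e := x)) \<partial>std_normal_distribution)" for g
  proof -
    obtain C n where *: "\<And>x. \<bar>F (g(e := x))\<bar> \<le> C * (1 + \<bar>x\<bar>) ^ n" using tame_growth[OF assms(3)] by blast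
    show ?thesis
    proof (rule ibp_1d[OF tame_has_pd[OF assms(3)] _ *])
      show "isCont (\<lambda>x. pd e F (g(e := x))) x" for x
        using tame_has_pd[OF tame_pd[OF assms(3)]] DERIV_isCont by blast
      show "integrable std_normal_distribution (\<lambda>x. x * F (g(e := x)))"
        using tame_section_integrable[OF t, of g e] by simp
      show "integrable std_normal_distribution (\<lambda>x. pd e F (g(e := x)))"
        by (rule tame_section_integrable[OF tame_pd[OF assms(3)]])
    qed
  qed
  then show ?thesis
    using assms t tame_pd[OF assms(3)] unfolding I(1)
    by (simp add: gauss_measure_insert[OF I(2,3)])
qed

section \<open>Rules for the expectation \<open>gE\<close>\<close>

lemma gE_const [simp]: "gE I (\<lambda>g. a) = a"
  using prob_space.prob_space[OF prob_space_gauss_measure[of I]] by (simp add: gE_def)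

lemma gE_add: "F \<in> tame I \<Longrightarrow> G \<in> tame I \<Longrightarrow> gE I (\<lambda>g. F g + G g) = gE I F + gE I G"
  unfolding gE_def by (intro Bochner_Integration.integral_add tame_integrable)

lemma gE_diff: "F \<in> tame I \<Longrightarrow> G \<in> tame I \<Longrightarrow> gE I (\<lambda>g. F g - G g) = gE I F - gE I G"
  unfolding gE_def by (intro Bochner_Integration.integral_diff tame_integrable)

lemma gE_cmult: "gE I (\<lambda>g. a * F g) = a * gE I F"
  unfolding gE_def by simp

lemma gE_sum:
  "(\<And>a. a \<in> A \<Longrightarrow> F a \<in> tame I) \<Longrightarrow> gE I (\<lambda>g. \<Sum>a\<in>A. F a g) = (\<Sum>a\<in>A. gE I (F a))"
  unfolding gE_def by (intro Bochner_Integration.integral_sum tame_integrable)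

lemma gE_mono: "F \<in> tame I \<Longrightarrow> G \<in> tame I \<Longrightarrow> (\<And>g. F g \<le> G g) \<Longrightarrow> gE I F \<le> gE I G"
  unfolding gE_def by (intro Bochner_Integration.integral_mono tame_integrable)

lemma gE_nonneg: "(\<And>g. 0 \<le> F g) \<Longrightarrow> 0 \<le> gE I F"
  unfolding gE_def by (intro Bochner_Integration.integral_nonneg)

text \<open>The expectation of (F x + G)^2 is a nonnegative quadratic polynomial in x, which bounds
  its discriminant.\<close>

lemma gE_Cauchy_Schwarz:
  assumes "F \<in> tame I" "G \<in> tame I"
  shows "\<bar>gE I (\<lambda>g. F g * G g)\<bar> \<le> sqrt (gE I (\<lambda>g. (F g)\<^sup>2) * gE I (\<lambda>g. (G g)\<^sup>2))"
proof -
  define a b c where "a = gE I (\<lambda>g. (F g)\<^sup>2)" and "b = gE I (\<lambda>g. (G g)\<^sup>2)"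
    and "c = gE I (\<lambda>g. F g * G g)"
  have ab: "0 \<le> a" "0 \<le> b" unfolding a_def b_def by (auto intro!: gE_nonneg)
  have q: "0 \<le> a * x\<^sup>2 + 2 * c * x + b" for x
  proof -
    have "0 \<le> gE I (\<lambda>g. (F g * x + G g)\<^sup>2)" by (intro gE_nonneg) simp
    also have "(\<lambda>g. (F g * x + G g)\<^sup>2) = (\<lambda>g. (x\<^sup>2 * (F g)\<^sup>2 + 2 * x * (F g * G g)) + (G g)\<^sup>2)"
      by (auto simp: power2_eq_square algebra_simps)
    also have "gE I \<dots> = x\<^sup>2 * a + 2 * x * c + b"
    proof -
      have t: "(\<lambda>g. x\<^sup>2 * (F g)\<^sup>2) \<in> tame I" "(\<lambda>g. 2 * x * (F g * G g)) \<in> tame I" "(\<lambda>g. (G g)\<^sup>2) \<in> tame I"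
        by (rule tame_mult tame_power tame_const assms)+
      show ?thesis
        unfolding a_def b_def c_def gE_add[OF tame_add[OF t(1,2)] t(3)] gE_add[OF t(1,2)] gE_cmult ..
    qed
    finally show ?thesis by (simp add: mult_ac)
  qed
  have "c\<^sup>2 \<le> a * b"
  proof (cases "a = 0")
    case True
    have "c = 0"
    proof (rule ccontr)
      assume "c \<noteq> 0"
      \<comment> \<open>With a = 0 the polynomial is linear, and at this point its value is
        -1.\<close>
      then show False using q[of "- (b + 1) / (2 * c)"] True by simp
    qed
    then show ?thesis using True by simp
  next
    case False
    \<comment> \<open>The minimiser is x = - c / a; multiplication by a turns the minimum into a b -
      c^2.\<close>
    then have "0 \<le> a * (a * (- c / a)\<^sup>2 + 2 * c * (- c / a) + b)"
      using q[of "- c / a"] ab(1) by (intro mult_nonneg_nonneg)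
    also have "\<dots> = a * b - c\<^sup>2" using False by (simp add: field_simps power2_eq_square)
    finally show ?thesis by simp
  qed
  then show ?thesis unfolding a_def b_def c_def by (metis real_sqrt_abs real_sqrt_le_iff)
qed

section \<open>Moment bounds\<close>

text \<open>The functions \<open>C\<close> are the constants in \<open>L\<^sup>2\<^sup>q\<close> bounds at scale \<open>x\<close>. Keeping them explicit makes
  every estimate uniform in the index set, in \<open>N\<close> and in the starting value.\<close>

definition Lq :: "'e set \<Rightarrow> (nat \<Rightarrow> real) \<Rightarrow> real \<Rightarrow> (('e \<Rightarrow> real) \<Rightarrow> real) \<Rightarrow> bool" where
  "Lq I C x F \<longleftrightarrow> F \<in> tame I \<and> 0 < x \<and> (\<forall>q. 0 \<le> C q) \<and>
     (\<forall>q\<ge>1. gE I (\<lambda>g. F g ^ (2 * q)) \<le> C q * x ^ (2 * q))"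

lemma Lq_tame: "Lq I C x F \<Longrightarrow> F \<in> tame I"
  by (simp add: Lq_def)

lemma Lq_mono:
  assumes "Lq I C x F" "x \<le> y" "\<And>q. C q \<le> D q"
  shows "Lq I D y F"
proof -
  have pos: "0 < x" "0 \<le> C q" "0 \<le> D q" for q
    using assms(1) assms(3)[of q] order_trans[OF _ assms(3)[of q]] by (auto simp: Lq_def)
  have "C q * x ^ (2 * q) \<le> D q * y ^ (2 * q)" for q
    using assms(2,3) pos by (intro mult_mono power_mono) (auto simp: less_imp_le)
  then show ?thesis
    using assms pos unfolding Lq_def by (meson order_trans less_le_trans)
qed

lemma Lq_rescale: "Lq I C (a * x) F \<Longrightarrow> 0 < a \<Longrightarrow> Lq I (\<lambda>q. C q * a ^ (2 * q)) x F"
  unfolding Lq_def by (simp add: power_mult_distrib mult_ac zero_less_mult_iff)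

lemma Lq_zero: "0 < x \<Longrightarrow> (\<And>q. 0 \<le> C q) \<Longrightarrow> Lq I C x (\<lambda>g. 0)"
  unfolding Lq_def by (auto simp: power_0_left)

lemma Lq_bounded:
  assumes "F \<in> tame I" "\<And>g. \<bar>F g\<bar> \<le> x" "0 < x"
  shows "Lq I (\<lambda>q. 1) x F"
  unfolding Lq_def
proof (intro conjI allI impI)
  fix q :: nat
  have "gE I (\<lambda>g. F g ^ (2 * q)) \<le> gE I (\<lambda>g. x ^ (2 * q))"
  proof (rule gE_mono)
    show "F g ^ (2 * q) \<le> x ^ (2 * q)" for g
      using power_mono[OF assms(2)[of g] abs_ge_zero, of "2 * q"] by (simp add: power_even_abs)
  qed (use assms(1) in auto)
  then show "gE I (\<lambda>g. F g ^ (2 * q)) \<le> 1 * x ^ (2 * q)" by simp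
qed (use assms in auto)

text \<open>Scales are strictly positive in \<open>Lq\<close>, so the factor \<open>b\<close> is
  allowed to exceed the absolute value of \<open>a\<close>, which may be zero.\<close>

lemma Lq_cmult:
  assumes "Lq I C x F" "\<bar>a\<bar> \<le> b" "0 < b"
  shows "Lq I C (b * x) (\<lambda>g. a * F g)"
proof -
  have "gE I (\<lambda>g. (a * F g) ^ (2 * q)) \<le> C q * (b * x) ^ (2 * q)" if "q \<ge> 1" for q
  proof -
    have "gE I (\<lambda>g. (a * F g) ^ (2 * q)) = a ^ (2 * q) * gE I (\<lambda>g. F g ^ (2 * q))"
      by (simp add: power_mult_distrib gE_cmult)
    also have "\<dots> \<le> b ^ (2 * q) * (C q * x ^ (2 * q))"
    proof (rule mult_mono)
      show "a ^ (2 * q) \<le> b ^ (2 * q)"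
        using power_mono[OF assms(2) abs_ge_zero, of "2 * q"] by (simp add: power_even_abs)
    qed (use assms that in \<open>auto simp: Lq_def intro!: gE_nonneg\<close>)
    finally show ?thesis by (simp add: power_mult_distrib mult_ac)
  qed
  then show ?thesis using assms unfolding Lq_def by auto
qed

text \<open>The loss is put into the scale and not into \<open>C\<close>, so that sums can be
  iterated with one fixed \<open>C\<close>. Of the factor 4, one 2 comes from
  \<open>even_power_add_le\<close> and the other from 2 <= 2^(2q), which absorbs the two equal
  terms.\<close>

lemma Lq_add:
  assumes "Lq I C x F" "Lq I C x G"
  shows "Lq I C (4 * x) (\<lambda>g. F g + G g)"
proof -
  have "gE I (\<lambda>g. (F g + G g) ^ (2 * q)) \<le> C q * (4 * x) ^ (2 * q)" if "q \<ge> 1" for q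
  proof -
    have t: "F \<in> tame I" "G \<in> tame I" using assms by (auto simp: Lq_def)
    have "gE I (\<lambda>g. (F g + G g) ^ (2 * q)) \<le> gE I (\<lambda>g. 2 ^ (2 * q) * (F g ^ (2 * q) + G g ^ (2 * q)))"
      by (rule gE_mono[OF _ _ even_power_add_le]) (intro tame_add tame_power tame_mult tame_const t)+
    also have "\<dots> = 2 ^ (2 * q) * (gE I (\<lambda>g. F g ^ (2 * q)) + gE I (\<lambda>g. G g ^ (2 * q)))"
      by (subst gE_cmult, subst gE_add) (auto intro: t)
    also have "\<dots> \<le> 2 ^ (2 * q) * (C q * x ^ (2 * q) + C q * x ^ (2 * q))"
      using assms that unfolding Lq_def by (intro mult_left_mono add_mono) auto
    also have "\<dots> \<le> 2 ^ (2 * q) * (2 ^ (2 * q) * (C q * x ^ (2 * q)))"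
    proof -
      have "(2::real) ^ 1 \<le> 2 ^ (2 * q)" using that by (intro power_increasing) auto
      moreover have "0 \<le> C q * x ^ (2 * q)" using assms unfolding Lq_def by auto
      ultimately show ?thesis
        using mult_right_mono[of "2" "2 ^ (2 * q)" "C q * x ^ (2 * q)"] by (intro mult_left_mono) auto
    qed
    also have "\<dots> = C q * (4 * x) ^ (2 * q)"
    proof -
      have "(4::real) ^ (2 * q) = 2 ^ (2 * q) * 2 ^ (2 * q)"
        by (simp flip: power_mult_distrib)
      then show ?thesis by (simp add: power_mult_distrib mult_ac)
    qed
    finally show ?thesis .
  qed
  then show ?thesis using assms unfolding Lq_def by auto
qed

text \<open>Jensen's inequality for the convex function x^(2q) with equal weights.\<close>

lemma sum_even_power_le:
  fixes f :: "'a \<Rightarrow> real"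
  assumes "finite A" "q \<ge> 1"
  shows "(\<Sum>a\<in>A. f a) ^ (2 * q) \<le> real (card A) ^ (2 * q - 1) * (\<Sum>a\<in>A. f a ^ (2 * q))"
proof (cases "A = {}")
  case True
  then show ?thesis using assms by (simp add: power_0_left)
next
  case False
  define n where "n = real (card A)"
  have n: "0 < n" using False assms by (simp add: n_def card_gt_0_iff)
  have cvx: "convex_on UNIV (\<lambda>x::real. x ^ (2 * q))"
    by (rule convex_power_even) simp
  have "(\<Sum>a\<in>A. (1 / n) *\<^sub>R f a) ^ (2 * q) \<le> (\<Sum>a\<in>A. (1 / n) * f a ^ (2 * q))"
    using convex_on_sum[OF \<open>finite A\<close> False cvx, of "\<lambda>a. 1 / n" f] n by (auto simp: n_def)
  then have "((1 / n) * (\<Sum>a\<in>A. f a)) ^ (2 * q) \<le> (1 / n) * (\<Sum>a\<in>A. f a ^ (2 * q))"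
    by (simp add: sum_distrib_left)
  then have "(1 / n) ^ (2 * q) * (\<Sum>a\<in>A. f a) ^ (2 * q) \<le> (1 / n) * (\<Sum>a\<in>A. f a ^ (2 * q))"
    by (simp only: power_mult_distrib)
  then have "n ^ (2 * q) * ((1 / n) ^ (2 * q) * (\<Sum>a\<in>A. f a) ^ (2 * q)) \<le> n ^ (2 * q) * ((1 / n) * (\<Sum>a\<in>A. f a ^ (2 * q)))"
    using n by (intro mult_left_mono) auto
  moreover have "n ^ (2 * q) * ((1 / n) ^ (2 * q) * S) = S" for S
    using n by (simp add: power_one_over)
  moreover have "n ^ (2 * q) * ((1 / n) * S) = n ^ (2 * q - 1) * S" for S
    using n assms by (simp add: power_eq_if[of n "2 * q"])
  ultimately show ?thesis unfolding n_def by (simp only:)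
qed

text \<open>\<open>n\<close> is a positive upper bound for the cardinality, so that an empty
  \<open>A\<close> still has a positive scale.\<close>

lemma Lq_sum:
  assumes "finite A" "real (card A) \<le> n" "0 < n" "0 < x" "\<And>q. 0 \<le> C q" "\<And>a. a \<in> A \<Longrightarrow> Lq I C x (F a)"
  shows "Lq I C (n * x) (\<lambda>g. \<Sum>a\<in>A. F a g)"
proof -
  have t: "F a \<in> tame I" if "a \<in> A" for a using assms that by (auto simp: Lq_def)
  have "gE I (\<lambda>g. (\<Sum>a\<in>A. F a g) ^ (2 * q)) \<le> C q * (n * x) ^ (2 * q)" if "q \<ge> 1" for q
  proof -
    define m where "m = real (card A)"
    have "gE I (\<lambda>g. (\<Sum>a\<in>A. F a g) ^ (2 * q)) \<le> gE I (\<lambda>g. m ^ (2 * q - 1) * (\<Sum>a\<in>A. F a g ^ (2 * q)))"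
      unfolding m_def
      by (rule gE_mono[OF _ _ sum_even_power_le[OF assms(1) that]])
        (intro tame_sum tame_power tame_mult tame_const t; assumption)+
    also have "\<dots> = m ^ (2 * q - 1) * (\<Sum>a\<in>A. gE I (\<lambda>g. F a g ^ (2 * q)))"
      by (subst gE_cmult, subst gE_sum) (auto intro: t)
    also have "\<dots> \<le> m ^ (2 * q - 1) * (\<Sum>a\<in>A. C q * x ^ (2 * q))"
      using assms that unfolding Lq_def m_def by (intro mult_left_mono sum_mono) auto
    also have "\<dots> = m ^ (2 * q) * (C q * x ^ (2 * q))"
      using that by (simp add: m_def power_eq_if[of "real (card A)" "2 * q"])
    also have "\<dots> \<le> n ^ (2 * q) * (C q * x ^ (2 * q))"
      using assms unfolding m_def by (intro mult_right_mono power_mono) auto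
    finally show ?thesis by (simp add: power_mult_distrib mult_ac)
  qed
  then show ?thesis using assms t unfolding Lq_def by auto
qed

text \<open>Cauchy-Schwarz applied to F^(2q) G^(2q) asks for the moments of order 4q of the factors,
  hence the argument \<open>2 * q\<close>. This doubling is why bounds are kept for all exponents at
  once.\<close>

definition cm :: "(nat \<Rightarrow> real) \<Rightarrow> (nat \<Rightarrow> real) \<Rightarrow> nat \<Rightarrow> real" where
  "cm C D q = sqrt (C (2 * q) * D (2 * q))"

lemma Lq_mult:
  assumes "Lq I C x F" "Lq I D y G"
  shows "Lq I (cm C D) (x * y) (\<lambda>g. F g * G g)"
proof -
  have t: "F \<in> tame I" "G \<in> tame I" using assms by (auto simp: Lq_def)
  have "gE I (\<lambda>g. (F g * G g) ^ (2 * q)) \<le> cm C D q * (x * y) ^ (2 * q)" if "q \<ge> 1" for q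
  proof -
    have e: "(r ^ (2 * q))\<^sup>2 = r ^ (2 * (2 * q))" for r :: real
      by (simp only: power_mult[symmetric] mult_ac)
    have "gE I (\<lambda>g. (F g * G g) ^ (2 * q)) \<le> \<bar>gE I (\<lambda>g. F g ^ (2 * q) * G g ^ (2 * q))\<bar>"
      by (simp only: power_mult_distrib abs_ge_self)
    also have "\<dots> \<le> sqrt (gE I (\<lambda>g. F g ^ (2 * (2 * q))) * gE I (\<lambda>g. G g ^ (2 * (2 * q))))"
      using gE_Cauchy_Schwarz[OF tame_power[OF t(1)] tame_power[OF t(2)], of "2 * q" "2 * q"]
      unfolding e .
    also have "\<dots> \<le> sqrt ((C (2 * q) * x ^ (2 * (2 * q))) * (D (2 * q) * y ^ (2 * (2 * q))))"
    proof (intro real_sqrt_le_mono mult_mono)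
      have "1 \<le> 2 * q" using that by simp
      then show "gE I (\<lambda>g. F g ^ (2 * (2 * q))) \<le> C (2 * q) * x ^ (2 * (2 * q))"
        "gE I (\<lambda>g. G g ^ (2 * (2 * q))) \<le> D (2 * q) * y ^ (2 * (2 * q))"
        using assms unfolding Lq_def by blast+
    qed (use assms in \<open>auto simp: Lq_def zero_le_even_power intro!: gE_nonneg\<close>)
    also have "\<dots> = sqrt ((C (2 * q) * D (2 * q)) * ((x * y) ^ (2 * q))\<^sup>2)"
      unfolding e[symmetric] by (simp only: power_mult_distrib mult_ac)
    also have "\<dots> = cm C D q * (x * y) ^ (2 * q)"
      unfolding real_sqrt_mult real_sqrt_abs cm_def by simp
    finally show ?thesis .
  qed
  then show ?thesis using assms unfolding Lq_def cm_def by auto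
qed

text \<open>The passage from moment bounds to expectations: the second moment of \<open>F\<close>
  suffices, and the bounded factor \<open>W\<close> costs no exponent.\<close>

lemma Lq_gE:
  assumes "Lq I C x F" "W \<in> tame I" "\<And>g. \<bar>W g\<bar> \<le> b"
  shows "\<bar>gE I (\<lambda>g. W g * F g)\<bar> \<le> b * (sqrt (C 1) * x)"
proof -
  have t: "F \<in> tame I" using assms by (auto simp: Lq_def)
  have b: "0 \<le> b" using assms(3)[of undefined] by auto
  have "\<bar>gE I (\<lambda>g. W g * F g)\<bar> \<le> sqrt (gE I (\<lambda>g. (W g)\<^sup>2) * gE I (\<lambda>g. (F g)\<^sup>2))"
    by (rule gE_Cauchy_Schwarz[OF assms(2) t])
  also have "\<dots> \<le> sqrt (b\<^sup>2 * (C 1 * x\<^sup>2))"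
  proof (intro real_sqrt_le_mono mult_mono)
    have "gE I (\<lambda>g. (W g)\<^sup>2) \<le> gE I (\<lambda>g. b\<^sup>2)"
      using assms b by (intro gE_mono) (auto simp: abs_le_square_iff[symmetric])
    then show "gE I (\<lambda>g. (W g)\<^sup>2) \<le> b\<^sup>2" by simp
    show "gE I (\<lambda>g. (F g)\<^sup>2) \<le> C 1 * x\<^sup>2" using assms(1) unfolding Lq_def by (auto dest: spec[of _ 1])
  qed (auto intro!: gE_nonneg)
  also have "\<dots> = b * (sqrt (C 1) * x)"
    using assms(1) b by (simp add: real_sqrt_mult Lq_def)
  finally show ?thesis .
qed

section \<open>Iterated partial derivatives\<close>

fun pds :: "'e list \<Rightarrow> (('e \<Rightarrow> real) \<Rightarrow> real) \<Rightarrow> ('e \<Rightarrow> real) \<Rightarrow> real" where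
  "pds [] F = F"
| "pds (e # es) F = pds es (pd e F)"

lemma tame_pds [intro]: "F \<in> tame I \<Longrightarrow> pds es F \<in> tame I"
  by (induction es arbitrary: F) auto

lemma pds_append: "pds (es @ fs) F = pds fs (pds es F)"
  by (induction es arbitrary: F) auto

lemma pds_zero [simp]: "pds es (\<lambda>g. 0) = (\<lambda>g. 0)"
  by (induction es) auto

lemma pds_const: "pds es (\<lambda>g. a) = (\<lambda>g. if es = [] then a else 0)"
  by (cases es) auto

lemma pds_add: "F \<in> tame I \<Longrightarrow> G \<in> tame I \<Longrightarrow> pds es (\<lambda>g. F g + G g) = (\<lambda>g. pds es F g + pds es G g)"
  by (induction es arbitrary: F G) (auto simp: pd_add[of _ I] tame_pd)

lemma pds_cmult: "F \<in> tame I \<Longrightarrow> pds es (\<lambda>g. a * F g) = (\<lambda>g. a * pds es F g)"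
  by (induction es arbitrary: F) (auto simp: pd_cmult[of _ I] tame_pd)

lemma pds_diff: "F \<in> tame I \<Longrightarrow> G \<in> tame I \<Longrightarrow> pds es (\<lambda>g. F g - G g) = (\<lambda>g. pds es F g - pds es G g)"
  by (induction es arbitrary: F G) (auto simp: pd_diff[of _ I] tame_pd)

lemma pds_sum:
  "(\<And>a. a \<in> A \<Longrightarrow> F a \<in> tame I) \<Longrightarrow> pds es (\<lambda>g. \<Sum>a\<in>A. F a g) = (\<lambda>g. \<Sum>a\<in>A. pds es (F a) g)"
  by (induction es arbitrary: F) (auto simp: pd_sum[of _ _ I] tame_pd)

lemma pds_outside:
  assumes "F \<in> tame I" "\<not> set es \<subseteq> I" shows "pds es F = (\<lambda>g. 0)"
  using assms
proof (induction es arbitrary: F)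
  case (Cons e es)
  then show ?case by (cases "e \<in> I") (auto simp: pd_outside tame_pd)
qed auto

text \<open>Each derivative splits a product into two and costs one use of \<open>Lq_add\<close>,
  hence the factor 4 per derivative. The hypothesis ranges over multiset splittings of
  \<open>es\<close>, which include the ordered ones that occur and spare the induction any
  bookkeeping about order.\<close>

lemma leibniz_Lq:
  assumes "F \<in> tame I" "G \<in> tame I"
    and "\<And>A B. mset A + mset B = mset es \<Longrightarrow> Lq I C x (\<lambda>g. pds A F g * pds B G g)"
  shows "Lq I C (4 ^ length es * x) (pds es (\<lambda>g. F g * G g))"
  using assms
proof (induction es arbitrary: F G)
  case Nil
  then show ?case using Nil(3)[of "[]" "[]"] by simp
next
  case (Cons e es)
  have 1: "Lq I C (4 ^ length es * x) (pds es (\<lambda>g. pd e F g * G g))"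
    using Cons.prems(3)[of "e # _"] by (intro Cons.IH Cons.prems tame_pd) auto
  have 2: "Lq I C (4 ^ length es * x) (pds es (\<lambda>g. F g * pd e G g))"
    using Cons.prems(3)[of _ "e # _"] by (intro Cons.IH Cons.prems tame_pd) auto
  have "pds (e # es) (\<lambda>g. F g * G g) = (\<lambda>g. pds es (\<lambda>g. pd e F g * G g) g + pds es (\<lambda>g. F g * pd e G g) g)"
    using Cons.prems(1,2) by (simp add: pd_mult[of _ I]) (subst pds_add[of _ I], auto)
  then show ?case using Lq_add[OF 1 2] by (simp add: mult_ac)
qed

section \<open>Moments of divergences\<close>

definition cnt :: "'e set \<Rightarrow> 'e list \<Rightarrow> nat" where
  "cnt V es = length (filter (\<lambda>e. e \<notin> V) es)"

definition wt :: "real \<Rightarrow> 'e set \<Rightarrow> 'e \<Rightarrow> real" where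
  "wt s V e = (if e \<in> V then 1 else s)"

text \<open>A derivative in a direction of \<open>L\<close> outside the exceptional set \<open>V\<close> gains a factor \<open>s\<close>, which will be
  \<open>1 / sqrt N\<close>. For a vector field \<open>u\<close> on \<open>L\<close> one more factor is gained at entries that are neither
  exceptional nor differentiated in their own direction; there are boundedly many exceptions.\<close>

definition scalar_bd :: "'e set \<Rightarrow> 'e set \<Rightarrow> real \<Rightarrow> 'e set \<Rightarrow> (nat \<Rightarrow> nat \<Rightarrow> real) \<Rightarrow> real
    \<Rightarrow> (('e \<Rightarrow> real) \<Rightarrow> real) \<Rightarrow> bool" where
  "scalar_bd I L s V C K F \<longleftrightarrow>
     (\<forall>es. set es \<subseteq> L \<longrightarrow> Lq I (C (length es)) (K * s ^ cnt V es) (pds es F))"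

definition vector_bd :: "'e set \<Rightarrow> 'e set \<Rightarrow> real \<Rightarrow> 'e set \<Rightarrow> (nat \<Rightarrow> nat \<Rightarrow> real) \<Rightarrow> real
    \<Rightarrow> ('e \<Rightarrow> ('e \<Rightarrow> real) \<Rightarrow> real) \<Rightarrow> bool" where
  "vector_bd I L s V C K u \<longleftrightarrow>
     (\<forall>es e. set es \<subseteq> L \<longrightarrow> e \<in> L \<longrightarrow>
        Lq I (C (length es)) (K * (s ^ cnt V es * wt s (V \<union> set es) e)) (pds es (u e)))"

text \<open>The adjoint of the gradient under the Gaussian measure (the Skorokhod integral).\<close>

definition divergence :: "'e set \<Rightarrow> ('e \<Rightarrow> ('e \<Rightarrow> real) \<Rightarrow> real) \<Rightarrow> ('e \<Rightarrow> real) \<Rightarrow> real" where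
  "divergence L u = (\<lambda>g. \<Sum>e\<in>L. g e * u e g - pd e (u e) g)"

text \<open>The double sum dominates every pair of orders that a Leibniz splitting can produce; the
  power of \<open>4 ^ r\<close> is the scale factor of \<open>leibniz_Lq\<close> moved into the
  constant.\<close>

definition cml :: "(nat \<Rightarrow> nat \<Rightarrow> real) \<Rightarrow> (nat \<Rightarrow> nat \<Rightarrow> real) \<Rightarrow> nat \<Rightarrow> nat \<Rightarrow> real" where
  "cml C D r q = (\<Sum>a\<le>r. \<Sum>b\<le>r. cm (C a) (D b) q) * (4 ^ r) ^ (2 * q)"

lemma cm_nonneg: "(\<And>q. 0 \<le> C q) \<Longrightarrow> (\<And>q. 0 \<le> D q) \<Longrightarrow> 0 \<le> cm C D q"
  by (simp add: cm_def)

lemma cml_nonneg: "(\<And>r q. 0 \<le> C r q) \<Longrightarrow> (\<And>r q. 0 \<le> D r q) \<Longrightarrow> 0 \<le> cml C D r q"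
  unfolding cml_def by (intro mult_nonneg_nonneg sum_nonneg cm_nonneg) auto

lemma cm_le_sum:
  fixes C D :: "nat \<Rightarrow> nat \<Rightarrow> real"
  assumes "\<And>r q. 0 \<le> C r q" "\<And>r q. 0 \<le> D r q" "a \<le> r" "b \<le> r"
  shows "cm (C a) (D b) q \<le> (\<Sum>a\<le>r. \<Sum>b\<le>r. cm (C a) (D b) q)"
proof -
  have "cm (C a) (D b) q \<le> (\<Sum>b\<le>r. cm (C a) (D b) q)"
    using assms by (intro member_le_sum) (auto intro!: cm_nonneg)
  also have "\<dots> \<le> (\<Sum>a\<le>r. \<Sum>b\<le>r. cm (C a) (D b) q)"
    using assms by (intro member_le_sum[of a "{..r}" "\<lambda>a. \<Sum>b\<le>r. cm (C a) (D b) q"])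
      (auto intro!: cm_nonneg sum_nonneg)
  finally show ?thesis .
qed

text \<open>The scales \<open>x\<close> and \<open>y\<close> depend on the sublist and not merely on
  its length, since the gain of a factor depends on which couplings differentiate it;
  \<open>z\<close> has to dominate all their products.\<close>

lemma leibniz_cml:
  assumes "F \<in> tame I" "G \<in> tame I" and nn: "\<And>r q. 0 \<le> C r q" "\<And>r q. 0 \<le> D r q"
    and F: "\<And>A B. mset A + mset B = mset es \<Longrightarrow> Lq I (C (length A)) (x A) (pds A F)"
    and G: "\<And>A B. mset A + mset B = mset es \<Longrightarrow> Lq I (D (length B)) (y B) (pds B G)"
    and le: "\<And>A B. mset A + mset B = mset es \<Longrightarrow> x A * y B \<le> z"
  shows "Lq I (cml C D (length es)) z (pds es (\<lambda>g. F g * G g))"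
  unfolding cml_def
proof (rule Lq_rescale, rule leibniz_Lq[OF assms(1,2)])
  fix A B assume *: "mset A + mset B = mset es"
  then have "length A + length B = length es"
    by (metis size_mset size_union)
  then have "length A \<le> length es" "length B \<le> length es" by auto
  then show "Lq I (\<lambda>q. \<Sum>a\<le>length es. \<Sum>b\<le>length es. cm (C a) (D b) q) z (\<lambda>g. pds A F g * pds B G g)"
    using F[OF *] G[OF *] le[OF *] cm_le_sum[OF nn] by (intro Lq_mono[OF Lq_mult])
qed auto

lemma cnt_mset: "mset A + mset B = mset es \<Longrightarrow> cnt V A + cnt V B = cnt V es"
proof -
  assume "mset A + mset B = mset es"
  then have "filter_mset (\<lambda>e. e \<notin> V) (mset A) + filter_mset (\<lambda>e. e \<notin> V) (mset B) = filter_mset (\<lambda>e. e \<notin> V) (mset es)"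
    by (metis filter_union_mset)
  then show ?thesis unfolding cnt_def by (metis mset_filter size_mset size_union)
qed

lemma mset_set_subset: "mset A + mset B = mset es \<Longrightarrow> set A \<subseteq> set es \<and> set B \<subseteq> set es"
  by (metis Un_upper1 Un_upper2 set_mset_mset set_mset_union)

lemma cnt_mono: "V \<subseteq> V' \<Longrightarrow> cnt V' es \<le> cnt V es"
  unfolding cnt_def by (induction es) auto

lemma wt_bounds: "0 < s \<Longrightarrow> s \<le> 1 \<Longrightarrow> 0 < wt s V e \<and> wt s V e \<le> 1 \<and> s \<le> wt s V e"
  by (simp add: wt_def)

lemma wt_mono: "0 < s \<Longrightarrow> s \<le> 1 \<Longrightarrow> V \<subseteq> V' \<Longrightarrow> wt s V e \<le> wt s V' e"
  by (auto simp: wt_def)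

lemma scalar_bd_tame: "scalar_bd I L s V C K F \<Longrightarrow> F \<in> tame I"
  unfolding scalar_bd_def by (drule spec[of _ "[]"]) (auto dest: Lq_tame)

lemma scalar_bd_pos: "scalar_bd I L s V C K F \<Longrightarrow> 0 < K"
  unfolding scalar_bd_def Lq_def cnt_def by (drule spec[of _ "[]"]) auto

lemma vector_bd_tame: "vector_bd I L s V C K u \<Longrightarrow> e \<in> L \<Longrightarrow> u e \<in> tame I"
  unfolding vector_bd_def by (drule spec[of _ "[]"]) (auto dest: Lq_tame)

lemma scalar_bd_mono:
  assumes "scalar_bd I L s V C K F" "0 < s" "s \<le> 1" "V \<subseteq> V'" "\<And>r q. C r q \<le> D r q"
  shows "scalar_bd I L s V' D K F"
  unfolding scalar_bd_def
proof (intro allI impI)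
  fix es assume "set es \<subseteq> L"
  then have "Lq I (C (length es)) (K * s ^ cnt V es) (pds es F)" using assms(1) by (auto simp: scalar_bd_def)
  then show "Lq I (D (length es)) (K * s ^ cnt V' es) (pds es F)"
    using assms scalar_bd_pos[OF assms(1)]
    by (elim Lq_mono) (auto intro!: power_decreasing cnt_mono)
qed

lemma vector_bd_mono:
  assumes "vector_bd I L s V C K u" "0 < K" "0 < s" "s \<le> 1" "V \<subseteq> V'" "\<And>r q. C r q \<le> D r q"
  shows "vector_bd I L s V' D K u"
  unfolding vector_bd_def
proof (intro allI impI)
  fix es e assume "set es \<subseteq> L" "e \<in> L"
  then have "Lq I (C (length es)) (K * (s ^ cnt V es * wt s (V \<union> set es) e)) (pds es (u e))"
    using assms(1) by (auto simp: vector_bd_def)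
  then show "Lq I (D (length es)) (K * (s ^ cnt V' es * wt s (V' \<union> set es) e)) (pds es (u e))"
  proof (rule Lq_mono)
    have "s ^ cnt V es \<le> s ^ cnt V' es" using assms by (intro power_decreasing cnt_mono) auto
    moreover have "wt s (V \<union> set es) e \<le> wt s (V' \<union> set es) e" using assms by (intro wt_mono) auto
    ultimately show "K * (s ^ cnt V es * wt s (V \<union> set es) e) \<le> K * (s ^ cnt V' es * wt s (V' \<union> set es) e)"
      using assms wt_bounds[of s "V \<union> set es" e] by (intro mult_left_mono mult_mono) auto
  qed (use assms in auto)
qed

lemma scalar_bd_mult:
  assumes "scalar_bd I L s V C K F" "scalar_bd I L s V D K' G" "\<And>r q. 0 \<le> C r q" "\<And>r q. 0 \<le> D r q"
  shows "scalar_bd I L s V (cml C D) (K * K') (\<lambda>g. F g * G g)"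
  unfolding scalar_bd_def
proof (intro allI impI)
  fix es assume es: "set es \<subseteq> L"
  show "Lq I (cml C D (length es)) (K * K' * s ^ cnt V es) (pds es (\<lambda>g. F g * G g))"
  proof (rule leibniz_cml[where x = "\<lambda>A. K * s ^ cnt V A" and y = "\<lambda>B. K' * s ^ cnt V B"])
    fix A B assume *: "mset A + mset B = mset es"
    then have "set A \<subseteq> L" "set B \<subseteq> L" using mset_set_subset[OF *] es by auto
    then show "Lq I (C (length A)) (K * s ^ cnt V A) (pds A F)" "Lq I (D (length B)) (K' * s ^ cnt V B) (pds B G)"
      using assms(1,2) by (auto simp: scalar_bd_def)
    show "K * s ^ cnt V A * (K' * s ^ cnt V B) \<le> K * K' * s ^ cnt V es"
      unfolding cnt_mset[OF *, symmetric] by (simp add: power_add mult_ac)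
  qed (use assms scalar_bd_tame in auto)
qed

lemma scalar_bd_pd:
  assumes "scalar_bd I L s V C K F" "e \<in> L"
  shows "scalar_bd I L s V (\<lambda>r. C (Suc r)) (K * wt s V e) (pd e F)"
  unfolding scalar_bd_def
proof (intro allI impI)
  fix es assume "set es \<subseteq> L"
  then have "Lq I (C (length (e # es))) (K * s ^ cnt V (e # es)) (pds (e # es) F)"
    using assms unfolding scalar_bd_def by (metis insert_subset list.simps(15))
  moreover have "s ^ cnt V (e # es) = wt s V e * s ^ cnt V es"
    by (simp add: cnt_def wt_def)
  ultimately show "Lq I (C (Suc (length es))) (K * wt s V e * s ^ cnt V es) (pds es (pd e F))"
    by (simp add: mult_ac)
qed

text \<open>The extra gain of an entry is lost once it has been differentiated in its own direction.
  Recording \<open>e\<close> as exceptional keeps this information after the derivative in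
  \<open>e\<close> has become part of the field.\<close>

lemma vector_bd_pd:
  assumes "vector_bd I L s V C K u" "e \<in> L" "0 < K" "0 < s" "s \<le> 1"
  shows "vector_bd I L s (insert e V) (\<lambda>r. C (Suc r)) (K * wt s V e) (\<lambda>e'. pd e (u e'))"
  unfolding vector_bd_def
proof (intro allI impI)
  fix es e' assume "set es \<subseteq> L" "e' \<in> L"
  then have *: "Lq I (C (length (e # es))) (K * (s ^ cnt V (e # es) * wt s (V \<union> set (e # es)) e')) (pds (e # es) (u e'))"
    using assms unfolding vector_bd_def by (metis insert_subset list.simps(15))
  have "s ^ cnt V (e # es) = wt s V e * s ^ cnt V es"
    by (simp add: cnt_def wt_def)
  also have "\<dots> \<le> wt s V e * s ^ cnt (insert e V) es"
    using assms wt_bounds[of s V e] by (intro mult_left_mono power_decreasing cnt_mono) auto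
  finally have "K * (s ^ cnt V (e # es) * wt s (insert e V \<union> set es) e')
      \<le> K * (wt s V e * s ^ cnt (insert e V) es * wt s (insert e V \<union> set es) e')"
    using assms wt_bounds[of s "insert e V \<union> set es" e'] by (intro mult_left_mono mult_right_mono) auto
  then have le: "K * (s ^ cnt V (e # es) * wt s (V \<union> set (e # es)) e')
      \<le> K * wt s V e * (s ^ cnt (insert e V) es * wt s (insert e V \<union> set es) e')"
    by (simp only: mult.assoc list.set Un_insert_left Un_insert_right)
  have "Lq I (C (length (e # es)))
      (K * wt s V e * (s ^ cnt (insert e V) es * wt s (insert e V \<union> set es) e')) (pds (e # es) (u e'))"
    by (rule Lq_mono[OF * le order_refl])
  then show "Lq I (C (Suc (length es)))
      (K * wt s V e * (s ^ cnt (insert e V) es * wt s (insert e V \<union> set es) e')) (pds es (pd e (u e')))"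
    by (simp only: pds.simps list.size add_Suc_right add_0_right)
qed

text \<open>The gain \<open>wt s V e\<close> is extracted as a constant. If \<open>e\<close> occurs
  among the derivatives and is not in \<open>V\<close>, the entry has lost that gain, but making
  \<open>e\<close> exceptional removes at least one factor s from the bound to be shown, which
  compensates.\<close>

lemma vector_bd_at:
  assumes "vector_bd I L s V C K u" "e \<in> L" "0 < K" "0 < s" "s \<le> 1"
  shows "scalar_bd I L s (insert e V) C (K * wt s V e) (u e)"
  unfolding scalar_bd_def
proof (intro allI impI)
  fix es assume "set es \<subseteq> L"
  then have *: "Lq I (C (length es)) (K * (s ^ cnt V es * wt s (V \<union> set es) e)) (pds es (u e))"
    using assms(1,2) unfolding vector_bd_def by blast
  have "s ^ cnt V es * wt s (V \<union> set es) e \<le> wt s V e * s ^ cnt (insert e V) es"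
  proof (cases "e \<in> set es \<and> e \<notin> V")
    case True
    then have "cnt (insert e V) es + 1 \<le> cnt V es"
    proof (induction es)
      case (Cons x es)
      then show ?case using cnt_mono[of V "insert e V" es] by (auto simp: cnt_def)
    qed simp
    then have "s ^ cnt V es \<le> s ^ (cnt (insert e V) es + 1)"
      using assms by (intro power_decreasing) auto
    then show ?thesis using True by (simp add: wt_def mult_ac)
  next
    case False
    then have "wt s (V \<union> set es) e = wt s V e" by (auto simp: wt_def)
    moreover have "s ^ cnt V es \<le> s ^ cnt (insert e V) es"
      using assms by (intro power_decreasing cnt_mono) auto
    ultimately show ?thesis using wt_bounds[of s V e] assms by (simp add: mult_ac)
  qed
  then show "Lq I (C (length es)) (K * wt s V e * s ^ cnt (insert e V) es) (pds es (u e))"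
    using assms(3) by (intro Lq_mono[OF *]) (auto simp: mult_ac)
qed

lemma divergence_tame:
  assumes "L \<subseteq> I" "\<And>e. e \<in> L \<Longrightarrow> u e \<in> tame I" shows "divergence L u \<in> tame I"
  unfolding divergence_def using assms by (intro tame_sum tame_diff tame_mult tame_coord tame_pd) auto

text \<open>In each direction the correction term of the divergence is exactly the part of the
  integration by parts in which the derivative falls on \<open>u e\<close>; what remains falls on
  \<open>H\<close>.\<close>

lemma gE_divergence:
  assumes "finite I" "L \<subseteq> I" "\<And>e. e \<in> L \<Longrightarrow> u e \<in> tame I" "H \<in> tame I"
  shows "gE I (\<lambda>g. divergence L u g * H g) = (\<Sum>e\<in>L. gE I (\<lambda>g. u e g * pd e H g))"
proof -
  have "gE I (\<lambda>g. divergence L u g * H g) = gE I (\<lambda>g. \<Sum>e\<in>L. g e * (u e g * H g) - pd e (u e) g * H g)"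
    unfolding divergence_def by (simp add: sum_distrib_right left_diff_distrib mult.assoc)
  also have "\<dots> = (\<Sum>e\<in>L. gE I (\<lambda>g. g e * (u e g * H g) - pd e (u e) g * H g))"
    using assms by (intro gE_sum tame_diff tame_mult tame_coord tame_pd) auto
  also have "\<dots> = (\<Sum>e\<in>L. gE I (\<lambda>g. u e g * pd e H g))"
  proof (rule sum.cong[OF refl])
    fix e assume "e \<in> L"
    then have e: "e \<in> I" "u e \<in> tame I" using assms by auto
    note t = e tame_pd[OF e(2), of e] tame_pd[OF assms(4), of e] assms(4)
    have "gE I (\<lambda>g. g e * (u e g * H g) - pd e (u e) g * H g)
        = gE I (\<lambda>g. g e * (u e g * H g)) - gE I (\<lambda>g. pd e (u e) g * H g)"
      using t by (intro gE_diff tame_mult tame_coord)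
    also have "gE I (\<lambda>g. g e * (u e g * H g)) = gE I (pd e (\<lambda>g. u e g * H g))"
      using t assms(1) by (intro ibp tame_mult)
    also have "\<dots> = gE I (\<lambda>g. pd e (u e) g * H g) + gE I (\<lambda>g. u e g * pd e H g)"
      unfolding pd_mult[OF t(2,5)] using t by (intro gE_add tame_mult)
    finally show "gE I (\<lambda>g. g e * (u e g * H g) - pd e (u e) g * H g) = gE I (\<lambda>g. u e g * pd e H g)"
      by simp
  qed
  finally show ?thesis .
qed

text \<open>The commutator of a derivative with its adjoint: the extra term \<open>u e\<close> comes
  from differentiating the explicit coordinate \<open>g e\<close>, and the correction terms match by
  \<open>pd_commute\<close>.\<close>

lemma pd_divergence:
  assumes "finite L" "L \<subseteq> I" "\<And>e. e \<in> L \<Longrightarrow> u e \<in> tame I"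
  shows "pd e (divergence L u) = (\<lambda>g. (if e \<in> L then u e g else 0) + divergence L (\<lambda>e'. pd e (u e')) g)"
proof -
  have *: "pd e (\<lambda>g. g a * u a g - pd a (u a) g) = 
      (\<lambda>g. (if e = a then u a g else 0) + (g a * pd e (u a) g - pd a (pd e (u a)) g))" if "a \<in> L" for a
  proof -
    have t: "u a \<in> tame I" "(\<lambda>g. g a) \<in> tame I" using assms that by auto
    show ?thesis
      unfolding pd_diff[OF tame_mult[OF t(2,1)] tame_pd[OF t(1)]] pd_mult[OF t(2,1)] pd_coord
        pd_commute[OF t(1), of e a] by auto
  qed
  have "pd e (divergence L u) = (\<lambda>g. \<Sum>a\<in>L. pd e (\<lambda>g. g a * u a g - pd a (u a) g) g)"
    unfolding divergence_def using assms by (intro pd_sum[of _ _ I] tame_diff tame_mult tame_coord tame_pd) auto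
  also have "\<dots> = (\<lambda>g. (\<Sum>a\<in>L. if e = a then u a g else 0) + (\<Sum>a\<in>L. g a * pd e (u a) g - pd a (pd e (u a)) g))"
    by (intro ext) (simp add: * sum.distrib)
  finally show ?thesis using assms by (simp add: divergence_def)
qed

text \<open>A product of \<open>n\<close> divergences is integrated by parts in one of its factors. This differentiates the
  other factors or \<open>F\<close> and leaves at most \<open>n - 1\<close> divergences, so that induction on \<open>n\<close> avoids any
  loss in the power of \<open>s\<close>.\<close>

definition moment_const :: "'e itself \<Rightarrow> nat \<Rightarrow> (nat \<Rightarrow> nat \<Rightarrow> real) \<Rightarrow> nat \<Rightarrow> real \<Rightarrow> bool" where
  "moment_const T v C n B \<longleftrightarrow> (\<forall>(I :: 'e set) L s V (S :: nat set) K F Ku u.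
     finite I \<longrightarrow> L \<subseteq> I \<longrightarrow> 0 < s \<longrightarrow> s \<le> 1 \<longrightarrow> s\<^sup>2 * real (card L) \<le> 1 \<longrightarrow> finite V \<longrightarrow> card V \<le> v \<longrightarrow>
     finite S \<longrightarrow> card S = n \<longrightarrow> scalar_bd I L s V C K F \<longrightarrow> (\<forall>a\<in>S. 0 < Ku a \<and> vector_bd I L s V C (Ku a) (u a)) \<longrightarrow>
     \<bar>gE I (\<lambda>g. (\<Prod>a\<in>S. divergence L (u a) g) * F g)\<bar> \<le> B * (K * (\<Prod>a\<in>S. Ku a)))"

lemma moment_constD:
  fixes I :: "'e set" and S :: "nat set"
  assumes "moment_const TYPE('e) v C n B" "finite I" "L \<subseteq> I" "0 < s" "s \<le> 1" "s\<^sup>2 * real (card L) \<le> 1" "finite V" "card V \<le> v"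
    "finite S" "card S = n" "scalar_bd I L s V C K F" "\<And>a. a \<in> S \<Longrightarrow> 0 < Ku a" "\<And>a. a \<in> S \<Longrightarrow> vector_bd I L s V C (Ku a) (u a)"
  shows "\<bar>gE I (\<lambda>g. (\<Prod>a\<in>S. divergence L (u a) g) * F g)\<bar> \<le> B * (K * (\<Prod>a\<in>S. Ku a))"
  by (rule assms(1)[unfolded moment_const_def, rule_format]) (use assms(2-) in \<open>simp_all\<close>)

text \<open>At most \<open>v\<close> exceptional directions contribute 1 each, and the s^2 from all
  directions add up to at most 1. Two weights in a summand thus pay for a sum over all of
  \<open>L\<close>.\<close>

lemma sum_wt_square_le:
  assumes "finite L" "0 < s" "s\<^sup>2 * real (card L) \<le> 1" "finite V" "card V \<le> v"
  shows "(\<Sum>e\<in>L. (wt s V e)\<^sup>2) \<le> real v + 1"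
proof -
  have "(\<Sum>e\<in>L. (wt s V e)\<^sup>2) \<le> (\<Sum>e\<in>L. (if e \<in> V then 1 else 0) + s\<^sup>2)"
    by (intro sum_mono) (auto simp: wt_def)
  also have "\<dots> = real (card (L \<inter> V)) + s\<^sup>2 * real (card L)"
    using assms(1) by (simp add: sum.distrib flip: sum.inter_restrict)
  also have "card (L \<inter> V) \<le> v" using assms(4,5) card_mono[of V "L \<inter> V"] by auto
  finally show ?thesis using assms(3) by linarith
qed

text \<open>The divergence of \<open>u a\<close> is removed by duality. Every term of the resulting
  sum over \<open>L\<close> contains \<open>wt s V e\<close> twice, so
  \<open>sum_wt_square_le\<close> bounds it uniformly. \<open>B1\<close> serves the terms with
  \<open>n\<close> divergences left and \<open>B2\<close> those with \<open>n - 1\<close>;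
  \<open>C'\<close> has to cover the enlarged scalar factors and the differentiated fields.\<close>

lemma moment_const_step:
  fixes I :: "'e set" and S :: "nat set"
  assumes B1: "moment_const TYPE('e) (Suc v) C' n B1" "0 \<le> B1" and B2: "moment_const TYPE('e) (Suc v) C' (n - 1) B2" "0 \<le> B2"
    and C: "\<And>r q. 0 \<le> C r q"
    and C': "\<And>r q. C r q \<le> C' r q" "\<And>r q. C (Suc r) q \<le> C' r q" "\<And>r q. cml C C r q \<le> C' r q"
      "\<And>r q. cml C (cml C C) r q \<le> C' r q" "\<And>r q. cml C (\<lambda>r. C (Suc r)) r q \<le> C' r q"
    and I: "finite I" "L \<subseteq> I" and s: "0 < s" "s \<le> 1" and sL: "s\<^sup>2 * real (card L) \<le> 1" and V: "finite V" "card V \<le> v"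
    and S: "finite S" "card S = n" "a \<notin> S" and F: "scalar_bd I L s V C K F"
    and u: "\<And>b. b \<in> insert a S \<Longrightarrow> 0 < Ku b" "\<And>b. b \<in> insert a S \<Longrightarrow> vector_bd I L s V C (Ku b) (u b)"
  shows "\<bar>gE I (\<lambda>g. (\<Prod>b\<in>insert a S. divergence L (u b) g) * F g)\<bar>
    \<le> ((real v + 1) * (n * (B1 + B2) + B1)) * (K * (\<Prod>b\<in>insert a S. Ku b))"
proof -
  define P where "P = K * (\<Prod>b\<in>insert a S. Ku b)"
  have K: "0 < K" by (rule scalar_bd_pos[OF F])
  have P: "0 \<le> P" unfolding P_def using K u(1)
    by (intro mult_nonneg_nonneg prod_nonneg less_imp_le[OF K]) (auto simp: less_imp_le)
  have tF: "F \<in> tame I" by (rule scalar_bd_tame[OF F])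
  have tu: "u b e \<in> tame I" if "b \<in> insert a S" "e \<in> L" for b e
    using vector_bd_tame[OF u(2)[OF that(1)] that(2)] .
  have tdl: "divergence L (u b) \<in> tame I" if "b \<in> insert a S" for b
    using tu that I by (intro divergence_tame) auto
  have finL: "finite L" using I finite_subset by blast
  define H where "H = (\<lambda>g. (\<Prod>b\<in>S. divergence L (u b) g) * F g)"
  have tH: "H \<in> tame I" unfolding H_def using tdl tF by (intro tame_mult tame_prod) auto
  have bound: "\<bar>gE I (\<lambda>g. u a e g * pd e H g)\<bar> \<le> (n * (B1 + B2) + B1) * P * (wt s V e)\<^sup>2" if e: "e \<in> L" for e
  proof -
    define w where "w = wt s V e"
    define V' where "V' = insert e V"
    have w: "0 < w" "w \<le> 1" by (simp_all add: w_def wt_bounds[OF s])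
    have V': "finite V'" "card V' \<le> Suc v" "V \<subseteq> V'" unfolding V'_def using V by (auto simp: card_insert_if)
    \<comment> \<open>In \<open>T1\<close> the derivative in \<open>e\<close> meets the explicit
      coordinate in the divergence of \<open>u b\<close>, which disappears; in \<open>T2\<close> it
      falls on the field \<open>u b\<close>; in \<open>T3\<close> it falls on \<open>F\<close>. One
      weight comes from \<open>u a e\<close>, the second from \<open>u b e\<close>, from
      \<open>pd e\<close> of the field, or from \<open>pd e F\<close>.\<close>
    define T1 where "T1 b = (\<lambda>g. (\<Prod>c\<in>S - {b}. divergence L (u c) g) * (u a e g * (u b e g * F g)))" for b
    define u' where "u' b = u(b := (\<lambda>e'. pd e (u b e')))" for b
    define T2 where "T2 b = (\<lambda>g. (\<Prod>c\<in>S. divergence L (u' b c) g) * (u a e g * F g))" for b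
    define T3 where "T3 = (\<lambda>g. (\<Prod>c\<in>S. divergence L (u c) g) * (u a e g * pd e F g))"
    have tu': "u' b c e' \<in> tame I" if "b \<in> S" "c \<in> S" "e' \<in> L" for b c e'
      unfolding u'_def using tu that by auto
    have tT: "T1 b \<in> tame I" "T2 b \<in> tame I" if "b \<in> S" for b
      unfolding T1_def T2_def using that tdl tu tu' tF e I
      by (intro tame_mult tame_prod divergence_tame; auto)+
    have tT3: "T3 \<in> tame I"
      unfolding T3_def using tdl tu tF e by (intro tame_mult tame_prod tame_pd) auto
    have split: "u a e g * pd e H g = (\<Sum>b\<in>S. T1 b g + T2 b g) + T3 g" for g
    proof -
      have 1: "pd e H g = (\<Sum>b\<in>S. pd e (divergence L (u b)) g * (\<Prod>c\<in>S - {b}. divergence L (u c) g)) * F g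
            + (\<Prod>b\<in>S. divergence L (u b) g) * pd e F g"
        unfolding H_def using tdl tF S(1)
        by (subst pd_mult[of _ I], force, force, subst pd_prod[of _ _ I]) auto
      have 2: "u a e g * (pd e (divergence L (u b)) g * (\<Prod>c\<in>S - {b}. divergence L (u c) g) * F g) = T1 b g + T2 b g" if b: "b \<in> S" for b
      proof -
        have "(\<Prod>c\<in>S. divergence L (u' b c) g) = divergence L (u' b b) g * (\<Prod>c\<in>S - {b}. divergence L (u' b c) g)"
          using b S(1) by (simp add: prod.remove)
        also have "(\<Prod>c\<in>S - {b}. divergence L (u' b c) g) = (\<Prod>c\<in>S - {b}. divergence L (u c) g)"
          by (intro prod.cong) (auto simp: u'_def)
        finally have "T2 b g = (divergence L (\<lambda>e'. pd e (u b e')) g * (\<Prod>c\<in>S - {b}. divergence L (u c) g)) * (u a e g * F g)"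
          by (simp add: T2_def u'_def)
        moreover have "pd e (divergence L (u b)) = (\<lambda>g. u b e g + divergence L (\<lambda>e'. pd e (u b e')) g)"
          using pd_divergence[OF finL I(2), of "u b" e] e tu b by simp
        ultimately show ?thesis by (simp add: T1_def algebra_simps)
      qed
      have "u a e g * pd e H g = (\<Sum>b\<in>S. u a e g * (pd e (divergence L (u b)) g * (\<Prod>c\<in>S - {b}. divergence L (u c) g) * F g)) + T3 g"
        unfolding 1 T3_def by (simp add: sum_distrib_left sum_distrib_right algebra_simps)
      then show ?thesis using 2 by simp
    qed
    have eq: "gE I (\<lambda>g. u a e g * pd e H g) = (\<Sum>b\<in>S. gE I (T1 b) + gE I (T2 b)) + gE I T3"
      unfolding split using tT tT3
      by (subst gE_add[OF tame_sum tT3], force, subst gE_sum[of _ _ I], force) (auto simp: gE_add)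
    have SBF: "scalar_bd I L s V' C K F" by (rule scalar_bd_mono[OF F s V'(3)]) simp
    have SBu: "scalar_bd I L s V' C (Ku b * w) (u b e)" if "b \<in> insert a S" for b
      using vector_bd_at[OF u(2)[OF that] e u(1)[OF that] s] unfolding V'_def w_def .
    have UBu: "vector_bd I L s V' C' (Ku b) (u b)" if "b \<in> insert a S" for b
      using C'(1) by (intro vector_bd_mono[OF u(2)[OF that] u(1)[OF that] s V'(3)])
    have cc: "\<And>r q. 0 \<le> cml C C r q" using C by (intro cml_nonneg)
    have b1: "\<bar>gE I (T1 b)\<bar> \<le> B2 * (P * w\<^sup>2)" if b: "b \<in> S" for b
    proof -
      have "scalar_bd I L s V' C' ((Ku a * w) * ((Ku b * w) * K)) (\<lambda>g. u a e g * (u b e g * F g))"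
        using b C cc by (intro scalar_bd_mono[OF scalar_bd_mult[OF SBu scalar_bd_mult[OF SBu SBF]] s] C'(4)) auto
      moreover have "card (S - {b}) = n - 1" using b S by simp
      ultimately have "\<bar>gE I (T1 b)\<bar> \<le> B2 * (((Ku a * w) * ((Ku b * w) * K)) * (\<Prod>c\<in>S - {b}. Ku c))"
        unfolding T1_def using S u(1) UBu by (intro moment_constD[OF B2(1) I s sL V'(1,2)]) auto
      moreover have "(\<Prod>c\<in>S. Ku c) = Ku b * (\<Prod>c\<in>S - {b}. Ku c)" using S b by (simp add: prod.remove)
      ultimately show ?thesis using S by (simp add: P_def power2_eq_square mult_ac)
    qed
    have b2: "\<bar>gE I (T2 b)\<bar> \<le> B1 * (P * w\<^sup>2)" if b: "b \<in> S" for b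
    proof -
      define Ku' where "Ku' = Ku(b := Ku b * w)"
      have "scalar_bd I L s V' C' ((Ku a * w) * K) (\<lambda>g. u a e g * F g)"
        using b C by (intro scalar_bd_mono[OF scalar_bd_mult[OF SBu SBF] s] C'(3)) auto
      moreover have "vector_bd I L s V' C' (Ku' c) (u' b c)" if c: "c \<in> S" for c
      proof (cases "c = b")
        case True
        have "vector_bd I L s V' (\<lambda>r. C (Suc r)) (Ku b * w) (\<lambda>e'. pd e (u b e'))"
          unfolding V'_def w_def using b u(1)[of b] u(2)[of b] by (intro vector_bd_pd e s) auto
        then show ?thesis unfolding True Ku'_def u'_def fun_upd_same
          using b u(1)[of b] w by (elim vector_bd_mono) (auto intro: s C'(2))
      qed (use UBu c in \<open>auto simp: Ku'_def u'_def\<close>)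
      ultimately have "\<bar>gE I (T2 b)\<bar> \<le> B1 * (((Ku a * w) * K) * (\<Prod>c\<in>S. Ku' c))"
        unfolding T2_def using S u(1) w b by (intro moment_constD[OF B1(1) I s sL V'(1,2)]) (auto simp: Ku'_def)
      moreover have "(\<Prod>c\<in>S. Ku' c) = w * (\<Prod>c\<in>S. Ku c)"
      proof -
        have "(\<Prod>c\<in>S. Ku' c) = Ku' b * (\<Prod>c\<in>S - {b}. Ku' c)" using S b by (simp add: prod.remove)
        also have "(\<Prod>c\<in>S - {b}. Ku' c) = (\<Prod>c\<in>S - {b}. Ku c)" by (intro prod.cong) (auto simp: Ku'_def)
        finally show ?thesis using prod.remove[OF S(1) b, of Ku] by (simp add: Ku'_def mult_ac)
      qed
      ultimately show ?thesis using S by (simp add: P_def power2_eq_square mult_ac)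
    qed
    have b3: "\<bar>gE I T3\<bar> \<le> B1 * (P * w\<^sup>2)"
    proof -
      have SBpd: "scalar_bd I L s V' (\<lambda>r. C (Suc r)) (K * w) (pd e F)"
        unfolding w_def by (rule scalar_bd_mono[OF scalar_bd_pd[OF F e] s V'(3)]) simp
      have "scalar_bd I L s V' C' ((Ku a * w) * (K * w)) (\<lambda>g. u a e g * pd e F g)"
        using C by (intro scalar_bd_mono[OF scalar_bd_mult[OF SBu SBpd] s] C'(5)) auto
      then have "\<bar>gE I T3\<bar> \<le> B1 * (((Ku a * w) * (K * w)) * (\<Prod>c\<in>S. Ku c))"
        unfolding T3_def using S u(1) UBu by (intro moment_constD[OF B1(1) I s sL V'(1,2)]) auto
      then show ?thesis using S by (simp add: P_def power2_eq_square mult_ac)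
    qed
    have "\<bar>gE I (T1 b) + gE I (T2 b)\<bar> \<le> (B1 + B2) * (P * w\<^sup>2)" if "b \<in> S" for b
      using b1[OF that] b2[OF that] abs_triangle_ineq[of "gE I (T1 b)" "gE I (T2 b)"]
      unfolding distrib_right by linarith
    then have "\<bar>\<Sum>b\<in>S. gE I (T1 b) + gE I (T2 b)\<bar> \<le> (\<Sum>b\<in>S. (B1 + B2) * (P * w\<^sup>2))"
      by (intro order_trans[OF sum_abs] sum_mono)
    also have "\<dots> = n * (B1 + B2) * (P * w\<^sup>2)" using S by simp
    finally have "\<bar>gE I (\<lambda>g. u a e g * pd e H g)\<bar> \<le> n * (B1 + B2) * (P * w\<^sup>2) + B1 * (P * w\<^sup>2)"
      using b3 unfolding eq by (intro order_trans[OF abs_triangle_ineq] add_mono)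
    then show ?thesis by (simp add: w_def algebra_simps)
  qed
  have "gE I (\<lambda>g. (\<Prod>b\<in>insert a S. divergence L (u b) g) * F g) = gE I (\<lambda>g. divergence L (u a) g * H g)"
    using S by (simp add: H_def mult.assoc)
  also have "\<dots> = (\<Sum>e\<in>L. gE I (\<lambda>g. u a e g * pd e H g))"
    using I tu tH by (intro gE_divergence) auto
  also have "\<bar>\<dots>\<bar> \<le> (\<Sum>e\<in>L. (n * (B1 + B2) + B1) * P * (wt s V e)\<^sup>2)"
    using bound by (intro order_trans[OF sum_abs] sum_mono)
  also have "\<dots> = (n * (B1 + B2) + B1) * P * (\<Sum>e\<in>L. (wt s V e)\<^sup>2)"
    by (simp add: sum_distrib_left)
  also have "\<dots> \<le> (n * (B1 + B2) + B1) * P * (real v + 1)"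
    using P B1(2) B2(2) by (intro mult_left_mono sum_wt_square_le finL s sL V) auto
  finally show ?thesis by (simp add: P_def mult_ac)
qed

text \<open>Strong induction, since the step refers to two smaller numbers of divergences.
  \<open>v\<close> and \<open>C\<close> are generalised because every step adds one exceptional
  direction and enlarges the constants.\<close>

lemma moment_const_exists:
  assumes "\<And>r q. 0 \<le> C r q"
  shows "\<exists>B\<ge>0. moment_const TYPE('e) v C n B"
  using assms
proof (induction n arbitrary: v C rule: less_induct)
  case (less n)
  show ?case
  proof (cases n)
    case 0
    have "\<bar>gE I (\<lambda>g. (\<Prod>a\<in>S. divergence L (u a) g) * F g)\<bar> \<le> sqrt (C 0 1) * (K * (\<Prod>a\<in>S. Ku a))"
      if "finite S" "card S = n" "scalar_bd I L s V C K F" for I :: "'e set" and L s V and S :: "nat set" and K F Ku u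
    proof -
      have "Lq I (C 0) K F" using that(3) unfolding scalar_bd_def by (auto simp: cnt_def dest: spec[of _ "[]"])
      from Lq_gE[OF this tame_const[of 1], of 1] show ?thesis using that 0 by simp
    qed
    then show ?thesis unfolding moment_const_def using less.prems by (intro exI[of _ "sqrt (C 0 1)"]) auto
  next
    case (Suc m)
    \<comment> \<open>One summand for each kind of object in the step: unchanged, differentiated, a
      product of two factors, a product of three, and a product with a derivative.\<close>
    define C' where "C' r q = C r q + C (Suc r) q + cml C C r q + cml C (cml C C) r q + cml C (\<lambda>r. C (Suc r)) r q" for r q
    have nn: "0 \<le> C r q" "0 \<le> cml C C r q" "0 \<le> cml C (cml C C) r q" "0 \<le> cml C (\<lambda>r. C (Suc r)) r q" for r q
      by (intro cml_nonneg less.prems)+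
    have C': "0 \<le> C' r q" for r q unfolding C'_def using nn by (intro add_nonneg_nonneg) auto
    obtain B1 where B1: "0 \<le> B1" "moment_const TYPE('e) (Suc v) C' m B1" using less.IH[of m C' "Suc v"] C' Suc by auto
    have "m - 1 < n" using Suc by auto
    then have "\<exists>B\<ge>0. moment_const TYPE('e) (Suc v) C' (m - 1) B" using C' by (intro less.IH)
    then obtain B2 where B2: "0 \<le> B2" "moment_const TYPE('e) (Suc v) C' (m - 1) B2" by blast
    define B where "B = (real v + 1) * (m * (B1 + B2) + B1)"
    have le: "C r q \<le> C' r q" "C (Suc r) q \<le> C' r q" "cml C C r q \<le> C' r q" "cml C (cml C C) r q \<le> C' r q"
      "cml C (\<lambda>r. C (Suc r)) r q \<le> C' r q" for r q
      using nn(1)[of r q] nn(1)[of "Suc r" q] nn(2)[of r q] nn(3)[of r q] nn(4)[of r q] unfolding C'_def by linarith+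
    have "moment_const TYPE('e) v C n B"
      unfolding moment_const_def
    proof (intro allI impI)
      fix I :: "'e set" and L s V and S :: "nat set" and K F Ku u
      assume *: "finite I" "L \<subseteq> I" "0 < s" "s \<le> 1" "s\<^sup>2 * real (card L) \<le> 1" "finite V" "card V \<le> v"
        "finite S" "card S = n" "scalar_bd I L s V C K F" "\<forall>a\<in>S. 0 < Ku a \<and> vector_bd I L s V C (Ku a) (u a)"
      obtain a S' where S': "S = insert a S'" "a \<notin> S'" "card S' = m" "finite S'"
        using *(8,9) Suc by (metis card_Suc_eq finite_insert)
      show "\<bar>gE I (\<lambda>g. (\<Prod>a\<in>S. divergence L (u a) g) * F g)\<bar> \<le> B * (K * (\<Prod>a\<in>S. Ku a))"
        unfolding S'(1) B_def using * S'
        by (intro moment_const_step[OF B1(2,1) B2(2,1) less.prems le]) auto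
    qed
    moreover have "0 \<le> B" using B1 B2 by (simp add: B_def)
    ultimately show ?thesis by blast
  qed
qed

text \<open>The moment of order 2q is the case of 2q equal fields and F = 1 in
  \<open>moment_const\<close>. The quantifier order matters: \<open>D\<close> depends on
  \<open>C\<close> and \<open>v\<close> only.\<close>

lemma Lq_divergence:
  assumes "\<And>r q. 0 \<le> C r q"
  shows "\<exists>D. \<forall>(I :: 'e set) L s V K u. finite I \<longrightarrow> L \<subseteq> I \<longrightarrow> 0 < s \<longrightarrow> s \<le> 1 \<longrightarrow> s\<^sup>2 * real (card L) \<le> 1 \<longrightarrow>
    finite V \<longrightarrow> card V \<le> v \<longrightarrow> 0 < K \<longrightarrow> vector_bd I L s V C K u \<longrightarrow> Lq I D K (divergence L u)"
proof -
  \<comment> \<open>The added 1 lets the constant function 1 satisfy \<open>scalar_bd\<close> with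
    the same constants as the field.\<close>
  define C' where "C' r q = C r q + 1" for r q
  have C': "0 \<le> C' r q" "C r q \<le> C' r q" for r q using assms[of r q] by (auto simp: C'_def)
  have "\<forall>q. \<exists>B\<ge>0. moment_const TYPE('e) v C' (2 * q) B" by (intro allI moment_const_exists C'(1))
  then obtain D where D: "\<And>q. 0 \<le> D q" "\<And>q. moment_const TYPE('e) v C' (2 * q) (D q)" by metis
  show ?thesis
  proof (intro exI[of _ D] allI impI)
    fix I :: "'e set" and L s V K u
    assume *: "finite I" "L \<subseteq> I" "0 < s" "s \<le> 1" "s\<^sup>2 * real (card L) \<le> 1" "finite V" "card V \<le> v" "0 < K" "vector_bd I L s V C K u"
    have U: "vector_bd I L s V C' K u" using * C'(2) by (intro vector_bd_mono[OF *(9)]) auto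
    have one: "scalar_bd I L s V C' 1 (\<lambda>g. 1)"
      unfolding scalar_bd_def
    proof (intro allI impI)
      fix es
      have "Lq I (C' (length es)) (1 * s ^ cnt V es) (\<lambda>g. if es = [] then 1 else 0)"
      proof (cases "es = []")
        case True
        have "Lq I (\<lambda>q. 1) 1 (\<lambda>g. 1)" by (rule Lq_bounded) auto
        then show ?thesis using True assms by (auto elim!: Lq_mono simp: C'_def cnt_def)
      next
        case False
        then show ?thesis using * C' by (auto intro!: Lq_zero)
      qed
      then show "Lq I (C' (length es)) (1 * s ^ cnt V es) (pds es (\<lambda>g. 1))" by (simp add: pds_const)
    qed
    have "gE I (\<lambda>g. divergence L u g ^ (2 * q)) \<le> D q * K ^ (2 * q)" for q
    proof -
      have "\<bar>gE I (\<lambda>g. (\<Prod>a\<in>{..<2 * q}. divergence L u g) * 1)\<bar> \<le> D q * (1 * (\<Prod>a\<in>{..<2 * q}. K))"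
        using * U one by (intro moment_constD[OF D(2)]) auto
      then show ?thesis by simp
    qed
    moreover have "divergence L u \<in> tame I" using vector_bd_tame[OF *(9)] * by (intro divergence_tame) auto
    ultimately show "Lq I D K (divergence L u)" using * D(1) by (auto simp: Lq_def)
  qed
qed

lemma Lq_nonneg: "Lq I C x F \<Longrightarrow> 0 \<le> C q"
  by (simp add: Lq_def)

lemma Lq_add2:
  assumes "Lq I C x F" "Lq I D x G"
  shows "Lq I (\<lambda>q. (C q + D q) * 4 ^ (2 * q)) x (\<lambda>g. F g + G g)"
proof (rule Lq_rescale)
  have "Lq I (\<lambda>q. C q + D q) x F" by (rule Lq_mono[OF assms(1)]) (simp_all add: Lq_nonneg[OF assms(2)])
  moreover have "Lq I (\<lambda>q. C q + D q) x G" by (rule Lq_mono[OF assms(2)]) (simp_all add: Lq_nonneg[OF assms(1)])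
  ultimately show "Lq I (\<lambda>q. C q + D q) (4 * x) (\<lambda>g. F g + G g)" by (rule Lq_add)
qed simp

lemma Lq_diff2:
  assumes "Lq I C x F" "Lq I D x G"
  shows "Lq I (\<lambda>q. (C q + D q) * 4 ^ (2 * q)) x (\<lambda>g. F g - G g)"
proof -
  have "Lq I D x (\<lambda>g. - G g)" using Lq_cmult[OF assms(2), of "-1" 1] by simp
  from Lq_add2[OF assms(1) this] show ?thesis by simp
qed

text \<open>Iterating the commutator leaves the divergence of the differentiated field, plus terms
  in which one derivative \<open>e\<close> of the list has been spent on an explicit coordinate and
  the others, \<open>A\<close>, act on the single entry \<open>u e\<close>.\<close>

lemma pds_divergence_Lq:
  assumes "finite L" "L \<subseteq> I" "\<And>e. e \<in> L \<Longrightarrow> u e \<in> tame I" "0 < x" "\<And>q. 0 \<le> C q"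
    and "Lq I C x (divergence L (\<lambda>e. pds es (u e)))"
    and "\<And>A e. e \<in> L \<Longrightarrow> add_mset e (mset A) = mset es \<Longrightarrow> Lq I C x (pds A (u e))"
  shows "Lq I C (4 ^ length es * x) (pds es (divergence L u))"
  using assms
proof (induction es arbitrary: u)
  case Nil
  then show ?case by simp
next
  case (Cons e es)
  have 1: "Lq I C (4 ^ length es * x) (pds es (divergence L (\<lambda>e'. pd e (u e'))))"
  proof (rule Cons.IH[OF Cons.prems(1,2) _ Cons.prems(4,5)])
    show "Lq I C x (divergence L (\<lambda>e'. pds es (pd e (u e'))))" using Cons.prems(6) by simp
    fix A e' assume "e' \<in> L" "add_mset e' (mset A) = mset es"
    then show "Lq I C x (pds A (pd e (u e')))" using Cons.prems(7)[of e' "e # A"] by simp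
  qed (use Cons.prems(3) in auto)
  have 2: "Lq I C (4 ^ length es * x) (pds es (\<lambda>g. if e \<in> L then u e g else 0))"
  proof (cases "e \<in> L")
    case True
    have "1 * x \<le> 4 ^ length es * x" using Cons.prems(4) by (intro mult_right_mono) auto
    then show ?thesis using True Cons.prems(7)[of e es] by (auto elim: Lq_mono)
  next
    case False
    then show ?thesis using Cons.prems(4,5) by (auto intro!: Lq_zero)
  qed
  have t: "(\<lambda>g. if e \<in> L then u e g else 0) \<in> tame I" using Cons.prems(3) by (cases "e \<in> L") auto
  have "divergence L (\<lambda>e'. pd e (u e')) \<in> tame I" using Cons.prems by (intro divergence_tame tame_pd) auto
  note 3 = pds_add[OF t this, of es]
  have "pd e (divergence L u) = (\<lambda>g. (if e \<in> L then u e g else 0) + divergence L (\<lambda>e'. pd e (u e')) g)"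
    using Cons.prems(3) by (intro pd_divergence[OF Cons.prems(1,2)])
  with 3 have "pds (e # es) (divergence L u)
     = (\<lambda>g. pds es (\<lambda>g. if e \<in> L then u e g else 0) g + pds es (divergence L (\<lambda>e'. pd e (u e'))) g)"
    by (simp only: pds.simps)
  then show ?case using Lq_add[OF 2 1] by (simp add: mult_ac)
qed

section \<open>Derivatives of the iterates\<close>

text \<open>Besides the sites \<open>1, \<dots>, N\<close> there are two auxiliary vertices \<open>0\<close> and \<open>N + 1\<close>. Their couplings to the
  sites provide two independent Gaussian copies of the field, given the disorder.\<close>

definition pairs :: "nat \<Rightarrow> (nat \<times> nat) set" where
  "pairs N = {(i, j). i < j \<and> j \<le> Suc N}"

definition isqrt :: "nat \<Rightarrow> real" where "isqrt N = 1 / sqrt (real N)"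

definition edge :: "nat \<Rightarrow> nat \<Rightarrow> nat \<times> nat" where "edge p l = (min p l, max p l)"

definition other :: "nat \<Rightarrow> nat \<times> nat \<Rightarrow> nat" where "other p e = (if fst e = p then snd e else fst e)"

definition row :: "nat \<Rightarrow> nat \<Rightarrow> nat set" where "row N p = {1..N} - {p}"

definition rdiv :: "nat \<Rightarrow> nat \<Rightarrow> (nat \<Rightarrow> disorder \<Rightarrow> real) \<Rightarrow> disorder \<Rightarrow> real" where
  "rdiv N p u = divergence (edge p ` row N p) (\<lambda>e. u (other p e))"

definition ends :: "(nat \<times> nat) list \<Rightarrow> nat set" where "ends es = (\<Union>e\<in>set es. {fst e, snd e})"

text \<open>Each derivative of an iterate at \<open>p\<close> costs a factor \<open>1 / sqrt N\<close>, and there is one more such factor if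
  none of the differentiated couplings touches \<open>p\<close>.\<close>

definition decay :: "nat \<Rightarrow> (nat \<times> nat) list \<Rightarrow> nat" where
  "decay p es = length es + (if es \<noteq> [] \<and> p \<notin> ends es then 1 else 0)"

definition valid :: "nat \<Rightarrow> (nat \<Rightarrow> real) \<Rightarrow> bool" where
  "valid N m1 \<longleftrightarrow> N \<ge> 1 \<and> (\<forall>i\<in>{1..N}. \<bar>m1 i\<bar> \<le> 1)"

lemma finite_pairs [simp]: "finite (pairs N)"
  by (rule finite_subset[of _ "{..Suc N} \<times> {..Suc N}"]) (auto simp: pairs_def)

lemma site_pairs_pairs: "site_pairs N \<subseteq> pairs N" by (auto simp: site_pairs_def pairs_def)

lemma isqrt_pos: "N \<ge> 1 \<Longrightarrow> 0 < isqrt N" by (simp add: isqrt_def)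
lemma isqrt_le: "N \<ge> 1 \<Longrightarrow> isqrt N \<le> 1" by (simp add: isqrt_def)
lemma isqrt_sq: "N \<ge> 1 \<Longrightarrow> real N * (isqrt N)\<^sup>2 = 1" by (simp add: isqrt_def power_divide)
lemma isqrt_sq': "N \<ge> 1 \<Longrightarrow> isqrt N * isqrt N = 1 / real N" by (simp add: isqrt_def)
lemma valid_N: "valid N m1 \<Longrightarrow> N \<ge> 1" by (simp add: valid_def)

lemma finite_row [simp]: "finite (row N p)" by (simp add: row_def)
lemma card_row: "card (row N p) \<le> N"
  unfolding row_def using card_mono[of "{1..N}" "{1..N} - {p}"] by simp

lemma other_edge [simp]: "other p (edge p l) = l" by (auto simp: other_def edge_def min_def max_def)
lemma edge_commute: "edge p l = edge l p" by (simp add: edge_def min.commute max.commute)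
lemma inj_edge: "inj_on (edge p) A" by (rule inj_on_inverseI[of _ "other p"]) simp
lemma edge_pairs: "p \<le> Suc N \<Longrightarrow> l \<in> row N p \<Longrightarrow> edge p l \<in> pairs N"
  by (auto simp: edge_def pairs_def row_def min_def max_def)

lemma edge_sites: "p \<in> {1..N} \<Longrightarrow> l \<in> row N p \<Longrightarrow> edge p l \<in> site_pairs N"
  by (auto simp: edge_def site_pairs_def row_def min_def max_def)

lemma row_pairs: "p \<le> Suc N \<Longrightarrow> edge p ` row N p \<subseteq> pairs N" using edge_pairs by blast

lemma coupling_edge: "p \<noteq> l \<Longrightarrow> coupling g p l = g (edge p l)"
  by (simp add: coupling_def edge_def)

lemma partial_deriv_edge: "p \<noteq> l \<Longrightarrow> partial_deriv p l F = pd (edge p l) F"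
  by (simp add: partial_deriv_def pd_def edge_def fun_eq_iff)

lemma rdiv_sum: "rdiv N p u g = (\<Sum>l\<in>row N p. g (edge p l) * u l g - pd (edge p l) (u l) g)"
  unfolding rdiv_def divergence_def by (subst sum.reindex[OF inj_edge]) simp

text \<open>The correction terms of the divergence are precisely the sum that the second choice of
  the Onsager term subtracts. The row omits l = p, where both \<open>coupling\<close> and
  \<open>partial_deriv\<close> vanish.\<close>

lemma rdiv_expand:
  "(\<Sum>l=1..N. coupling g p l * u l g) = rdiv N p u g + (\<Sum>l=1..N. partial_deriv p l (u l) g)"
proof -
  have "(\<Sum>l=1..N. f l) = (\<Sum>l\<in>row N p. f l)" if "f p = 0" for f :: "nat \<Rightarrow> real"
    using that unfolding row_def by (cases "p \<in> {1..N}") (auto simp: sum.remove)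
  from this[of "\<lambda>l. coupling g p l * u l g"] this[of "\<lambda>l. partial_deriv p l (u l) g"]
  show ?thesis
    by (simp add: coupling_def[of g p p] partial_deriv_def[of p p] rdiv_sum sum.distrib[symmetric])
       (rule sum.cong, auto simp: row_def coupling_edge partial_deriv_edge)
qed

lemma rdiv_tame: "p \<le> Suc N \<Longrightarrow> (\<And>l. l \<in> row N p \<Longrightarrow> u l \<in> tame (pairs N)) \<Longrightarrow> rdiv N p u \<in> tame (pairs N)"
  unfolding rdiv_def by (intro divergence_tame row_pairs) auto

lemma ends_append: "ends (es @ fs) = ends es \<union> ends fs" by (auto simp: ends_def)
lemma ends_Cons: "ends (e # es) = {fst e, snd e} \<union> ends es" by (auto simp: ends_def)
lemma ends_mono: "set A \<subseteq> set B \<Longrightarrow> ends A \<subseteq> ends B" by (auto simp: ends_def)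
lemma finite_ends: "finite (ends es)" by (auto simp: ends_def)
lemma card_ends: "card (ends es) \<le> 2 * length es"
proof (induction es)
  case Nil then show ?case by (simp add: ends_def)
next
  case (Cons e es)
  have "card (ends (e # es)) \<le> card {fst e, snd e} + card (ends es)" unfolding ends_Cons by (rule card_Un_le)
  also have "card {fst e, snd e} \<le> 2" by (simp add: card_insert_if)
  finally show ?case using Cons by simp
qed
lemma decay_ge: "length es \<le> decay p es" by (simp add: decay_def)

lemma edge_ends: "l \<noteq> p \<Longrightarrow> l \<in> ends fs \<Longrightarrow> set fs \<subseteq> edge p ` R \<Longrightarrow> edge p l \<in> set fs"
  by (auto simp: ends_def edge_def min_def max_def split: if_splits)

section \<open>The iterates as tame functions, and the splitting of the field\<close>

locale amp =
  fixes \<beta> h :: real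
begin

definition mag :: "onsager_choice \<Rightarrow> nat \<Rightarrow> (nat \<Rightarrow> real) \<Rightarrow> nat \<Rightarrow> nat \<Rightarrow> disorder \<Rightarrow> real" where
  "mag c N m1 k p = (\<lambda>g. iterate c \<beta> h N m1 k g p)"

definition lfield :: "onsager_choice \<Rightarrow> nat \<Rightarrow> (nat \<Rightarrow> real) \<Rightarrow> nat \<Rightarrow> nat \<Rightarrow> disorder \<Rightarrow> real" where
  "lfield c N m1 k p = (\<lambda>g. local_field c \<beta> N (iterate c \<beta> h N m1 (Suc k)) (iterate c \<beta> h N m1 k) g p)"

text \<open>The field without its remainder is a divergence. The remainder measures how far the Onsager term is
  from \<open>\<beta> / sqrt N * (\<Sum>j. \<partial>\<^sub>i\<^sub>j m\<^sub>j)\<close>.\<close>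

definition remainder :: "onsager_choice \<Rightarrow> nat \<Rightarrow> (nat \<Rightarrow> real) \<Rightarrow> nat \<Rightarrow> nat \<Rightarrow> disorder \<Rightarrow> real" where
  "remainder c N m1 k p = (\<lambda>g. lfield c N m1 k p g - \<beta> * isqrt N * rdiv N p (mag c N m1 (Suc k)) g)"

lemma mag_simps:
  "mag c N m1 0 p = (\<lambda>g. 0)" "mag c N m1 (Suc 0) p = (\<lambda>g. m1 p)"
  "mag c N m1 (Suc (Suc k)) p = (\<lambda>g. tanh (h + lfield c N m1 k p g))"
  by (auto simp: mag_def lfield_def)

lemma lfield_Overlap:
  "lfield Onsager_Overlap N m1 k p = (\<lambda>g. \<beta> * isqrt N * (\<Sum>l=1..N. coupling g p l * mag Onsager_Overlap N m1 (Suc k) l g)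
     - \<beta>\<^sup>2 * (1 - (1 / real N) * (\<Sum>l=1..N. mag Onsager_Overlap N m1 (Suc k) l g * mag Onsager_Overlap N m1 (Suc k) l g))
       * mag Onsager_Overlap N m1 k p g)"
  by (simp add: lfield_def local_field_def mag_def overlap_def isqrt_def fun_eq_iff)

lemma lfield_Derivative:
  "lfield Onsager_Derivative N m1 k p = (\<lambda>g. \<beta> * isqrt N * (\<Sum>l=1..N. coupling g p l * mag Onsager_Derivative N m1 (Suc k) l g)
     - \<beta> * isqrt N * (\<Sum>l=1..N. partial_deriv p l (mag Onsager_Derivative N m1 (Suc k) l) g))"
  by (simp add: lfield_def local_field_def mag_def isqrt_def fun_eq_iff)

lemma coupling_tame: "p \<in> {1..N} \<Longrightarrow> l \<in> {1..N} \<Longrightarrow> (\<lambda>g. coupling g p l) \<in> tame (site_pairs N)"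
  by (cases "p = l") (auto simp: coupling_def site_pairs_def intro!: tame_coord)

lemma partial_deriv_tame: "F \<in> tame I \<Longrightarrow> partial_deriv p l F \<in> tame I"
proof (cases "p = l")
  case True
  then have "partial_deriv p l F = (\<lambda>g. 0)" by (simp add: partial_deriv_def fun_eq_iff)
  then show ?thesis by simp
qed (auto simp: partial_deriv_edge)

lemma lfield_tame_step:
  assumes "\<And>p. p \<in> {1..N} \<Longrightarrow> mag c N m1 (Suc k) p \<in> tame (site_pairs N)"
    "\<And>p. p \<in> {1..N} \<Longrightarrow> mag c N m1 k p \<in> tame (site_pairs N)" "p \<in> {1..N}"
  shows "lfield c N m1 k p \<in> tame (site_pairs N)"
proof (cases c)
  case Onsager_Overlap
  show ?thesis unfolding Onsager_Overlap lfield_Overlap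
    using assms unfolding Onsager_Overlap
    by (intro tame_diff tame_mult tame_const tame_sum coupling_tame) auto
next
  case Onsager_Derivative
  show ?thesis unfolding Onsager_Derivative lfield_Derivative
    using assms unfolding Onsager_Derivative
    by (intro tame_diff tame_mult tame_const tame_sum coupling_tame partial_deriv_tame) auto
qed

lemma mag_tame_sites: "p \<in> {1..N} \<Longrightarrow> mag c N m1 k p \<in> tame (site_pairs N)"
proof (induction k arbitrary: p rule: less_induct)
  case (less k)
  consider "k = 0" | "k = Suc 0" | j where "k = Suc (Suc j)" by (metis not0_implies_Suc)
  then show ?case
  proof cases
    case 3
    show ?thesis unfolding 3 mag_simps
      using less 3 by (intro tame_tanh tame_add tame_const lfield_tame_step) auto
  qed (auto simp: mag_simps)
qed

lemma mag_tame: "p \<in> {1..N} \<Longrightarrow> mag c N m1 k p \<in> tame (pairs N)"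
  using tame_mono[OF mag_tame_sites site_pairs_pairs] .

lemma lfield_tame_sites: "p \<in> {1..N} \<Longrightarrow> lfield c N m1 k p \<in> tame (site_pairs N)"
  by (intro lfield_tame_step mag_tame_sites)

lemma lfield_tame: "p \<in> {1..N} \<Longrightarrow> lfield c N m1 k p \<in> tame (pairs N)"
  using tame_mono[OF lfield_tame_sites site_pairs_pairs] .

lemma dvm_tame: "p \<le> Suc N \<Longrightarrow> rdiv N p (mag c N m1 k) \<in> tame (pairs N)"
  by (intro rdiv_tame mag_tame) (auto simp: row_def)

lemma remainder_tame: "p \<in> {1..N} \<Longrightarrow> remainder c N m1 k p \<in> tame (pairs N)"
  unfolding remainder_def by (intro tame_diff tame_mult tame_const lfield_tame dvm_tame) auto

lemma lfield_decomp: "lfield c N m1 k p g = \<beta> * isqrt N * rdiv N p (mag c N m1 (Suc k)) g + remainder c N m1 k p g"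
  by (simp add: remainder_def)

lemma remainder_Derivative: "remainder Onsager_Derivative N m1 k p = (\<lambda>g. 0)"
  unfolding remainder_def lfield_Derivative rdiv_expand by (simp add: algebra_simps)

lemma mag_abs_le:
  assumes "valid N m1" "p \<in> {1..N}" shows "\<bar>mag c N m1 k p g\<bar> \<le> 1"
proof -
  consider "k = 0" | "k = Suc 0" | j where "k = Suc (Suc j)" by (metis not0_implies_Suc)
  then show ?thesis using assms by cases (auto simp: mag_simps valid_def abs_tanh_le_1)
qed

text \<open>Site couplings are the only ones on which the iterates depend. The empty list records
  bounded moments of the iterate itself, and \<open>C\<close> is uniform in the Onsager choice, in
  N, in the starting value and in the site.\<close>

definition mag_bounds :: "nat \<Rightarrow> (nat \<Rightarrow> nat \<Rightarrow> real) \<Rightarrow> bool" where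
  "mag_bounds k C \<longleftrightarrow> (\<forall>r q. 0 \<le> C r q) \<and> (\<forall>c N m1 es p. valid N m1 \<longrightarrow> set es \<subseteq> site_pairs N \<longrightarrow> p \<in> {1..N} \<longrightarrow>
     Lq (pairs N) (C (length es)) (isqrt N ^ decay p es) (pds es (mag c N m1 k p)))"

text \<open>The exponent does not refer to p: since \<open>decay p es\<close> never exceeds
  \<open>length es + 1\<close>, derivatives of the remainder are as small as the best derivatives of
  an iterate, wherever the couplings lie.\<close>

definition remainder_bounds :: "nat \<Rightarrow> (nat \<Rightarrow> nat \<Rightarrow> real) \<Rightarrow> bool" where
  "remainder_bounds k C \<longleftrightarrow> (\<forall>r q. 0 \<le> C r q) \<and> (\<forall>c N m1 es p. valid N m1 \<longrightarrow> set es \<subseteq> site_pairs N \<longrightarrow> p \<in> {1..N} \<longrightarrow>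
     Lq (pairs N) (C (length es)) (isqrt N ^ (length es + 1)) (pds es (remainder c N m1 k p)))"

lemma mag_boundsD: "mag_bounds k C \<Longrightarrow> valid N m1 \<Longrightarrow> set es \<subseteq> site_pairs N \<Longrightarrow> p \<in> {1..N} \<Longrightarrow>
     Lq (pairs N) (C (length es)) (isqrt N ^ decay p es) (pds es (mag c N m1 k p))"
  by (simp add: mag_bounds_def)

lemma remainder_boundsD: "remainder_bounds k C \<Longrightarrow> valid N m1 \<Longrightarrow> set es \<subseteq> site_pairs N \<Longrightarrow> p \<in> {1..N} \<Longrightarrow>
     Lq (pairs N) (C (length es)) (isqrt N ^ (length es + 1)) (pds es (remainder c N m1 k p))"
  by (simp add: remainder_bounds_def)

text \<open>With at least one derivative inside, the entry at l has an extra factor 1 / sqrt N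
  unless l is an endpoint of \<open>es\<close>. There are at most 2 \<open>length es\<close> such l,
  so the differentiated iterates form a vector field with boundedly many exceptional directions, and
  its divergence has the scale of the exceptional entries.\<close>

lemma rdiv_pds_bound:
  assumes M: "mag_bounds k C"
  shows "\<exists>D. (\<forall>r q. 0 \<le> D r q) \<and> (\<forall>c N m1 es p. valid N m1 \<longrightarrow> set es \<subseteq> site_pairs N \<longrightarrow> es \<noteq> [] \<longrightarrow> p \<le> Suc N \<longrightarrow>
     Lq (pairs N) (D (length es)) (isqrt N ^ length es) (rdiv N p (\<lambda>l. pds es (mag c N m1 k l))))"
proof -
  have nn: "0 \<le> C r q" for r q using M by (simp add: mag_bounds_def)
  have "\<exists>D. (\<forall>q. 0 \<le> D q) \<and> (\<forall>c N m1 es p. valid N m1 \<longrightarrow> set es \<subseteq> site_pairs N \<longrightarrow> es \<noteq> [] \<longrightarrow> length es = r \<longrightarrow> p \<le> Suc N \<longrightarrow>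
     Lq (pairs N) D (isqrt N ^ r) (rdiv N p (\<lambda>l. pds es (mag c N m1 k l))))" for r
  proof -
    \<comment> \<open>The field already carries r derivatives, hence the shifted constants
      \<open>C (r + a)\<close>; 2 r bounds the number of endpoints of r couplings.\<close>
    obtain D where D: "\<forall>(I :: (nat \<times> nat) set) L s V K u. finite I \<longrightarrow> L \<subseteq> I \<longrightarrow> 0 < s \<longrightarrow> s \<le> 1 \<longrightarrow> s\<^sup>2 * real (card L) \<le> 1 \<longrightarrow>
        finite V \<longrightarrow> card V \<le> 2 * r \<longrightarrow> 0 < K \<longrightarrow> vector_bd I L s V (\<lambda>a. C (r + a)) K u \<longrightarrow> Lq I D K (divergence L u)"
      using Lq_divergence[where C = "\<lambda>a. C (r + a)" and v = "2 * r", OF nn] by (elim exE) (rule that)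
    have main: "Lq (pairs N) D (isqrt N ^ r) (rdiv N p (\<lambda>l. pds es (mag c N m1 k l)))"
      if v: "valid N m1" and es: "set es \<subseteq> site_pairs N" "es \<noteq> []" "length es = r" and p: "p \<le> Suc N" for c N m1 es p
    proof -
      define V where "V = edge p ` ends es"
      have N: "N \<ge> 1" using valid_N[OF v] .
      have V: "finite V" "card V \<le> 2 * r"
        using card_image_le[OF finite_ends, of "edge p" es] card_ends[of es] finite_ends es by (auto simp: V_def)
      have cL: "(isqrt N)\<^sup>2 * real (card (edge p ` row N p)) \<le> 1"
      proof -
        have "card (edge p ` row N p) \<le> N" using card_image[OF inj_edge] card_row by simp
        then have "(isqrt N)\<^sup>2 * real (card (edge p ` row N p)) \<le> (isqrt N)\<^sup>2 * real N" by (intro mult_left_mono) auto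
        then show ?thesis using isqrt_sq[OF N] by (simp add: mult_ac)
      qed
      have "vector_bd (pairs N) (edge p ` row N p) (isqrt N) V (\<lambda>a. C (r + a)) (isqrt N ^ r) (\<lambda>e. pds es (mag c N m1 k (other p e)))"
        unfolding vector_bd_def
      proof (intro allI impI)
        fix fs e assume fs: "set fs \<subseteq> edge p ` row N p" and "e \<in> edge p ` row N p"
        then obtain l where l: "e = edge p l" "l \<in> row N p" by auto
        have l': "l \<in> {1..N}" "l \<noteq> p" using l by (auto simp: row_def)
        let ?x = "isqrt N ^ r * (isqrt N ^ cnt V fs * wt (isqrt N) (V \<union> set fs) e)"
        have pos: "0 < ?x" by (intro mult_pos_pos zero_less_power) (simp_all add: isqrt_pos[OF N] wt_bounds[OF isqrt_pos[OF N] isqrt_le[OF N]])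
        show "Lq (pairs N) (C (r + length fs)) ?x (pds fs (pds es (mag c N m1 k (other p e))))"
        \<comment> \<open>The other case arises for an auxiliary p, whose row consists of couplings
          on which no iterate depends; the derivatives then vanish identically.\<close>
        proof (cases "set fs \<subseteq> site_pairs N")
          case True
          have "isqrt N ^ decay l (es @ fs) \<le> ?x"
          proof -
            have c: "cnt V fs \<le> length fs" by (simp add: cnt_def)
            show ?thesis
            proof (cases "e \<in> V \<union> set fs")
              case True
              then have "?x = isqrt N ^ (r + cnt V fs)" by (simp add: wt_def power_add)
              moreover have "r + cnt V fs \<le> decay l (es @ fs)" using c es decay_ge[of "es @ fs" l] by simp
              ultimately show ?thesis using power_decreasing[of "r + cnt V fs" "decay l (es @ fs)" "isqrt N"] isqrt_pos[OF N] isqrt_le[OF N] by simp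
            next
              case False
              then have x: "?x = isqrt N ^ (r + cnt V fs + 1)" by (simp add: wt_def power_add)
              have "l \<notin> ends es" using False by (auto simp: V_def l)
              moreover have "l \<notin> ends fs" using False edge_ends[OF l'(2) _ fs] by (auto simp: l)
              ultimately have "r + cnt V fs + 1 \<le> decay l (es @ fs)" using c es by (simp add: decay_def ends_append)
              then show ?thesis unfolding x using isqrt_pos[OF N] isqrt_le[OF N] by (intro power_decreasing) auto
            qed
          qed
          then show ?thesis
            using mag_boundsD[OF M v, of "es @ fs" l c] True es l' by (auto simp: pds_append l elim!: Lq_mono)
        next
          case False
          have "pds fs (pds es (mag c N m1 k l)) = (\<lambda>g. 0)"
            using l' by (intro pds_outside[OF _ False] tame_pds mag_tame_sites) auto
          then show ?thesis using Lq_zero[OF pos, of "C (r + length fs)"] nn by (simp add: l)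
        qed
      qed
      then show ?thesis unfolding rdiv_def
        using isqrt_pos[OF N] isqrt_le[OF N] cL V row_pairs[OF p] by (intro D[rule_format]) auto
    qed
    \<comment> \<open>\<open>Lq_divergence\<close> does not state that its constants are
      nonnegative; the absolute value supplies this.\<close>
    have "Lq (pairs N) (\<lambda>q. \<bar>D q\<bar>) (isqrt N ^ r) (rdiv N p (\<lambda>l. pds es (mag c N m1 k l)))"
      if "valid N m1" "set es \<subseteq> site_pairs N" "es \<noteq> []" "length es = r" "p \<le> Suc N" for c N m1 es p
      using main[OF that] by (rule Lq_mono) auto
    then show ?thesis by (intro exI[of _ "\<lambda>q. \<bar>D q\<bar>"]) auto
  qed
  then obtain D where "\<And>r. (\<forall>q. 0 \<le> D r q) \<and> (\<forall>c N m1 es p. valid N m1 \<longrightarrow> set es \<subseteq> site_pairs N \<longrightarrow> es \<noteq> [] \<longrightarrow> length es = r \<longrightarrow> p \<le> Suc N \<longrightarrow>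
     Lq (pairs N) (D r) (isqrt N ^ r) (rdiv N p (\<lambda>l. pds es (mag c N m1 k l))))" by metis
  then show ?thesis by (intro exI[of _ D]) auto
qed

end

section \<open>Derivatives of the fields\<close>

context amp begin

text \<open>The derivatives \<open>B\<close> are commuted into the divergence. If none of them
  touches \<open>p\<close>, none is a direction of the row and no power is lost; otherwise one may
  be spent on an explicit coordinate, leaving a single entry with one derivative fewer.\<close>

lemma rdiv_pds_bound2:
  assumes M: "mag_bounds k C"
  shows "\<exists>D. (\<forall>r q. 0 \<le> D r q) \<and> (\<forall>c N m1 E B p. valid N m1 \<longrightarrow> set (E @ B) \<subseteq> site_pairs N \<longrightarrow> E @ B \<noteq> [] \<longrightarrow> p \<le> Suc N \<longrightarrow>
     Lq (pairs N) (D (length (E @ B))) (if p \<in> ends B then isqrt N ^ (length (E @ B) - 1) else isqrt N ^ length (E @ B))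
       (pds B (rdiv N p (\<lambda>l. pds E (mag c N m1 k l)))))"
proof -
  have nn: "0 \<le> C r q" for r q using M by (simp add: mag_bounds_def)
  obtain D0 where D0_raw: "\<forall>r q. 0 \<le> D0 r q" "\<forall>c N m1 es p. valid N m1 \<longrightarrow> set es \<subseteq> site_pairs N \<longrightarrow> es \<noteq> [] \<longrightarrow> p \<le> Suc N \<longrightarrow>
     Lq (pairs N) (D0 (length es)) (isqrt N ^ length es) (rdiv N p (\<lambda>l. pds es (mag c N m1 k l)))"
    using rdiv_pds_bound[OF M] by (elim exE conjE) (rule that)
  note D0 = D0_raw[rule_format]
  define D where "D r q = (D0 r q + C (r - 1) q) * (4 ^ r) ^ (2 * q)" for r q
  have "Lq (pairs N) (D (length (E @ B))) (if p \<in> ends B then isqrt N ^ (length (E @ B) - 1) else isqrt N ^ length (E @ B))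
       (pds B (rdiv N p (\<lambda>l. pds E (mag c N m1 k l))))"
    if v: "valid N m1" and es: "set (E @ B) \<subseteq> site_pairs N" "E @ B \<noteq> []" and p: "p \<le> Suc N" for c N m1 E B p
  proof -
    define r where "r = length (E @ B)"
    define x where "x = (if p \<in> ends B then isqrt N ^ (r - 1) else isqrt N ^ r)"
    define C' where "C' q = D0 r q + C (r - 1) q" for q
    have N: "N \<ge> 1" using valid_N[OF v] .
    have x: "0 < x" "isqrt N ^ r \<le> x" unfolding x_def
      using isqrt_pos[OF N] isqrt_le[OF N] by (auto intro!: power_decreasing)
    have "Lq (pairs N) C' (4 ^ length B * x) (pds B (divergence (edge p ` row N p) (\<lambda>e. pds E (mag c N m1 k (other p e)))))"
    proof (rule pds_divergence_Lq)
      show "0 \<le> C' q" for q using D0(1) nn by (simp add: C'_def)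
      have "Lq (pairs N) (D0 r) (isqrt N ^ r) (rdiv N p (\<lambda>l. pds (E @ B) (mag c N m1 k l)))"
        unfolding r_def by (rule D0(2)[OF v es p])
      from Lq_mono[OF this x(2)] show "Lq (pairs N) C' x (divergence (edge p ` row N p) (\<lambda>e. pds B (pds E (mag c N m1 k (other p e)))))"
        using nn by (simp add: rdiv_def pds_append C'_def)
      fix A e assume e: "e \<in> edge p ` row N p" and A: "add_mset e (mset A) = mset B"
      from e obtain l where "e = edge p l" "l \<in> row N p" by blast
      then have l: "e = edge p l" "l \<in> {1..N}" by (auto simp: row_def)
      have eB: "e \<in> set B" "set A \<subseteq> set B" using A by (metis set_mset_mset union_single_eq_member, metis set_mset_mset set_mset_add_mset_insert subset_insertI)
      have "p \<in> {fst e, snd e}" unfolding l by (cases "p \<le> l") (auto simp: edge_def)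
      then have "p \<in> ends B" using eB unfolding ends_def by blast
      then have xx: "x = isqrt N ^ (r - 1)" by (simp add: x_def)
      have "length B = Suc (length A)" using arg_cong[OF A, of size] by simp
      then have len: "length (E @ A) = r - 1" by (simp add: r_def)
      have "Lq (pairs N) (C (r - 1)) (isqrt N ^ decay l (E @ A)) (pds (E @ A) (mag c N m1 k l))"
        using mag_boundsD[OF M v, of "E @ A" l c] es(1) eB l unfolding len by auto
      moreover have "isqrt N ^ decay l (E @ A) \<le> x"
        unfolding xx using decay_ge[of "E @ A" l] isqrt_pos[OF N] isqrt_le[OF N] unfolding len by (intro power_decreasing) auto
      ultimately have "Lq (pairs N) C' x (pds (E @ A) (mag c N m1 k l))"
        by (rule Lq_mono) (simp add: C'_def D0(1))
      then show "Lq (pairs N) C' x (pds A (pds E (mag c N m1 k (other p e))))" by (simp add: l pds_append)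
    qed (use x row_pairs[OF p] in \<open>auto intro!: tame_pds mag_tame simp: row_def\<close>)
    then have res: "Lq (pairs N) C' (4 ^ r * x) (pds B (rdiv N p (\<lambda>l. pds E (mag c N m1 k l))))"
      unfolding rdiv_def
    proof (rule Lq_mono)
      have "(4::real) ^ length B \<le> 4 ^ r" by (intro power_increasing) (auto simp: r_def)
      then show "4 ^ length B * x \<le> 4 ^ r * x" using x by (intro mult_right_mono) auto
    qed auto
    have "(0::real) < 4 ^ r" by simp
    from Lq_rescale[OF res this] show ?thesis
      unfolding x_def C'_def D_def[abs_def] r_def .
  qed
  moreover have "0 \<le> D r q" for r q using D0(1) nn by (simp add: D_def)
  ultimately show ?thesis by (intro exI[of _ D]) blast
qed

definition bq :: "nat \<Rightarrow> real" where "bq q = (\<bar>\<beta>\<bar> + 1) ^ (2 * q)"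

lemma bq_nonneg: "0 \<le> bq q" by (simp add: bq_def)

lemma Lq_beta_isqrt:
  assumes "Lq I C x F" "N \<ge> 1"
  shows "Lq I (\<lambda>q. C q * bq q) (isqrt N * x) (\<lambda>g. \<beta> * isqrt N * F g)"
  unfolding bq_def
proof (rule Lq_rescale)
  have "Lq I C (((\<bar>\<beta>\<bar> + 1) * isqrt N) * x) (\<lambda>g. \<beta> * isqrt N * F g)"
    using isqrt_pos[OF assms(2)] by (intro Lq_cmult[OF assms(1)]) (auto simp: abs_mult)
  then show "Lq I C ((\<bar>\<beta>\<bar> + 1) * (isqrt N * x)) (\<lambda>g. \<beta> * isqrt N * F g)" by (simp only: mult.assoc)
qed auto

text \<open>One formula serves two roles: at a site it is the divergence part of the field, at the
  vertices \<open>0\<close> and \<open>Suc N\<close> it is a Gaussian copy given the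
  disorder.\<close>

definition rfield :: "onsager_choice \<Rightarrow> nat \<Rightarrow> (nat \<Rightarrow> real) \<Rightarrow> nat \<Rightarrow> nat \<Rightarrow> disorder \<Rightarrow> real" where
  "rfield c N m1 k p = (\<lambda>g. \<beta> * isqrt N * rdiv N p (mag c N m1 (Suc k)) g)"

lemma rfield_tame: "p \<le> Suc N \<Longrightarrow> rfield c N m1 k p \<in> tame (pairs N)"
  unfolding rfield_def by (intro tame_mult tame_const dvm_tame)

text \<open>Proper derivatives only: at order zero the boundedness of tanh takes over.\<close>

definition decay_bounds :: "nat \<Rightarrow> (nat \<Rightarrow> nat \<Rightarrow> real) \<Rightarrow> nat \<Rightarrow> (disorder \<Rightarrow> real) \<Rightarrow> bool" where
  "decay_bounds N C p F \<longleftrightarrow> (\<forall>es. es \<noteq> [] \<longrightarrow> set es \<subseteq> site_pairs N \<longrightarrow>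
     Lq (pairs N) (C (length es)) (isqrt N ^ decay p es) (pds es F))"

lemma decay_boundsD:
  "decay_bounds N C p F \<Longrightarrow> es \<noteq> [] \<Longrightarrow> set es \<subseteq> site_pairs N \<Longrightarrow>
     Lq (pairs N) (C (length es)) (isqrt N ^ decay p es) (pds es F)"
  by (simp add: decay_bounds_def)

text \<open>The prefactor 1 / sqrt N raises the exponents \<open>length es - 1\<close> and
  \<open>length es\<close> of \<open>rdiv_pds_bound2\<close> to \<open>decay p es\<close>, whether
  or not \<open>p\<close> is touched.\<close>

lemma rfield_bound:
  assumes M: "mag_bounds (Suc k) C"
  shows "\<exists>D. (\<forall>r q. 0 \<le> D r q) \<and> (\<forall>c N m1 p. valid N m1 \<longrightarrow> p \<le> Suc N \<longrightarrow> decay_bounds N D p (rfield c N m1 k p))"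
proof -
  obtain D where D_raw: "\<forall>r q. 0 \<le> D r q" "\<forall>c N m1 E B p. valid N m1 \<longrightarrow> set (E @ B) \<subseteq> site_pairs N \<longrightarrow> E @ B \<noteq> [] \<longrightarrow> p \<le> Suc N \<longrightarrow>
     Lq (pairs N) (D (length (E @ B))) (if p \<in> ends B then isqrt N ^ (length (E @ B) - 1) else isqrt N ^ length (E @ B))
       (pds B (rdiv N p (\<lambda>l. pds E (mag c N m1 (Suc k) l))))"
    using rdiv_pds_bound2[OF M] by (elim exE conjE) (rule that)
  note D = D_raw[rule_format]
  have "decay_bounds N (\<lambda>r q. D r q * bq q) p (rfield c N m1 k p)"
    if v: "valid N m1" and p: "p \<le> Suc N" for c N m1 p
    unfolding decay_bounds_def
  proof (intro allI impI)
    fix es :: "(nat \<times> nat) list" assume es: "es \<noteq> []" "set es \<subseteq> site_pairs N"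
    have "Lq (pairs N) (D (length es)) (if p \<in> ends es then isqrt N ^ (length es - 1) else isqrt N ^ length es)
       (pds es (rdiv N p (mag c N m1 (Suc k))))"
      using D(2)[OF v, of "[]" es p c] es p by (simp cong: if_cong)
    from Lq_beta_isqrt[OF this valid_N[OF v]]
    have "Lq (pairs N) (\<lambda>q. D (length es) q * bq q) (isqrt N * (if p \<in> ends es then isqrt N ^ (length es - 1) else isqrt N ^ length es))
       (pds es (rfield c N m1 k p))"
      unfolding rfield_def using dvm_tame[OF p] by (subst pds_cmult) 
    moreover have "isqrt N * (if p \<in> ends es then isqrt N ^ (length es - 1) else isqrt N ^ length es) = isqrt N ^ decay p es"
      using es(1) by (cases es) (auto simp: decay_def)
    ultimately show "Lq (pairs N) (\<lambda>q. D (length es) q * bq q) (isqrt N ^ decay p es) (pds es (rfield c N m1 k p))" by simp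
  qed
  then show ?thesis using D(1) bq_nonneg by (intro exI[of _ "\<lambda>r q. D r q * bq q"]) auto
qed

lemma lfield_eq: "lfield c N m1 k p = (\<lambda>g. rfield c N m1 k p g + remainder c N m1 k p g)"
  by (simp add: lfield_decomp rfield_def fun_eq_iff)

lemma lfield_bound:
  assumes M: "mag_bounds (Suc k) C" and E: "remainder_bounds k C2"
  shows "\<exists>D. (\<forall>r q. 0 \<le> D r q) \<and> (\<forall>c N m1 p. valid N m1 \<longrightarrow> p \<in> {1..N} \<longrightarrow> decay_bounds N D p (lfield c N m1 k p))"
proof -
  have nn: "0 \<le> C2 r q" for r q using E by (simp add: remainder_bounds_def)
  obtain D where D_raw: "\<forall>r q. 0 \<le> D r q" "\<forall>c N m1 p. valid N m1 \<longrightarrow> p \<le> Suc N \<longrightarrow> decay_bounds N D p (rfield c N m1 k p)"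
    using rfield_bound[OF M] by (elim exE conjE) (rule that)
  note D = D_raw[rule_format]
  define D' where "D' r q = (D r q + C2 r q) * 4 ^ (2 * q)" for r q
  have "decay_bounds N D' p (lfield c N m1 k p)"
    if v: "valid N m1" and p: "p \<in> {1..N}" for c N m1 p
    unfolding decay_bounds_def
  proof (intro allI impI)
    fix es :: "(nat \<times> nat) list" assume es: "es \<noteq> []" "set es \<subseteq> site_pairs N"
    have p': "p \<le> Suc N" using p by auto
    have "decay p es \<le> length es + 1" by (simp add: decay_def)
    then have "isqrt N ^ (length es + 1) \<le> isqrt N ^ decay p es"
      using isqrt_pos[OF valid_N[OF v]] isqrt_le[OF valid_N[OF v]] by (intro power_decreasing) auto
    then have "Lq (pairs N) (C2 (length es)) (isqrt N ^ decay p es) (pds es (remainder c N m1 k p))"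
      by (rule Lq_mono[OF remainder_boundsD[OF E v es(2) p]]) simp
    from Lq_add2[OF decay_boundsD[OF D(2)[OF v p'] es] this]
    show "Lq (pairs N) (D' (length es)) (isqrt N ^ decay p es) (pds es (lfield c N m1 k p))"
      unfolding lfield_eq pds_add[OF rfield_tame[OF p'] remainder_tame[OF p]] D'_def .
  qed
  then show ?thesis using D(1) nn by (intro exI[of _ D']) (auto simp: D'_def)
qed

text \<open>The subtracted term is the leading part of the derivative of Y_i in g_il; it stems from
  the explicit coordinate in the divergence and has an exact counterpart for the Gaussian
  copy.\<close>

definition defect :: "onsager_choice \<Rightarrow> nat \<Rightarrow> (nat \<Rightarrow> real) \<Rightarrow> nat \<Rightarrow> nat \<Rightarrow> nat \<Rightarrow> disorder \<Rightarrow> real" where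
  "defect c N m1 k i l = (\<lambda>g. pd (edge i l) (lfield c N m1 k i) g - \<beta> * isqrt N * mag c N m1 (Suc k) l g)"

lemma defect_eq:
  assumes "i \<in> {1..N}" "l \<in> {1..N}" "i \<noteq> l"
  shows "defect c N m1 k i l = (\<lambda>g. \<beta> * isqrt N * rdiv N i (\<lambda>l'. pds [edge i l] (mag c N m1 (Suc k) l')) g
            + pds [edge i l] (remainder c N m1 k i) g)"
proof -
  have i: "i \<le> Suc N" using assms by auto
  have l: "edge i l \<in> edge i ` row N i" using assms by (auto simp: row_def)
  have "pd (edge i l) (rdiv N i (mag c N m1 (Suc k))) 
      = (\<lambda>g. mag c N m1 (Suc k) l g + rdiv N i (\<lambda>l'. pd (edge i l) (mag c N m1 (Suc k) l')) g)"
    unfolding rdiv_def using l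
    by (subst pd_divergence[OF _ row_pairs[OF i]]) (auto intro!: mag_tame simp: row_def)
  then show ?thesis
    unfolding defect_def lfield_eq rfield_def pd_add[OF tame_mult[OF tame_const dvm_tame[OF i]] remainder_tame[OF assms(1)]] pd_cmult[OF dvm_tame[OF i]]
    by (simp add: fun_eq_iff algebra_simps)
qed

text \<open>What the commutator leaves is the divergence of a field with one derivative inside, of
  order 1 / sqrt N, so with the prefactor the defect is of order 1 / N. A further derivative that
  touches \<open>i\<close> may cost one factor, as in \<open>rdiv_pds_bound2\<close>.\<close>

lemma defect_bound:
  assumes M: "mag_bounds (Suc k) C" and E: "remainder_bounds k C2"
  shows "\<exists>D. (\<forall>r q. 0 \<le> D r q) \<and> (\<forall>c N m1 B i l. valid N m1 \<longrightarrow> set B \<subseteq> site_pairs N \<longrightarrow> i \<in> {1..N} \<longrightarrow> l \<in> {1..N} \<longrightarrow> i \<noteq> l \<longrightarrow>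
     Lq (pairs N) (D (length B)) (if i \<in> ends B then isqrt N ^ (length B + 1) else isqrt N ^ (length B + 2)) (pds B (defect c N m1 k i l)))"
proof -
  have nn: "0 \<le> C2 r q" for r q using E by (simp add: remainder_bounds_def)
  obtain D where D_raw: "\<forall>r q. 0 \<le> D r q" "\<forall>c N m1 E B p. valid N m1 \<longrightarrow> set (E @ B) \<subseteq> site_pairs N \<longrightarrow> E @ B \<noteq> [] \<longrightarrow> p \<le> Suc N \<longrightarrow>
     Lq (pairs N) (D (length (E @ B))) (if p \<in> ends B then isqrt N ^ (length (E @ B) - 1) else isqrt N ^ length (E @ B))
       (pds B (rdiv N p (\<lambda>l. pds E (mag c N m1 (Suc k) l))))"
    using rdiv_pds_bound2[OF M] by (elim exE conjE) (rule that)
  note D = D_raw[rule_format]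
  define D' where "D' r q = (D (Suc r) q * bq q + C2 (Suc r) q) * 4 ^ (2 * q)" for r q
  have "Lq (pairs N) (D' (length B)) (if i \<in> ends B then isqrt N ^ (length B + 1) else isqrt N ^ (length B + 2)) (pds B (defect c N m1 k i l))"
    if v: "valid N m1" and es: "set B \<subseteq> site_pairs N" and i: "i \<in> {1..N}" and l: "l \<in> {1..N}" "i \<noteq> l" for c N m1 B i l
  proof -
    have i': "i \<le> Suc N" using i by auto
    have N: "N \<ge> 1" using valid_N[OF v] .
    have e: "edge i l \<in> site_pairs N" using edge_sites[OF i] l by (auto simp: row_def)
    let ?x = "if i \<in> ends B then isqrt N ^ (length B + 1) else isqrt N ^ (length B + 2)"
    let ?F = "rdiv N i (\<lambda>l'. pds [edge i l] (mag c N m1 (Suc k) l'))"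
    have "Lq (pairs N) (D (Suc (length B))) (if i \<in> ends B then isqrt N ^ length B else isqrt N ^ Suc (length B)) (pds B ?F)"
      using D(2)[OF v, of "[edge i l]" B i c] es e i' by (simp cong: if_cong)
    from Lq_beta_isqrt[OF this N]
    have 1: "Lq (pairs N) (\<lambda>q. D (Suc (length B)) q * bq q) ?x (\<lambda>g. \<beta> * isqrt N * pds B ?F g)"
      by (simp add: if_distrib[of "(*) (isqrt N)"] cong: if_cong)
    have "Lq (pairs N) (C2 (Suc (length B))) (isqrt N ^ (length B + 2)) (pds (edge i l # B) (remainder c N m1 k i))"
      using remainder_boundsD[OF E v, of "edge i l # B" i c] es e i by simp
    then have 2: "Lq (pairs N) (C2 (Suc (length B))) ?x (pds (edge i l # B) (remainder c N m1 k i))"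
      using isqrt_pos[OF N] isqrt_le[OF N] by (elim Lq_mono) (auto intro!: power_decreasing simp del: power_Suc)
    have t: "?F \<in> tame (pairs N)" by (intro rdiv_tame i' tame_pds mag_tame) (auto simp: row_def)
    have "pds B (defect c N m1 k i l) = (\<lambda>g. \<beta> * isqrt N * pds B ?F g + pds (edge i l # B) (remainder c N m1 k i) g)"
      unfolding defect_eq[OF i l] pds_add[OF tame_mult[OF tame_const t] tame_pds[OF remainder_tame[OF i]]] pds_cmult[OF t] by simp
    then show ?thesis using Lq_add2[OF 1 2] by (simp add: D'_def[abs_def] cong: if_cong)
  qed
  then show ?thesis using D(1) nn bq_nonneg by (intro exI[of _ D']) (auto simp: D'_def)
qed

end

section \<open>Derivative bounds through tanh and along the iteration\<close>

definition omsq :: "(nat \<Rightarrow> nat \<Rightarrow> real) \<Rightarrow> nat \<Rightarrow> nat \<Rightarrow> real" where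
  "omsq C r q = (1 + cml C C r q) * 4 ^ (2 * q)"

lemma omsq_nonneg: "(\<And>r q. 0 \<le> C r q) \<Longrightarrow> 0 \<le> omsq C r q"
  unfolding omsq_def by (intro mult_nonneg_nonneg add_nonneg_nonneg cml_nonneg) auto

text \<open>One factor per derivative is all that is asked here; in the products where this is used,
  the extra factor for untouched sites is supplied by the other factor.\<close>

lemma one_minus_sq_bound:
  assumes "F \<in> tame I" "0 < s" "s \<le> 1" "\<And>r q. 0 \<le> C r q"
    and "\<And>A. set A \<subseteq> set es \<Longrightarrow> length A \<le> length es \<Longrightarrow> Lq I (C (length A)) (s ^ length A) (pds A F)"
  shows "Lq I (omsq C (length es)) (s ^ length es) (pds es (\<lambda>g. 1 - (F g)\<^sup>2))"
proof -
  have 1: "Lq I (cml C C (length es)) (s ^ length es) (pds es (\<lambda>g. F g * F g))"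
  proof (rule leibniz_cml[where x = "\<lambda>A. s ^ length A" and y = "\<lambda>A. s ^ length A"])
    fix A B assume *: "mset A + mset B = mset es"
    then have l: "length A + length B = length es" by (metis size_mset size_union)
    show "Lq I (C (length A)) (s ^ length A) (pds A F)" "Lq I (C (length B)) (s ^ length B) (pds B F)"
      using mset_set_subset[OF *] l by (auto intro!: assms(5))
    show "s ^ length A * s ^ length B \<le> s ^ length es" by (simp add: l[symmetric] power_add)
  qed (use assms in auto)
  have "Lq I (\<lambda>q. 1) (s ^ length es) (\<lambda>g. if es = [] then 1 else 0)"
  proof (cases "es = []")
    case True
    have "Lq I (\<lambda>q. 1) 1 (\<lambda>g. 1)" by (rule Lq_bounded) auto
    then show ?thesis using True by simp
  qed (use assms(2) in \<open>auto intro!: Lq_zero\<close>)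
  from Lq_diff2[OF this[folded pds_const[of es 1]] 1]
  show ?thesis
    unfolding power2_eq_square pds_diff[OF tame_const tame_mult[OF assms(1,1)]] omsq_def[abs_def] .
qed

context amp begin

text \<open>The first derivative of tanh (h + Y) is (1 - tanh^2) times a derivative of Y, so order r
  + 1 follows from the orders up to r of the same function.\<close>

lemma tanh_bound_aux:
  assumes "\<And>r q. 0 \<le> Cy r q"
  shows "\<exists>C. (\<forall>r q. 0 \<le> C r q) \<and> (\<forall>N p Y es. N \<ge> 1 \<longrightarrow> Y \<in> tame (pairs N) \<longrightarrow>
     decay_bounds N Cy p Y \<longrightarrow> set es \<subseteq> site_pairs N \<longrightarrow> length es \<le> r \<longrightarrow>
     Lq (pairs N) (C (length es)) (isqrt N ^ decay p es) (pds es (\<lambda>g. tanh (h + Y g))))"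
proof (induction r)
  case 0
  have "Lq (pairs N) (\<lambda>q. 1) 1 (\<lambda>g. tanh (h + Y g))" if "Y \<in> tame (pairs N)" for N Y
    using that by (intro Lq_bounded abs_tanh_le_1 tame_tanh tame_add tame_const) auto
  then show ?case by (intro exI[of _ "\<lambda>r q. 1"]) (auto simp: decay_def)
next
  case (Suc r)
  obtain C where C_raw: "\<forall>r q. 0 \<le> C r q" "\<forall>N p Y es. N \<ge> 1 \<longrightarrow> Y \<in> tame (pairs N) \<longrightarrow>
     decay_bounds N Cy p Y \<longrightarrow> set es \<subseteq> site_pairs N \<longrightarrow> length es \<le> r \<longrightarrow>
     Lq (pairs N) (C (length es)) (isqrt N ^ decay p es) (pds es (\<lambda>g. tanh (h + Y g)))"
    using Suc by (elim exE conjE) (rule that)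
  have nn: "0 \<le> C r q" for r q using C_raw(1) by blast
  define D where "D a = (if a \<le> r then C a else cml (omsq C) (\<lambda>a. Cy (Suc a)) r)" for a
  have "Lq (pairs N) (D (length es)) (isqrt N ^ decay p es) (pds es (\<lambda>g. tanh (h + Y g)))"
    if N: "N \<ge> 1" and Y: "Y \<in> tame (pairs N)"
      and b: "decay_bounds N Cy p Y"
      and es: "set es \<subseteq> site_pairs N" "length es \<le> Suc r" for N p Y es
  proof (cases "length es \<le> r")
    case True
    have "Lq (pairs N) (C (length es)) (isqrt N ^ decay p es) (pds es (\<lambda>g. tanh (h + Y g)))"
      by (rule C_raw(2)[rule_format, OF N Y b es(1) True])
    then show ?thesis using True by (simp add: D_def)
  next
    case False
    then obtain e fs where e: "es = e # fs" "length fs = r" using es by (cases es) auto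
    let ?T = "\<lambda>g. tanh (h + Y g)"
    have hY: "(\<lambda>g. h + Y g) \<in> tame (pairs N)" using Y by (intro tame_add tame_const)
    then have T: "?T \<in> tame (pairs N)" by (rule tame_tanh)
    have s: "0 < isqrt N" "isqrt N \<le> 1" using isqrt_pos[OF N] isqrt_le[OF N] .
    have Tb: "Lq (pairs N) (C (length A)) (isqrt N ^ length A) (pds A ?T)" if "set A \<subseteq> set fs" "length A \<le> r" for A
    proof (rule Lq_mono)
      show "Lq (pairs N) (C (length A)) (isqrt N ^ decay p A) (pds A ?T)"
        by (rule C_raw(2)[rule_format, OF N Y b]) (use that es e in auto)
      show "isqrt N ^ decay p A \<le> isqrt N ^ length A" using s decay_ge[of A p] by (intro power_decreasing) auto
    qed simp
    have "pds es ?T = pds fs (\<lambda>g. (1 - (?T g)\<^sup>2) * pd e Y g)"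
      using pd_tanh[OF hY, of e] pd_add[OF tame_const[of h] Y, of e] by (simp add: e)
    \<comment> \<open>The first derivative \<open>e\<close> stays with Y, so the list
      \<open>e # B\<close> is never empty. As \<open>ends (e # B)\<close> lies in
      \<open>ends es\<close>, the extra factor for an untouched \<open>p\<close> is inherited from
      this factor.\<close>
    moreover have "Lq (pairs N) (cml (omsq C) (\<lambda>a. Cy (Suc a)) (length fs)) (isqrt N ^ decay p es) (pds fs (\<lambda>g. (1 - (?T g)\<^sup>2) * pd e Y g))"
    proof (rule leibniz_cml[where x = "\<lambda>A. isqrt N ^ length A" and y = "\<lambda>B. isqrt N ^ decay p (e # B)"])
      fix A B assume *: "mset A + mset B = mset fs"
      then have l: "length A + length B = length fs" by (metis size_mset size_union)
      have sub: "set A \<subseteq> set fs" "set B \<subseteq> set fs" using mset_set_subset[OF *] by auto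
      show "Lq (pairs N) (omsq C (length A)) (isqrt N ^ length A) (pds A (\<lambda>g. 1 - (?T g)\<^sup>2))"
        using sub l e by (intro one_minus_sq_bound T s nn Tb) auto
      show "Lq (pairs N) (Cy (Suc (length B))) (isqrt N ^ decay p (e # B)) (pds B (pd e Y))"
        using decay_boundsD[OF b, of "e # B"] sub es e by auto
      have "ends (e # B) \<subseteq> ends es" using sub e by (intro ends_mono) auto
      then have "decay p es \<le> length A + decay p (e # B)" using l e by (auto simp: decay_def)
      then show "isqrt N ^ length A * isqrt N ^ decay p (e # B) \<le> isqrt N ^ decay p es"
        using s unfolding power_add[symmetric] by (intro power_decreasing) auto
    next
      show "(\<lambda>g. 1 - (?T g)\<^sup>2) \<in> tame (pairs N)" by (intro tame_diff tame_power tame_const T)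
      show "pd e Y \<in> tame (pairs N)" by (rule tame_pd[OF Y])
      show "0 \<le> omsq C r q" for r q by (rule omsq_nonneg[OF nn])
      show "0 \<le> Cy (Suc r) q" for r q by (rule assms)
    qed
    ultimately show ?thesis using False e by (simp add: D_def)
  qed
  moreover have "0 \<le> D a q" for a q using nn assms by (auto simp: D_def intro!: cml_nonneg omsq_nonneg)
  ultimately show ?case by (intro exI[of _ D]) blast
qed

text \<open>The constants for orders up to r are used at order r; the diagonal \<open>C r r\<close>
  is a single family valid for all orders.\<close>

lemma tanh_bound:
  assumes "\<And>r q. 0 \<le> Cy r q"
  shows "\<exists>C. (\<forall>r q. 0 \<le> C r q) \<and> (\<forall>N p Y es. N \<ge> 1 \<longrightarrow> Y \<in> tame (pairs N) \<longrightarrow>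
     decay_bounds N Cy p Y \<longrightarrow> set es \<subseteq> site_pairs N \<longrightarrow>
     Lq (pairs N) (C (length es)) (isqrt N ^ decay p es) (pds es (\<lambda>g. tanh (h + Y g))))"
proof -
  have "\<exists>C. \<forall>r. (\<forall>r' q. 0 \<le> C r r' q) \<and> (\<forall>N p Y es. N \<ge> 1 \<longrightarrow> Y \<in> tame (pairs N) \<longrightarrow>
     decay_bounds N Cy p Y \<longrightarrow> set es \<subseteq> site_pairs N \<longrightarrow> length es \<le> r \<longrightarrow>
     Lq (pairs N) (C r (length es)) (isqrt N ^ decay p es) (pds es (\<lambda>g. tanh (h + Y g))))"
    by (intro choice allI tanh_bound_aux assms)
  then obtain C where C: "\<forall>r. (\<forall>r' q. 0 \<le> C r r' q) \<and> (\<forall>N p Y es. N \<ge> 1 \<longrightarrow> Y \<in> tame (pairs N) \<longrightarrow>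
     decay_bounds N Cy p Y \<longrightarrow> set es \<subseteq> site_pairs N \<longrightarrow> length es \<le> r \<longrightarrow>
     Lq (pairs N) (C r (length es)) (isqrt N ^ decay p es) (pds es (\<lambda>g. tanh (h + Y g))))"
    by (elim exE) (rule that)
  show ?thesis
  proof (intro exI[of _ "\<lambda>r. C r r"] conjI allI impI)
    show "0 \<le> C r r q" for r q using C by blast
  qed (use C in blast)
qed

lemma mag_bounds_0: "\<exists>C. mag_bounds (Suc 0) C"
proof (rule exI)
  show "mag_bounds (Suc 0) (\<lambda>r q. 1)"
    unfolding mag_bounds_def
  proof (intro conjI allI impI)
    fix c N m1 and es :: "(nat \<times> nat) list" and p
    assume v: "valid N m1" and p: "p \<in> {1..N}"
    have m: "mag c N m1 (Suc 0) p = (\<lambda>g. m1 p)" by (simp add: mag_simps)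
    show "Lq (pairs N) (\<lambda>q. 1) (isqrt N ^ decay p es) (pds es (mag c N m1 (Suc 0) p))"
    proof (cases "es = []")
      case True
      then show ?thesis using v p by (auto simp: m decay_def valid_def intro!: Lq_bounded)
    next
      case False
      then show ?thesis unfolding m pds_const using isqrt_pos[OF valid_N[OF v]] by (auto intro!: Lq_zero)
    qed
  qed auto
qed

lemma mag_bounds_Suc:
  assumes "mag_bounds (Suc k) C" "remainder_bounds k C2"
  shows "\<exists>D. mag_bounds (Suc (Suc k)) D"
proof -
  obtain Cy where Cy_raw: "\<forall>r q. 0 \<le> Cy r q" "\<forall>c N m1 p. valid N m1 \<longrightarrow> p \<in> {1..N} \<longrightarrow> decay_bounds N Cy p (lfield c N m1 k p)"
    using lfield_bound[OF assms] by (elim exE conjE) (rule that)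
  have Cyn: "0 \<le> Cy r q" for r q using Cy_raw(1) by blast
  obtain D where D: "\<forall>r q. 0 \<le> D r q" "\<forall>N p Y es. N \<ge> 1 \<longrightarrow> Y \<in> tame (pairs N) \<longrightarrow>
     decay_bounds N Cy p Y \<longrightarrow> set es \<subseteq> site_pairs N \<longrightarrow>
     Lq (pairs N) (D (length es)) (isqrt N ^ decay p es) (pds es (\<lambda>g. tanh (h + Y g)))"
    using tanh_bound[of Cy, OF Cyn] by (elim exE conjE) (rule that)
  have "mag_bounds (Suc (Suc k)) D"
    unfolding mag_bounds_def
  proof (intro conjI allI impI)
    show "0 \<le> D r q" for r q using D(1) by blast
    fix c N m1 es p assume *: "valid N m1" "set es \<subseteq> site_pairs N" "p \<in> {1..N}"
    show "Lq (pairs N) (D (length es)) (isqrt N ^ decay p es) (pds es (mag c N m1 (Suc (Suc k)) p))"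
      unfolding mag_simps
      by (rule D(2)[rule_format, OF valid_N[OF *(1)] lfield_tame[OF *(3)] _ *(2)])
        (use Cy_raw(2) * in blast)
  qed
  then show ?thesis by blast
qed

text \<open>The start is constant in the disorder and the iterate with index 0 is zero, so for the
  first choice both the derivative sum and the Onsager term vanish.\<close>

lemma remainder_bounds_0: "\<exists>C. remainder_bounds 0 C"
proof (rule exI)
  have z: "remainder c N m1 0 p = (\<lambda>g. 0)" for c N m1 p
  proof (cases c)
    case Onsager_Overlap
    have "partial_deriv p l (\<lambda>g. a) = (\<lambda>g. 0)" for l a by (simp add: partial_deriv_def fun_eq_iff)
    then have "lfield c N m1 0 p g = \<beta> * isqrt N * rdiv N p (mag c N m1 (Suc 0)) g" for g
      unfolding Onsager_Overlap lfield_Overlap rdiv_expand by (simp add: mag_simps)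
    then show ?thesis by (simp add: remainder_def)
  qed (simp add: remainder_Derivative)
  show "remainder_bounds 0 (\<lambda>r q. 1)"
    unfolding remainder_bounds_def z using isqrt_pos[OF valid_N] by (auto intro!: Lq_zero)
qed

text \<open>By the chain rule the derivative in g_il of the iterate at l is (1 - m_l^2) times the
  sum of beta m_i / sqrt N and a defect. Summed over l, the first part reproduces the overlap form
  of the Onsager term up to the diagonal l = i; the defects and the diagonal remain.\<close>

lemma remainder_Overlap_Suc:
  assumes v: "valid N m1" and i: "i \<in> {1..N}"
  shows "remainder Onsager_Overlap N m1 (Suc k) i = (\<lambda>g.
      \<beta> * isqrt N * (\<Sum>l\<in>row N i. (1 - (mag Onsager_Overlap N m1 (Suc (Suc k)) l g)\<^sup>2) * defect Onsager_Overlap N m1 k l i g)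
      - \<beta> * isqrt N * (\<beta> * isqrt N * ((1 - (mag Onsager_Overlap N m1 (Suc (Suc k)) i g)\<^sup>2) * mag Onsager_Overlap N m1 (Suc k) i g)))"
proof
  fix g
  let ?c = Onsager_Overlap
  have N: "N \<ge> 1" using valid_N[OF v] .
  define M where "M l = mag ?c N m1 (Suc (Suc k)) l g" for l
  define a where "a = mag ?c N m1 (Suc k) i g"
  have pdM: "pd (edge i l) (mag ?c N m1 (Suc (Suc k)) l) g = (1 - (M l)\<^sup>2) * (defect ?c N m1 k l i g + \<beta> * isqrt N * a)"
    if "l \<in> row N i" for l
  proof -
    have l: "l \<in> {1..N}" using that by (auto simp: row_def)
    have "pd (edge i l) (mag ?c N m1 (Suc (Suc k)) l) g = (1 - (M l)\<^sup>2) * pd (edge i l) (lfield ?c N m1 k l) g"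
      unfolding M_def mag_simps pd_tanh[OF tame_add[OF tame_const lfield_tame[OF l]]] pd_add[OF tame_const lfield_tame[OF l]] by simp
    then show ?thesis by (simp add: defect_def a_def edge_commute)
  qed
  have "remainder ?c N m1 (Suc k) i g = \<beta> * isqrt N * (\<Sum>l=1..N. partial_deriv i l (mag ?c N m1 (Suc (Suc k)) l) g)
      - \<beta>\<^sup>2 * (1 - (1 / real N) * (\<Sum>l=1..N. M l * M l)) * a"
    unfolding remainder_def lfield_Overlap rdiv_expand by (simp add: M_def a_def algebra_simps)
  also have "(\<Sum>l=1..N. partial_deriv i l (mag ?c N m1 (Suc (Suc k)) l) g)
      = (\<Sum>l\<in>row N i. pd (edge i l) (mag ?c N m1 (Suc (Suc k)) l) g)"
    using i by (subst sum.remove[of _ i]) (auto simp: partial_deriv_def[of i i] row_def partial_deriv_edge intro!: sum.cong)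
  also have "\<dots> = (\<Sum>l\<in>row N i. (1 - (M l)\<^sup>2) * defect ?c N m1 k l i g) + \<beta> * isqrt N * a * (\<Sum>l\<in>row N i. 1 - (M l)\<^sup>2)"
    by (simp add: pdM distrib_left sum.distrib sum_distrib_left mult_ac)
  \<comment> \<open>The overlap averages over all sites, including i, which the row omits.\<close>
  also have "1 - (1 / real N) * (\<Sum>l=1..N. M l * M l) = (isqrt N)\<^sup>2 * ((\<Sum>l\<in>row N i. 1 - (M l)\<^sup>2) + (1 - (M i)\<^sup>2))"
  proof -
    have "(\<Sum>l\<in>row N i. 1 - (M l)\<^sup>2) + (1 - (M i)\<^sup>2) = (\<Sum>l=1..N. 1 - (M l)\<^sup>2)"
      using i unfolding row_def by (subst (2) sum.remove[of _ i]) auto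
    also have "\<dots> = real N - (\<Sum>l=1..N. M l * M l)" by (simp add: sum_subtractf power2_eq_square)
    finally show ?thesis using N by (simp add: isqrt_def power_divide field_simps)
  qed
  finally show "remainder ?c N m1 (Suc k) i g = \<beta> * isqrt N * (\<Sum>l\<in>row N i. (1 - (mag ?c N m1 (Suc (Suc k)) l g)\<^sup>2) * defect ?c N m1 k l i g)
      - \<beta> * isqrt N * (\<beta> * isqrt N * ((1 - (mag ?c N m1 (Suc (Suc k)) i g)\<^sup>2) * mag ?c N m1 (Suc k) i g))"
    by (simp add: M_def a_def power2_eq_square algebra_simps)
qed

lemma mag_length_bound:
  assumes "mag_bounds k C" "valid N m1" "set A \<subseteq> site_pairs N" "p \<in> {1..N}"
  shows "Lq (pairs N) (C (length A)) (isqrt N ^ length A) (pds A (mag c N m1 k p))"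
  using isqrt_pos[OF valid_N[OF assms(2)]] isqrt_le[OF valid_N[OF assms(2)]] decay_ge[of A p]
  by (intro Lq_mono[OF mag_boundsD[OF assms]] power_decreasing) auto

text \<open>Write s = 1 / sqrt N and r for the number of derivatives. The at most 2 r touched sites
  have defect terms of order s^(r+1); the others gain one more factor and sum to N s^(r+2) = s^r.
  The prefactor beta s then yields s^(r+1), and the diagonal term carries this prefactor
  twice.\<close>

lemma remainder_bounds_Suc:
  assumes M: "mag_bounds (Suc k) C" and M2: "mag_bounds (Suc (Suc k)) C'" and E: "remainder_bounds k C2"
  shows "\<exists>D. remainder_bounds (Suc k) D"
proof -
  have nn: "0 \<le> C r q" "0 \<le> C' r q" for r q using M M2 by (auto simp: mag_bounds_def)
  obtain R where R_raw: "\<forall>r q. 0 \<le> R r q" "\<forall>c N m1 B i l. valid N m1 \<longrightarrow> set B \<subseteq> site_pairs N \<longrightarrow> i \<in> {1..N} \<longrightarrow> l \<in> {1..N} \<longrightarrow> i \<noteq> l \<longrightarrow>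
     Lq (pairs N) (R (length B)) (if i \<in> ends B then isqrt N ^ (length B + 1) else isqrt N ^ (length B + 2)) (pds B (defect c N m1 k i l))"
    using defect_bound[OF M E] by (elim exE conjE) (rule that)
  note R = R_raw[rule_format]
  define T where "T r q = cml (omsq C') R r q" for r q
  define S where "S r q = (T r q * (2 * real r + 1) ^ (2 * q) + T r q) * 4 ^ (2 * q)" for r q
  define P where "P r q = (S r q * bq q + cml (omsq C') C r q * bq q * bq q) * 4 ^ (2 * q)" for r q
  have Tn: "0 \<le> T r q" for r q unfolding T_def by (intro cml_nonneg omsq_nonneg nn R)
  have Pn: "0 \<le> P r q" for r q unfolding P_def S_def
    by (intro mult_nonneg_nonneg add_nonneg_nonneg Tn bq_nonneg cml_nonneg omsq_nonneg nn) auto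
  have "Lq (pairs N) (P (length es)) (isqrt N ^ (length es + 1)) (pds es (remainder c N m1 (Suc k) i))"
    if v: "valid N m1" and es: "set es \<subseteq> site_pairs N" and i: "i \<in> {1..N}" for c N m1 es i
  proof (cases c)
    case Onsager_Derivative
    show ?thesis unfolding Onsager_Derivative remainder_Derivative pds_zero
      using isqrt_pos[OF valid_N[OF v]] Pn by (intro Lq_zero) auto
  next
    case Onsager_Overlap
    define r where "r = length es"
    let ?M = "\<lambda>l. mag c N m1 (Suc (Suc k)) l"
    have N: "N \<ge> 1" using valid_N[OF v] .
    have s: "0 < isqrt N" "isqrt N \<le> 1" using isqrt_pos[OF N] isqrt_le[OF N] .
    have om: "Lq (pairs N) (omsq C' (length A)) (isqrt N ^ length A) (pds A (\<lambda>g. 1 - (?M l g)\<^sup>2))"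
      if "set A \<subseteq> set es" "l \<in> {1..N}" for A l
      using that es by (intro one_minus_sq_bound mag_tame s nn mag_length_bound[OF M2 v]) auto
    have tom: "(\<lambda>g. 1 - (?M l g)\<^sup>2) \<in> tame (pairs N)" if "l \<in> {1..N}" for l
      using mag_tame[OF that] by (intro tame_diff tame_power tame_const)
    have tR: "defect c N m1 k l i \<in> tame (pairs N)" if "l \<in> {1..N}" for l
      unfolding defect_def using that i by (intro tame_diff tame_mult tame_const tame_pd lfield_tame mag_tame) auto
    define F where "F l = (\<lambda>g. (1 - (?M l g)\<^sup>2) * defect c N m1 k l i g)" for l
    have tF: "F l \<in> tame (pairs N)" if "l \<in> {1..N}" for l
      unfolding F_def using tom tR that by (intro tame_mult) auto
    have Fb: "Lq (pairs N) (T r) (if l \<in> ends es then isqrt N ^ (r + 1) else isqrt N ^ (r + 2)) (pds es (F l))" 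
      if l: "l \<in> {1..N}" "l \<noteq> i" for l
      unfolding F_def T_def[abs_def] r_def
    proof (rule leibniz_cml[where x = "\<lambda>A. isqrt N ^ length A"
          and y = "\<lambda>B. if l \<in> ends B then isqrt N ^ (length B + 1) else isqrt N ^ (length B + 2)"])
      fix A B assume *: "mset A + mset B = mset es"
      then have len: "length A + length B = length es" by (metis size_mset size_union)
      have sub: "set A \<subseteq> set es" "set B \<subseteq> set es" using mset_set_subset[OF *] by auto
      show "Lq (pairs N) (omsq C' (length A)) (isqrt N ^ length A) (pds A (\<lambda>g. 1 - (?M l g)\<^sup>2))"
        using om sub l by auto
      show "Lq (pairs N) (R (length B)) (if l \<in> ends B then isqrt N ^ (length B + 1) else isqrt N ^ (length B + 2)) (pds B (defect c N m1 k l i))"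
        using sub es l i by (intro R(2)[OF v]) auto
      have Bes: "ends B \<subseteq> ends es" by (rule ends_mono[OF sub(2)])
      have e: "isqrt N ^ (length es + 1) = isqrt N ^ length A * isqrt N ^ (length B + 1)" "isqrt N ^ (length es + 2) = isqrt N ^ length A * isqrt N ^ (length B + 2)"
        unfolding len[symmetric] by (simp_all add: power_add)
      have d: "isqrt N ^ (length es + 2) \<le> isqrt N ^ (length es + 1)" using s by (intro power_decreasing) auto
      show "isqrt N ^ length A * (if l \<in> ends B then isqrt N ^ (length B + 1) else isqrt N ^ (length B + 2))
          \<le> (if l \<in> ends es then isqrt N ^ (length es + 1) else isqrt N ^ (length es + 2))"
        using Bes d unfolding e by auto
    qed (use tom tR l nn R(1) in \<open>auto intro!: omsq_nonneg\<close>)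
    define V where "V = row N i \<inter> ends es"
    have "card V \<le> card (ends es)" unfolding V_def by (intro card_mono finite_ends) auto
    then have "card V \<le> 2 * r" using card_ends[of es] by (simp add: r_def)
    \<comment> \<open>The added 1 keeps the scale in \<open>Lq_sum\<close> positive for r =
      0.\<close>
    then have cV: "real (card V) \<le> 2 * real r + 1" by linarith
    have "Lq (pairs N) (T r) ((2 * real r + 1) * isqrt N ^ (r + 1)) (\<lambda>g. \<Sum>l\<in>V. pds es (F l) g)"
    proof (rule Lq_sum[OF _ cV])
      fix l assume "l \<in> V"
      then show "Lq (pairs N) (T r) (isqrt N ^ (r + 1)) (pds es (F l))" using Fb[of l] by (auto simp: V_def row_def)
    qed (use s Tn finite_row in \<open>auto simp: V_def\<close>)
    then have "Lq (pairs N) (\<lambda>q. T r q * (2 * real r + 1) ^ (2 * q)) (isqrt N ^ (r + 1)) (\<lambda>g. \<Sum>l\<in>V. pds es (F l) g)"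
      by (rule Lq_rescale) auto
    then have b1: "Lq (pairs N) (\<lambda>q. T r q * (2 * real r + 1) ^ (2 * q)) (isqrt N ^ r) (\<lambda>g. \<Sum>l\<in>V. pds es (F l) g)"
      using s by (elim Lq_mono) (auto intro!: power_decreasing simp del: power_Suc)
    have cW: "real (card (row N i - ends es)) \<le> real N"
      using card_mono[of "row N i" "row N i - ends es"] card_row[of N i] by auto
    have "Lq (pairs N) (T r) (real N * isqrt N ^ (r + 2)) (\<lambda>g. \<Sum>l\<in>row N i - ends es. pds es (F l) g)"
    proof (rule Lq_sum[OF _ cW])
      fix l assume "l \<in> row N i - ends es"
      then show "Lq (pairs N) (T r) (isqrt N ^ (r + 2)) (pds es (F l))" using Fb[of l] by (auto simp: row_def)
    qed (use s Tn N in auto)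
    moreover have "real N * isqrt N ^ (r + 2) = isqrt N ^ r"
      using isqrt_sq[OF N] by (simp add: power_add power2_eq_square mult_ac)
    ultimately have b2: "Lq (pairs N) (T r) (isqrt N ^ r) (\<lambda>g. \<Sum>l\<in>row N i - ends es. pds es (F l) g)" by (simp only:)
    have "(\<Sum>l\<in>row N i. pds es (F l) g) = (\<Sum>l\<in>V. pds es (F l) g) + (\<Sum>l\<in>row N i - ends es. pds es (F l) g)" for g
      unfolding V_def by (subst sum.Int_Diff[of _ _ "ends es"]) auto
    with Lq_add2[OF b1 b2] have "Lq (pairs N) (S r) (isqrt N ^ r) (\<lambda>g. \<Sum>l\<in>row N i. pds es (F l) g)"
      by (simp add: S_def[abs_def])
    from Lq_beta_isqrt[OF this N] have b3: "Lq (pairs N) (\<lambda>q. S r q * bq q) (isqrt N ^ (r + 1)) (\<lambda>g. \<beta> * isqrt N * (\<Sum>l\<in>row N i. pds es (F l) g))"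
      by simp
    define G where "G = (\<lambda>g. (1 - (?M i g)\<^sup>2) * mag c N m1 (Suc k) i g)"
    have tG: "G \<in> tame (pairs N)" unfolding G_def using tom mag_tame i by (intro tame_mult) auto
    have "Lq (pairs N) (cml (omsq C') C r) (isqrt N ^ r) (pds es G)"
      unfolding G_def r_def
    proof (rule leibniz_cml[where x = "\<lambda>A. isqrt N ^ length A" and y = "\<lambda>A. isqrt N ^ length A"])
      fix A B assume *: "mset A + mset B = mset es"
      then have len: "length A + length B = length es" by (metis size_mset size_union)
      have sub: "set A \<subseteq> set es" "set B \<subseteq> set es" using mset_set_subset[OF *] by auto
      show "Lq (pairs N) (omsq C' (length A)) (isqrt N ^ length A) (pds A (\<lambda>g. 1 - (?M i g)\<^sup>2))" using om sub i by auto
      show "Lq (pairs N) (C (length B)) (isqrt N ^ length B) (pds B (mag c N m1 (Suc k) i))"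
        using sub es i by (intro mag_length_bound[OF M v]) auto
      show "isqrt N ^ length A * isqrt N ^ length B \<le> isqrt N ^ length es" by (simp add: len[symmetric] power_add)
    qed (use tom mag_tame i nn in \<open>auto intro!: omsq_nonneg\<close>)
    from Lq_beta_isqrt[OF Lq_beta_isqrt[OF this N] N]
    have "Lq (pairs N) (\<lambda>q. cml (omsq C') C r q * bq q * bq q) (isqrt N * (isqrt N * isqrt N ^ r)) (\<lambda>g. \<beta> * isqrt N * (\<beta> * isqrt N * pds es G g))" .
    moreover have "isqrt N * (isqrt N * isqrt N ^ r) \<le> isqrt N ^ (r + 1)"
      using s power_decreasing[of "r + 1" "r + 2" "isqrt N"] by simp
    ultimately have b4: "Lq (pairs N) (\<lambda>q. cml (omsq C') C r q * bq q * bq q) (isqrt N ^ (r + 1)) (\<lambda>g. \<beta> * isqrt N * (\<beta> * isqrt N * pds es G g))"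
      by (rule Lq_mono) simp
    have row: "l \<in> row N i \<Longrightarrow> l \<in> {1..N}" for l by (simp add: row_def)
    have tS: "(\<lambda>g. \<Sum>l\<in>row N i. F l g) \<in> tame (pairs N)" using tF row by (intro tame_sum) auto
    have "remainder c N m1 (Suc k) i = (\<lambda>g. \<beta> * isqrt N * (\<Sum>l\<in>row N i. F l g) - \<beta> * isqrt N * (\<beta> * isqrt N * G g))"
      unfolding F_def G_def Onsager_Overlap by (rule remainder_Overlap_Suc[OF v i])
    then have "pds es (remainder c N m1 (Suc k) i) = (\<lambda>g. \<beta> * isqrt N * (\<Sum>l\<in>row N i. pds es (F l) g) - \<beta> * isqrt N * (\<beta> * isqrt N * pds es G g))"
      using pds_diff[OF tame_mult[OF tame_const tS] tame_mult[OF tame_const tame_mult[OF tame_const tG]]]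
        pds_cmult[OF tS] pds_cmult[OF tame_mult[OF tame_const tG]] pds_cmult[OF tG] pds_sum[of "row N i" F "pairs N" es] tF row
      by simp
    then show ?thesis using Lq_diff2[OF b3 b4] by (simp add: P_def[abs_def] r_def)
  qed
  then show ?thesis using Pn by (intro exI[of _ P]) (simp add: remainder_bounds_def)
qed

text \<open>The two bounds have to be proved together: the next iterate needs the current remainder,
  and the next remainder needs two consecutive iterates and the current remainder.\<close>

lemma mag_bounds_remainder_bounds: "(\<exists>C. mag_bounds (Suc k) C) \<and> (\<exists>C. remainder_bounds k C)"
proof (induction k)
  case 0
  show ?case using mag_bounds_0 remainder_bounds_0 by blast
next
  case (Suc k)
  then obtain C C2 where *: "mag_bounds (Suc k) C" "remainder_bounds k C2" by blast
  obtain C' where "mag_bounds (Suc (Suc k)) C'" using mag_bounds_Suc[OF *] by blast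
  with remainder_bounds_Suc[OF *(1) this *(2)] show ?case by blast
qed

end

section \<open>Gaussian interpolation\<close>

text \<open>The mean value theorem bounds all difference quotients by the integrable function
  \<open>B\<close>, so dominated convergence applies along every sequence of increments.\<close>

lemma gE_has_derivative:
  assumes K: "\<And>t. K t \<in> tame I" and K': "\<And>t. K' t \<in> tame I" and B: "B \<in> tame I"
    and d: "\<And>t g. ((\<lambda>t. K t g) has_real_derivative K' t g) (at t)"
    and b: "\<And>t g. \<bar>K' t g\<bar> \<le> B g"
  shows "((\<lambda>t. gE I (K t)) has_real_derivative gE I (K' t)) (at t)"
proof -
  have q: "\<bar>(K y g - K t g) / (y - t)\<bar> \<le> B g" for y g
  proof (cases "y = t")
    case True
    then show ?thesis using order_trans[OF abs_ge_zero b] by simp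
  next
    case False
    have "norm (K y g - K t g) \<le> B g * norm (y - t)"
      by (rule field_differentiable_bound[of UNIV "\<lambda>t. K t g" "\<lambda>t. K' t g"]) (use d b in \<open>auto\<close>)
    then show ?thesis using False by (simp add: divide_le_eq)
  qed
  have "((\<lambda>y. gE I (\<lambda>g. (K y g - K t g) / (y - t))) \<longlongrightarrow> gE I (K' t)) (at t)"
    unfolding tendsto_at_iff_sequentially comp_def
  proof (intro allI impI)
    fix X :: "nat \<Rightarrow> real" assume X: "\<forall>i. X i \<in> UNIV - {t}" "X \<longlonglongrightarrow> t"
    show "(\<lambda>n. gE I (\<lambda>g. (K (X n) g - K t g) / (X n - t))) \<longlonglongrightarrow> gE I (K' t)"
      unfolding gE_def
    proof (rule integral_dominated_convergence)
      show "integrable (gauss_measure I) B" using B by (rule tame_integrable)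
      show "K' t \<in> borel_measurable (gauss_measure I)" using K' by (rule tame_measurable)
      show "(\<lambda>g. (K (X n) g - K t g) / (X n - t)) \<in> borel_measurable (gauss_measure I)" for n
        using tame_measurable[OF K[of "X n"]] tame_measurable[OF K[of t]] by measurable
      show "AE g in gauss_measure I. norm ((K (X n) g - K t g) / (X n - t)) \<le> B g" for n
        using q by (intro AE_I2) (simp only: real_norm_def)
      show "AE g in gauss_measure I. (\<lambda>n. (K (X n) g - K t g) / (X n - t)) \<longlonglongrightarrow> K' t g"
      proof (intro AE_I2)
        fix g
        have "((\<lambda>y. (K y g - K t g) / (y - t)) \<longlongrightarrow> K' t g) (at t)"
          using d[of g t] by (simp add: has_field_derivative_iff)
        then show "(\<lambda>n. (K (X n) g - K t g) / (X n - t)) \<longlonglongrightarrow> K' t g"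
          using X unfolding tendsto_at_iff_sequentially comp_def by blast
      qed
    qed
  qed
  moreover have "gE I (\<lambda>g. (K y g - K t g) / (y - t)) = (gE I (K y) - gE I (K t)) / (y - t)" for y
    using gE_cmult[of I "1 / (y - t)" "\<lambda>g. K y g - K t g"] gE_diff[OF K[of y] K[of t]] by simp
  ultimately show ?thesis by (simp add: has_field_derivative_iff)
qed

section \<open>Test functions and the rotation path\<close>

context amp begin

definition th :: "real \<Rightarrow> real" where "th x = tanh (h + x)"
definition th' :: "real \<Rightarrow> real" where "th' x = 1 - (th x)\<^sup>2"
text \<open>\<open>w = 1\<close> gives the integrand of \<open>psi\<close> and \<open>w = 0\<close> that of \<open>chi\<close>; the other functions are the partial
  derivatives of \<open>u0\<close>.\<close>

definition u0 :: "real \<Rightarrow> real \<Rightarrow> real \<Rightarrow> real" where "u0 w x y = th x * ((1 - w) + w * th y)"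
definition u1 :: "real \<Rightarrow> real \<Rightarrow> real \<Rightarrow> real" where "u1 w x y = th' x * ((1 - w) + w * th y)"
definition u2 :: "real \<Rightarrow> real \<Rightarrow> real \<Rightarrow> real" where "u2 w x y = th x * (w * th' y)"
definition u11 :: "real \<Rightarrow> real \<Rightarrow> real \<Rightarrow> real" where "u11 w x y = - 2 * th x * th' x * ((1 - w) + w * th y)"
definition u12 :: "real \<Rightarrow> real \<Rightarrow> real \<Rightarrow> real" where "u12 w x y = th' x * (w * th' y)"
definition u22 :: "real \<Rightarrow> real \<Rightarrow> real \<Rightarrow> real" where "u22 w x y = th x * (w * (- 2 * th y * th' y))"

lemma th_abs: "\<bar>th x\<bar> \<le> 1" by (simp add: th_def abs_tanh_le_1)
lemma th'_abs: "\<bar>th' x\<bar> \<le> 1"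
proof -
  have "(th x)\<^sup>2 \<le> 1" using th_abs[of x] by (simp add: abs_square_le_1)
  then show ?thesis by (simp add: th'_def)
qed

lemma wth_abs: "0 \<le> w \<Longrightarrow> w \<le> 1 \<Longrightarrow> \<bar>(1 - w) + w * th y\<bar> \<le> 1"
proof -
  assume w: "0 \<le> w" "w \<le> 1"
  have "\<bar>(1 - w) + w * th y\<bar> \<le> (1 - w) + w * \<bar>th y\<bar>"
    using w by (intro order_trans[OF abs_triangle_ineq]) (simp add: abs_mult)
  also have "\<dots> \<le> (1 - w) + w * 1" using w th_abs[of y] by (intro add_left_mono mult_left_mono) auto
  finally show ?thesis by simp
qed

lemma abs_mult_le: "\<bar>a\<bar> \<le> c \<Longrightarrow> \<bar>b\<bar> \<le> d \<Longrightarrow> \<bar>a * b\<bar> \<le> c * (d :: real)"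
  unfolding abs_mult by (intro mult_mono) auto

lemma u_abs:
  assumes "0 \<le> w" "w \<le> 1"
  shows "\<bar>u0 w x y\<bar> \<le> 1" "\<bar>u1 w x y\<bar> \<le> 2" "\<bar>u2 w x y\<bar> \<le> 2"
    "\<bar>u11 w x y\<bar> \<le> 2" "\<bar>u12 w x y\<bar> \<le> 2" "\<bar>u22 w x y\<bar> \<le> 2"
proof -
  have w: "\<bar>w\<bar> \<le> 1" using assms by simp
  have m2: "\<bar>- 2 :: real\<bar> \<le> 2" by simp
  note b = th_abs th'_abs wth_abs[OF assms] w m2
  show "\<bar>u0 w x y\<bar> \<le> 1" unfolding u0_def using abs_mult_le[OF b(1,3)] by simp
  show "\<bar>u1 w x y\<bar> \<le> 2" unfolding u1_def using abs_mult_le[OF b(2,3), of x y] by simp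
  show "\<bar>u2 w x y\<bar> \<le> 2" unfolding u2_def using abs_mult_le[OF b(1) abs_mult_le[OF b(4,2)], of x y] by simp
  show "\<bar>u11 w x y\<bar> \<le> 2" unfolding u11_def
    using abs_mult_le[OF abs_mult_le[OF abs_mult_le[OF b(5,1)] b(2)] b(3), of x x y] by simp
  show "\<bar>u12 w x y\<bar> \<le> 2" unfolding u12_def using abs_mult_le[OF b(2) abs_mult_le[OF b(4,2)], of x y] by simp
  show "\<bar>u22 w x y\<bar> \<le> 2" unfolding u22_def
    using abs_mult_le[OF b(1) abs_mult_le[OF b(4) abs_mult_le[OF abs_mult_le[OF b(5,1)] b(2)]], of x y y] by simp
qed

lemma th_tame [intro]: "X \<in> tame I \<Longrightarrow> (\<lambda>g. th (X g)) \<in> tame I"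
  unfolding th_def by (intro tame_tanh tame_add tame_const)

lemma th'_tame [intro]: "X \<in> tame I \<Longrightarrow> (\<lambda>g. th' (X g)) \<in> tame I"
  unfolding th'_def by (intro tame_diff tame_power tame_const th_tame)

lemma u_tame:
  assumes "X \<in> tame I" "Y \<in> tame I"
  shows "(\<lambda>g. u0 w (X g) (Y g)) \<in> tame I" "(\<lambda>g. u1 w (X g) (Y g)) \<in> tame I" "(\<lambda>g. u2 w (X g) (Y g)) \<in> tame I"
    "(\<lambda>g. u11 w (X g) (Y g)) \<in> tame I" "(\<lambda>g. u12 w (X g) (Y g)) \<in> tame I" "(\<lambda>g. u22 w (X g) (Y g)) \<in> tame I"
  unfolding u0_def u1_def u2_def u11_def u12_def u22_def
  by (intro tame_mult tame_add tame_const th_tame th'_tame assms)+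

lemma th_deriv: "(th has_real_derivative th' x) (at x)"
  unfolding th_def[abs_def] th'_def by (auto intro!: derivative_eq_intros simp: th_def)

lemma th'_deriv: "(th' has_real_derivative - 2 * th x * th' x) (at x)"
  unfolding th'_def[abs_def] by (auto intro!: derivative_eq_intros th_deriv simp: th'_def)

lemma pd_u:
  assumes X: "X \<in> tame I" and Y: "Y \<in> tame I"
  shows "pd e (\<lambda>g. u0 w (X g) (Y g)) = (\<lambda>g. u1 w (X g) (Y g) * pd e X g + u2 w (X g) (Y g) * pd e Y g)"
    "pd e (\<lambda>g. u1 w (X g) (Y g)) = (\<lambda>g. u11 w (X g) (Y g) * pd e X g + u12 w (X g) (Y g) * pd e Y g)"
    "pd e (\<lambda>g. u2 w (X g) (Y g)) = (\<lambda>g. u12 w (X g) (Y g) * pd e X g + u22 w (X g) (Y g) * pd e Y g)"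
proof -
  note d = DERIV_chain2[OF th_deriv tame_has_pd'[OF X]] DERIV_chain2[OF th_deriv tame_has_pd'[OF Y]]
    DERIV_chain2[OF th'_deriv tame_has_pd'[OF X]] DERIV_chain2[OF th'_deriv tame_has_pd'[OF Y]]
  show "pd e (\<lambda>g. u0 w (X g) (Y g)) = (\<lambda>g. u1 w (X g) (Y g) * pd e X g + u2 w (X g) (Y g) * pd e Y g)"
    unfolding u0_def u1_def u2_def
    by (intro ext pd_eqI) (rule derivative_eq_intros d refl | simp add: algebra_simps)+
  show "pd e (\<lambda>g. u1 w (X g) (Y g)) = (\<lambda>g. u11 w (X g) (Y g) * pd e X g + u12 w (X g) (Y g) * pd e Y g)"
    unfolding u1_def u11_def u12_def
    by (intro ext pd_eqI) (rule derivative_eq_intros d refl | simp add: algebra_simps)+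
  show "pd e (\<lambda>g. u2 w (X g) (Y g)) = (\<lambda>g. u12 w (X g) (Y g) * pd e X g + u22 w (X g) (Y g) * pd e Y g)"
    unfolding u2_def u12_def u22_def
    by (intro ext pd_eqI) (rule derivative_eq_intros d refl | simp add: algebra_simps)+
qed

lemma u0_has_derivative:
  assumes "(f has_real_derivative f') (at t)" "(k has_real_derivative k') (at t)"
  shows "((\<lambda>t. u0 w (f t) (k t)) has_real_derivative u1 w (f t) (k t) * f' + u2 w (f t) (k t) * k') (at t)"
  unfolding u0_def u1_def u2_def
  by (rule derivative_eq_intros DERIV_chain2[OF th_deriv assms(1)] DERIV_chain2[OF th_deriv assms(2)] refl | simp add: algebra_simps)+

text \<open>A quarter turn from Y at t = 0 to Z at t = pi / 2. For independent centered Gaussians of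
  equal variance, position and velocity are uncorrelated at every t; this is the model for the
  cancellations below.\<close>

definition rot :: "real \<Rightarrow> (('e \<Rightarrow> real) \<Rightarrow> real) \<Rightarrow> (('e \<Rightarrow> real) \<Rightarrow> real) \<Rightarrow> ('e \<Rightarrow> real) \<Rightarrow> real" where
  "rot t Y Z = (\<lambda>g. cos t * Y g + sin t * Z g)"

definition rot' :: "real \<Rightarrow> (('e \<Rightarrow> real) \<Rightarrow> real) \<Rightarrow> (('e \<Rightarrow> real) \<Rightarrow> real) \<Rightarrow> ('e \<Rightarrow> real) \<Rightarrow> real" where
  "rot' t Y Z = (\<lambda>g. - sin t * Y g + cos t * Z g)"

lemma rot_tame: "Y \<in> tame I \<Longrightarrow> Z \<in> tame I \<Longrightarrow> rot t Y Z \<in> tame I"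
  unfolding rot_def by (intro tame_add tame_mult tame_const)

lemma rot'_tame: "Y \<in> tame I \<Longrightarrow> Z \<in> tame I \<Longrightarrow> rot' t Y Z \<in> tame I"
  unfolding rot'_def by (intro tame_add tame_mult tame_const)

lemma rot'_abs: "\<bar>rot' t Y Z g\<bar> \<le> 2 + (Y g)\<^sup>2 + (Z g)\<^sup>2"
proof -
  have *: "\<bar>a\<bar> \<le> 1 + a\<^sup>2" for a :: real
    using sum_squares_bound[of 1 "\<bar>a\<bar>"] by (simp add: abs_if split: if_splits)
  have "\<bar>rot' t Y Z g\<bar> \<le> \<bar>sin t * Y g\<bar> + \<bar>cos t * Z g\<bar>"
    unfolding rot'_def by linarith
  also have "\<bar>sin t * Y g\<bar> \<le> 1 * \<bar>Y g\<bar>" unfolding abs_mult by (intro mult_right_mono) auto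
  also have "\<bar>cos t * Z g\<bar> \<le> 1 * \<bar>Z g\<bar>" unfolding abs_mult by (intro mult_right_mono) auto
  finally show ?thesis using *[of "Y g"] *[of "Z g"] by linarith
qed

text \<open>The hypotheses bound the two parts of the derivative along the path, one for each
  argument of \<open>u0\<close>; the factor \<open>F\<close> does not move.\<close>

lemma interpolation:
  fixes I :: "'e set"
  assumes w: "0 \<le> w" "w \<le> 1" and t: "Y1 \<in> tame I" "Y2 \<in> tame I" "Z1 \<in> tame I" "Z2 \<in> tame I" "F \<in> tame I"
    and b1: "\<And>t. \<bar>gE I (\<lambda>g. rot' t Y1 Z1 g * (u1 w (rot t Y1 Z1 g) (rot t Y2 Z2 g) * F g))\<bar> \<le> M1"
    and b2: "\<And>t. \<bar>gE I (\<lambda>g. rot' t Y2 Z2 g * (u2 w (rot t Y1 Z1 g) (rot t Y2 Z2 g) * F g))\<bar> \<le> M2"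
  shows "\<bar>gE I (\<lambda>g. u0 w (Y1 g) (Y2 g) * F g) - gE I (\<lambda>g. u0 w (Z1 g) (Z2 g) * F g)\<bar> \<le> 2 * (M1 + M2)"
proof -
  define K where "K t = (\<lambda>g. u0 w (rot t Y1 Z1 g) (rot t Y2 Z2 g) * F g)" for t
  define P where "P t = (\<lambda>g. rot' t Y1 Z1 g * (u1 w (rot t Y1 Z1 g) (rot t Y2 Z2 g) * F g))" for t
  define Q where "Q t = (\<lambda>g. rot' t Y2 Z2 g * (u2 w (rot t Y1 Z1 g) (rot t Y2 Z2 g) * F g))" for t
  define B where "B = (\<lambda>g. ((2 + (Y1 g)\<^sup>2 + (Z1 g)\<^sup>2) + (2 + (Y2 g)\<^sup>2 + (Z2 g)\<^sup>2)) * (2 * (1 + (F g)\<^sup>2)))"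
  note r = rot_tame[OF t(1,3)] rot_tame[OF t(2,4)] rot'_tame[OF t(1,3)] rot'_tame[OF t(2,4)]
  have tK: "K t \<in> tame I" and tP: "P t \<in> tame I" and tQ: "Q t \<in> tame I" for t
    unfolding K_def P_def Q_def by (intro tame_mult u_tame r t(5))+
  have F: "\<bar>F g\<bar> \<le> 1 + (F g)\<^sup>2" for g
    using sum_squares_bound[of 1 "\<bar>F g\<bar>"] by (simp add: abs_if split: if_splits)
  have "((\<lambda>t. gE I (K t)) has_real_derivative gE I (\<lambda>g. P s g + Q s g)) (at s)" for s
  proof (rule gE_has_derivative)
    show "K t \<in> tame I" for t by (rule tK)
    show "(\<lambda>g. P t g + Q t g) \<in> tame I" for t by (intro tame_add tP tQ)
    show "B \<in> tame I" unfolding B_def by (intro tame_mult tame_add tame_const tame_power t)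
    fix t g
    have "((\<lambda>t. rot t Y Z g) has_real_derivative rot' t Y Z g) (at t)" for Y Z :: "('e \<Rightarrow> real) \<Rightarrow> real"
      unfolding rot_def rot'_def by (auto intro!: derivative_eq_intros)
    from DERIV_cmult_right[OF u0_has_derivative[OF this[of Y1 Z1] this[of Y2 Z2]], of w "F g"]
    show "((\<lambda>t. K t g) has_real_derivative P t g + Q t g) (at t)"
      unfolding K_def P_def Q_def by (simp add: algebra_simps)
    have "\<bar>P t g\<bar> \<le> (2 + (Y1 g)\<^sup>2 + (Z1 g)\<^sup>2) * (2 * (1 + (F g)\<^sup>2))"
      unfolding P_def by (intro abs_mult_le rot'_abs u_abs w F)
    moreover have "\<bar>Q t g\<bar> \<le> (2 + (Y2 g)\<^sup>2 + (Z2 g)\<^sup>2) * (2 * (1 + (F g)\<^sup>2))"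
      unfolding Q_def by (intro abs_mult_le rot'_abs u_abs w F)
    ultimately show "\<bar>P t g + Q t g\<bar> \<le> B g"
      unfolding B_def distrib_right[of "2 + (Y1 g)\<^sup>2 + (Z1 g)\<^sup>2"] by linarith
  qed
  then have d: "((\<lambda>t. gE I (K t)) has_real_derivative gE I (\<lambda>g. P s g + Q s g)) (at s within S)" for s S
    by (rule has_field_derivative_at_within)
  have bd: "norm (gE I (\<lambda>g. P s g + Q s g)) \<le> M1 + M2" for s
    unfolding gE_add[OF tP tQ] using b1[of s] b2[of s] unfolding P_def Q_def real_norm_def by linarith
  have "norm (gE I (K 0) - gE I (K (pi / 2))) \<le> (M1 + M2) * norm (0 - pi / 2)"
    by (rule field_differentiable_bound[of UNIV "\<lambda>t. gE I (K t)" "\<lambda>s. gE I (\<lambda>g. P s g + Q s g)"]) (use d bd in auto)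
  \<comment> \<open>The path has length pi / 2 < 2, whence the factor 2 of the claim.\<close>
  also have "\<dots> \<le> (M1 + M2) * 2"
    using bd[of 0] pi_half_less_two order_trans[OF norm_ge_zero bd[of 0]] by (intro mult_left_mono) auto
  finally show ?thesis by (simp add: K_def rot_def mult_ac)
qed

end

section \<open>Linear forms in Gaussian coordinates and the functions \<open>psi\<close> and
  \<open>chi\<close>\<close>

lemma tame_cong_outside:
  assumes "F \<in> tame J" "\<And>e. e \<in> J \<Longrightarrow> g e = g' e" shows "F g = F g'"
  using assms by (induction rule: tame.induct) auto

lemma gE_insert_outside:
  assumes "finite J" "e \<notin> J" "F \<in> tame J"
  shows "gE (insert e J) F = gE J F"
proof -
  have "F (g(e := x)) = F g" for g x using assms by (intro tame_cong_outside[OF assms(3)]) auto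
  then show ?thesis
    unfolding gauss_measure_insert[OF assms(1,2) tame_mono[OF assms(3) subset_insertI]]
    using prob_space.prob_space[OF prob_space_std_normal] by (simp add: gE_def)
qed

lemma gE_superset:
  assumes "finite K" "finite J" "F \<in> tame J"
  shows "gE (J \<union> K) F = gE J F"
  using assms(1)
proof induction
  case (insert e K)
  then show ?case
  proof (cases "e \<in> J \<union> K")
    case False
    then show ?thesis using gE_insert_outside[of "J \<union> K" e F] insert assms by (auto intro: tame_mono)
  qed (simp add: insert_absorb)
qed simp

definition lin :: "'e set \<Rightarrow> ('e \<Rightarrow> real) \<Rightarrow> ('e \<Rightarrow> real) \<Rightarrow> real" where
  "lin I a = (\<lambda>g. \<Sum>e\<in>I. a e * g e)"

lemma lin_tame: "lin I a \<in> tame I"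
  unfolding lin_def by (intro tame_sum tame_mult tame_const tame_coord)

lemma pd_lin:
  assumes "finite I" "e \<in> I" shows "pd e (lin I a) = (\<lambda>g. a e)"
proof -
  have "pd e (lin I a) = (\<lambda>g. \<Sum>e'\<in>I. pd e (\<lambda>g. a e' * g e') g)"
    unfolding lin_def by (intro pd_sum[of _ _ I] tame_mult tame_const tame_coord)
  also have "\<dots> = (\<lambda>g. \<Sum>e'\<in>I. if e = e' then a e' else 0)"
    by (intro ext sum.cong refl) (simp add: pd_cmult[OF tame_coord] pd_coord)
  finally show ?thesis using assms by simp
qed

lemma gE_lin:
  assumes "finite I" "H \<in> tame I"
  shows "gE I (\<lambda>g. lin I a g * H g) = (\<Sum>e\<in>I. a e * gE I (pd e H))"
proof -
  have "gE I (\<lambda>g. lin I a g * H g) = gE I (\<lambda>g. \<Sum>e\<in>I. a e * (g e * H g))"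
    unfolding lin_def by (simp add: sum_distrib_right mult.assoc)
  also have "\<dots> = (\<Sum>e\<in>I. a e * gE I (\<lambda>g. g e * H g))"
  proof (subst gE_sum)
    show "(\<lambda>g. a e * (g e * H g)) \<in> tame I" if "e \<in> I" for e
      using that by (intro tame_mult tame_const tame_coord assms(2))
  qed (simp add: gE_cmult)
  finally show ?thesis using assms by (simp add: ibp)
qed

context amp begin

text \<open>After integration by parts the inner products of \<open>a\<close> and of
  \<open>b\<close> enter with the factors - sin t cos t and cos t sin t and cancel by
  \<open>eq\<close>; the mixed ones vanish by \<open>orth\<close>.\<close>

lemma gE_rot'_lin:
  assumes I: "finite I" and W: "W \<in> tame I" "V1 \<in> tame I" "V2 \<in> tame I"
    and pdW: "\<And>e. e \<in> I \<Longrightarrow> pd e W = (\<lambda>g. V1 g * pd e (rot t (lin I a1) (lin I b1)) g + V2 g * pd e (rot t (lin I a2) (lin I b2)) g)"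
    and orth: "(\<Sum>e\<in>I. a e * b1 e) = 0" "(\<Sum>e\<in>I. a e * b2 e) = 0" "(\<Sum>e\<in>I. b e * a1 e) = 0" "(\<Sum>e\<in>I. b e * a2 e) = 0"
    and eq: "(\<Sum>e\<in>I. a e * a1 e) = (\<Sum>e\<in>I. b e * b1 e)" "(\<Sum>e\<in>I. a e * a2 e) = (\<Sum>e\<in>I. b e * b2 e)"
  shows "gE I (\<lambda>g. rot' t (lin I a) (lin I b) g * W g) = 0"
proof -
  have pr: "pd e (rot t (lin I a) (lin I b)) = (\<lambda>g. cos t * a e + sin t * b e)" if "e \<in> I" for e a b
    unfolding rot_def using that I
    by (simp add: pd_add[OF tame_mult[OF tame_const lin_tame] tame_mult[OF tame_const lin_tame]] pd_cmult[OF lin_tame] pd_lin)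
  have g: "gE I (pd e W) = (cos t * a1 e + sin t * b1 e) * gE I V1 + (cos t * a2 e + sin t * b2 e) * gE I V2" if "e \<in> I" for e
  proof -
    have "pd e W = (\<lambda>g. (cos t * a1 e + sin t * b1 e) * V1 g + (cos t * a2 e + sin t * b2 e) * V2 g)"
      unfolding pdW[OF that] pr[OF that] by (simp add: mult.commute)
    then show ?thesis using W by (simp add: gE_add[OF tame_mult[OF tame_const] tame_mult[OF tame_const]] gE_cmult)
  qed
  have L: "gE I (\<lambda>g. lin I c g * W g) = (cos t * (\<Sum>e\<in>I. c e * a1 e) + sin t * (\<Sum>e\<in>I. c e * b1 e)) * gE I V1
      + (cos t * (\<Sum>e\<in>I. c e * a2 e) + sin t * (\<Sum>e\<in>I. c e * b2 e)) * gE I V2" for c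
    unfolding gE_lin[OF I W(1)]
    by (simp add: g sum_distrib_left sum_distrib_right sum.distrib algebra_simps)
  have "gE I (\<lambda>g. rot' t (lin I a) (lin I b) g * W g)
      = gE I (\<lambda>g. (- sin t) * (lin I a g * W g) + cos t * (lin I b g * W g))"
    unfolding rot'_def by (simp add: algebra_simps)
  also have "\<dots> = (- sin t) * gE I (\<lambda>g. lin I a g * W g) + cos t * gE I (\<lambda>g. lin I b g * W g)"
    using W lin_tame by (subst gE_add) (auto simp only: gE_cmult intro!: tame_mult tame_const)
  also have "\<dots> = 0" unfolding L orth eq by (simp add: algebra_simps)
  finally show ?thesis .
qed

text \<open>Along the rotation path the covariance is constant, so Gaussian integration by parts makes the
  derivative of the expectation vanish identically.\<close>

lemma gE_linear_forms_eq:
  fixes I :: "'e set"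
  assumes I: "finite I" and w: "0 \<le> w" "w \<le> 1"
    and orth: "(\<Sum>e\<in>I. a1 e * b1 e) = 0" "(\<Sum>e\<in>I. a1 e * b2 e) = 0" "(\<Sum>e\<in>I. a2 e * b1 e) = 0" "(\<Sum>e\<in>I. a2 e * b2 e) = 0"
    and eq: "(\<Sum>e\<in>I. a1 e * a1 e) = (\<Sum>e\<in>I. b1 e * b1 e)" "(\<Sum>e\<in>I. a1 e * a2 e) = (\<Sum>e\<in>I. b1 e * b2 e)"
      "(\<Sum>e\<in>I. a2 e * a2 e) = (\<Sum>e\<in>I. b2 e * b2 e)"
  shows "gE I (\<lambda>g. u0 w (lin I a1 g) (lin I a2 g)) = gE I (\<lambda>g. u0 w (lin I b1 g) (lin I b2 g))"
proof -
  have orth': "(\<Sum>e\<in>I. b1 e * a1 e) = 0" "(\<Sum>e\<in>I. b2 e * a1 e) = 0" "(\<Sum>e\<in>I. b1 e * a2 e) = 0" "(\<Sum>e\<in>I. b2 e * a2 e) = 0"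
    and eq': "(\<Sum>e\<in>I. a2 e * a1 e) = (\<Sum>e\<in>I. b2 e * b1 e)"
    using orth eq(2) by (simp_all add: mult.commute)
  note r = rot_tame[OF lin_tame lin_tame]
  have 1: "gE I (\<lambda>g. rot' t (lin I a1) (lin I b1) g * u1 w (rot t (lin I a1) (lin I b1) g) (rot t (lin I a2) (lin I b2) g)) = 0" for t
    by (rule gE_rot'_lin[OF I u_tame(2)[OF r r] u_tame(4)[OF r r] u_tame(5)[OF r r] pd_u(2)[OF r r]])
      (rule orth orth' eq)+
  have 2: "gE I (\<lambda>g. rot' t (lin I a2) (lin I b2) g * u2 w (rot t (lin I a1) (lin I b1) g) (rot t (lin I a2) (lin I b2) g)) = 0" for t
    by (rule gE_rot'_lin[OF I u_tame(3)[OF r r] u_tame(5)[OF r r] u_tame(6)[OF r r] pd_u(3)[OF r r]])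
      (rule orth orth' eq eq')+
  have "\<bar>gE I (\<lambda>g. u0 w (lin I a1 g) (lin I a2 g) * 1) - gE I (\<lambda>g. u0 w (lin I b1 g) (lin I b2 g) * 1)\<bar> \<le> 2 * (0 + 0)"
    by (rule interpolation[OF w lin_tame lin_tame lin_tame lin_tame tame_const]) (simp_all add: 1 2)
  then show ?thesis by simp
qed

lemma measurable_std_pair:
  "borel_measurable (std_normal_distribution \<Otimes>\<^sub>M std_normal_distribution) = borel_measurable (borel \<Otimes>\<^sub>M borel)"
  by (intro measurable_cong_sets sets_pair_measure_cong) auto

lemma gE_pair:
  assumes "p \<noteq> q" and \<Phi>: "(\<lambda>g. \<Phi> (g p) (g q)) \<in> tame {p, q}"
    and m: "case_prod \<Phi> \<in> borel_measurable (borel \<Otimes>\<^sub>M borel)"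
  shows "gE {p, q} (\<lambda>g. \<Phi> (g p) (g q)) = (\<integral>x. (\<integral>y. \<Phi> x y \<partial>std_normal_distribution) \<partial>std_normal_distribution)"
proof -
  interpret product_prob_space "\<lambda>e. std_normal_distribution" UNIV
    by (rule product_prob_space_gauss_measure)
  have ins: "{p, q} = insert q {p}" by auto
  have m': "(\<lambda>x. \<integral>y. \<Phi> x y \<partial>std_normal_distribution) \<in> borel_measurable std_normal_distribution"
    by (rule sigma_finite_measure.borel_measurable_lebesgue_integral[OF prob_space_imp_sigma_finite[OF prob_space_std_normal]])
      (simp only: measurable_std_pair m)
  have "gE {p, q} (\<lambda>g. \<Phi> (g p) (g q)) = (\<integral>g. (\<integral>y. \<Phi> (g p) y \<partial>std_normal_distribution) \<partial>gauss_measure {p})"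
    unfolding ins using assms by (subst gauss_measure_insert) (auto simp: insert_commute)
  also have "\<dots> = (\<integral>x. (\<integral>y. \<Phi> x y \<partial>std_normal_distribution) \<partial>std_normal_distribution)"
    unfolding gauss_measure_def by (rule product_integral_singleton[OF m'])
  finally show ?thesis .
qed

lemma continuous_measurable_pair:
  fixes f :: "real \<Rightarrow> real \<Rightarrow> real"
  assumes "continuous_on UNIV (\<lambda>x. f (fst x) (snd x))"
  shows "case_prod f \<in> borel_measurable (borel \<Otimes>\<^sub>M borel)"
  unfolding borel_prod split_beta' using assms by (rule borel_measurable_continuous_onI)

lemma psi_eq_double:
  assumes "p \<noteq> q"
  shows "psi \<beta> h t t' t'' = gE {p, q} (\<lambda>g. u0 1 (\<beta> * (sqrt t' * g p)) (\<beta> * (t / sqrt t' * g p + sqrt (t'' - t\<^sup>2 / t') * g q)))"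
proof -
  let ?S = std_normal_distribution
  interpret S: prob_space ?S by simp
  interpret P: pair_prob_space ?S ?S ..
  define a b d where "a = sqrt t'" and "b = t / sqrt t'" and "d = sqrt (t'' - t\<^sup>2 / t')"
  define \<Phi> where "\<Phi> x y = u0 1 (\<beta> * (a * x)) (\<beta> * (b * x + d * y))" for x y
  have m: "case_prod \<Phi> \<in> borel_measurable (borel \<Otimes>\<^sub>M borel)"
    by (rule continuous_measurable_pair) (unfold \<Phi>_def u0_def th_def, intro continuous_intros, auto)
  have mt: "(\<lambda>(z', z''). tanh (h + \<beta> * z') * tanh (h + \<beta> * z'')) \<in> borel_measurable (borel :: (real \<times> real) measure)"
    unfolding split_beta' by (intro borel_measurable_continuous_onI continuous_intros) auto
  have i: "integrable (?S \<Otimes>\<^sub>M ?S) (case_prod \<Phi>)"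
  proof (rule P.P.integrable_const_bound[where B = 1])
    show "AE x in ?S \<Otimes>\<^sub>M ?S. norm (case_prod \<Phi> x) \<le> 1"
      using u_abs(1)[of 1] by (auto simp: \<Phi>_def)
    show "case_prod \<Phi> \<in> borel_measurable (?S \<Otimes>\<^sub>M ?S)" by (simp only: measurable_std_pair m)
  qed
  have T: "(\<lambda>(x, y). (sqrt t' * x, t / sqrt t' * x + sqrt (t'' - t\<^sup>2 / t') * y)) \<in> ?S \<Otimes>\<^sub>M ?S \<rightarrow>\<^sub>M borel"
    by (auto simp: split_beta' borel_prod[symmetric])
  have "psi \<beta> h t t' t'' = (\<integral>x. case_prod \<Phi> x \<partial>(?S \<Otimes>\<^sub>M ?S))"
    unfolding psi_def gaussian_pair_def integral_distr[OF T mt]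
  proof (rule Bochner_Integration.integral_cong[OF refl])
    fix x :: "real \<times> real"
    show "(case case x of (x, y) \<Rightarrow> (sqrt t' * x, t / sqrt t' * x + sqrt (t'' - t\<^sup>2 / t') * y) of
        (z', z'') \<Rightarrow> tanh (h + \<beta> * z') * tanh (h + \<beta> * z'')) = case_prod \<Phi> x"
      by (cases x) (simp only: prod.case \<Phi>_def u0_def th_def a_def b_def d_def, simp)
  qed
  also have "\<dots> = (\<integral>x. (\<integral>y. \<Phi> x y \<partial>?S) \<partial>?S)"
    using P.integral_fst[OF i] by simp
  also have "\<dots> = gE {p, q} (\<lambda>g. \<Phi> (g p) (g q))"
  proof (rule gE_pair[OF assms _ m, symmetric])
    show "(\<lambda>g. \<Phi> (g p) (g q)) \<in> tame {p, q}"
      unfolding \<Phi>_def by (intro u_tame tame_mult tame_add tame_const tame_coord) auto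
  qed
  finally show ?thesis by (simp add: \<Phi>_def a_def b_def d_def)
qed

lemma chi_eq_double:
  assumes "p \<noteq> q"
  shows "chi \<beta> h t = gE {p, q} (\<lambda>g. u0 0 (\<beta> * (sqrt t * g p)) 0)"
proof -
  let ?S = std_normal_distribution
  have "gE {p, q} (\<lambda>g. (\<lambda>x y. u0 0 (\<beta> * (sqrt t * x)) 0) (g p) (g q)) = (\<integral>x. (\<integral>y. u0 0 (\<beta> * (sqrt t * x)) 0 \<partial>?S) \<partial>?S)"
  proof (rule gE_pair[OF assms])
    show "(\<lambda>g. u0 0 (\<beta> * (sqrt t * g p)) 0) \<in> tame {p, q}"
      by (intro u_tame tame_mult tame_add tame_const tame_coord) auto
    show "(\<lambda>(x, y :: real). u0 0 (\<beta> * (sqrt t * x)) 0) \<in> borel_measurable (borel \<Otimes>\<^sub>M borel)"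
      by (rule continuous_measurable_pair) (unfold u0_def th_def, intro continuous_intros, auto)
  qed
  moreover have "(\<integral>y. u0 0 (\<beta> * (sqrt t * x)) 0 \<partial>?S) = tanh (h + \<beta> * sqrt t * x)" for x
  proof -
    have "(\<integral>y. u0 0 (\<beta> * (sqrt t * x)) 0 \<partial>?S) = u0 0 (\<beta> * (sqrt t * x)) 0"
      using prob_space.prob_space[OF prob_space_std_normal] by (simp only: lebesgue_integral_const scaleR_one)
    then show ?thesis by (simp add: u0_def th_def mult.assoc)
  qed
  ultimately show ?thesis unfolding chi_def by (simp only:)
qed

text \<open>Coordinates \<open>p\<close> and \<open>q\<close> outside \<open>J\<close> make the two
  pairs of forms orthogonal, so equality of covariances suffices for
  \<open>gE_linear_forms_eq\<close>. The coefficients a, b, d form a Cholesky factor, which exists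
  for degenerate covariances too.\<close>

lemma gE_u0_reduce:
  fixes J :: "(nat \<times> nat) set"
  assumes J: "finite J" "p \<notin> J" "q \<notin> J" "p \<noteq> q" and w: "0 \<le> w" "w \<le> 1"
    and eq: "a * a = (\<Sum>e\<in>J. u e * u e)" "a * b = (\<Sum>e\<in>J. u e * v e)" "b * b + d * d = (\<Sum>e\<in>J. v e * v e)"
  shows "gE J (\<lambda>g. u0 w (lin J u g) (lin J v g)) = gE {p, q} (\<lambda>g. u0 w (a * g p) (b * g p + d * g q))"
proof -
  define I where "I = J \<union> {p, q}"
  define f where "f c = (\<lambda>e. if e \<in> J then c e else 0)" for c :: "nat \<times> nat \<Rightarrow> real"
  define k where "k x y = (\<lambda>e. if e = p then x else if e = q then y else 0)" for x y :: real
  have I: "finite I" using J by (simp add: I_def)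
  have split: "(\<Sum>e\<in>I. F e) = (\<Sum>e\<in>J. F e) + (F p + F q)" for F :: "nat \<times> nat \<Rightarrow> real"
    unfolding I_def using J by (subst sum.union_disjoint) auto
  have kJ: "k x y e = 0" if "e \<in> J" for x y e using that J by (auto simp: k_def)
  have fl: "lin I (f c) = lin J c" for c unfolding lin_def split using J by (simp add: f_def)
  have kl: "lin I (k x y) = (\<lambda>g. x * g p + y * g q)" for x y
    unfolding lin_def split using J by (simp add: kJ) (simp add: k_def)
  have "gE J (\<lambda>g. u0 w (lin J u g) (lin J v g)) = gE I (\<lambda>g. u0 w (lin J u g) (lin J v g))"
    unfolding I_def using J by (intro gE_superset[symmetric] u_tame lin_tame) auto
  also have "\<dots> = gE I (\<lambda>g. u0 w (lin I (f u) g) (lin I (f v) g))" by (simp add: fl)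
  also have "\<dots> = gE I (\<lambda>g. u0 w (lin I (k a 0) g) (lin I (k b d) g))"
    by (rule gE_linear_forms_eq[OF I w]; unfold split)
       (use J eq in \<open>simp_all add: kJ, simp_all add: f_def k_def\<close>)
  also have "\<dots> = gE ({p, q} \<union> J) (\<lambda>g. u0 w (a * g p) (b * g p + d * g q))"
    unfolding kl unfolding I_def by (simp add: Un_commute)
  also have "\<dots> = gE {p, q} (\<lambda>g. u0 w (a * g p) (b * g p + d * g q))"
    using J by (intro gE_superset u_tame tame_add tame_mult tame_const tame_coord) auto
  finally show ?thesis .
qed

lemma fresh_pair: "finite J \<Longrightarrow> \<exists>p q :: nat \<times> nat. p \<notin> J \<and> q \<notin> J \<and> p \<noteq> q"
proof -
  assume "finite J"
  then obtain p :: "nat \<times> nat" where p: "p \<notin> J" using ex_new_if_finite[of J] by (auto simp: infinite_UNIV_char_0 finite_prod)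
  from \<open>finite J\<close> obtain q :: "nat \<times> nat" where "q \<notin> insert p J" using ex_new_if_finite[of "insert p J"] by (auto simp: finite_prod)
  with p show ?thesis by blast
qed

text \<open>The two-coordinate forms chosen in the reduction have beta times the coefficients in
  \<open>gaussian_pair\<close>, and the law of the forms depends on their covariance alone.\<close>

lemma psi_eq:
  fixes J :: "(nat \<times> nat) set"
  assumes J: "finite J"
  shows "gE J (\<lambda>g. u0 1 (lin J (\<lambda>e. \<beta> * u e) g) (lin J (\<lambda>e. \<beta> * v e) g))
     = psi \<beta> h (\<Sum>e\<in>J. u e * v e) (\<Sum>e\<in>J. u e * u e) (\<Sum>e\<in>J. v e * v e)"
proof -
  obtain p q :: "nat \<times> nat" where pq: "p \<notin> J" "q \<notin> J" "p \<noteq> q" using fresh_pair[OF J] by blast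
  define t t' t'' where "t = (\<Sum>e\<in>J. u e * v e)" and "t' = (\<Sum>e\<in>J. u e * u e)" and "t'' = (\<Sum>e\<in>J. v e * v e)"
  have t': "0 \<le> t'" "0 \<le> t''" unfolding t'_def t''_def by (auto intro: sum_nonneg)
  have cs: "t\<^sup>2 \<le> t' * t''"
    using Cauchy_Schwarz_ineq_sum[of u v J] by (simp add: t_def t'_def t''_def power2_eq_square)
  have isqrt: "(\<Sum>e\<in>J. \<beta> * x e * (\<beta> * y e)) = \<beta> * \<beta> * (\<Sum>e\<in>J. x e * y e)" for x y :: "nat \<times> nat \<Rightarrow> real"
    by (simp add: sum_distrib_left mult_ac)
  have e1: "sqrt t' * sqrt t' = t'" using t' by simp
  \<comment> \<open>For t' = 0 Cauchy-Schwarz forces t = 0, which agrees with the convention x / 0 =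
    0.\<close>
  have e2: "sqrt t' * (t / sqrt t') = t"
  proof (cases "t' = 0")
    case True
    then show ?thesis using cs by simp
  qed (use t' in simp)
  have le: "t\<^sup>2 / t' \<le> t''"
    using cs t' by (cases "t' = 0") (auto simp: field_simps)
  have e3: "(t / sqrt t') * (t / sqrt t') + sqrt (t'' - t\<^sup>2 / t') * sqrt (t'' - t\<^sup>2 / t') = t''"
    using le t' by (simp add: power2_eq_square)
  have "gE J (\<lambda>g. u0 1 (lin J (\<lambda>e. \<beta> * u e) g) (lin J (\<lambda>e. \<beta> * v e) g))
     = gE {p, q} (\<lambda>g. u0 1 ((\<beta> * sqrt t') * g p) ((\<beta> * (t / sqrt t')) * g p + (\<beta> * sqrt (t'' - t\<^sup>2 / t')) * g q))"
  proof (rule gE_u0_reduce[OF J pq])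
    show "\<beta> * sqrt t' * (\<beta> * sqrt t') = (\<Sum>e\<in>J. \<beta> * u e * (\<beta> * u e))"
      unfolding isqrt t'_def[symmetric] using e1 by (simp add: algebra_simps)
    show "\<beta> * sqrt t' * (\<beta> * (t / sqrt t')) = (\<Sum>e\<in>J. \<beta> * u e * (\<beta> * v e))"
      unfolding isqrt t_def[symmetric] using e2 by (metis mult.assoc mult.left_commute)
    have "\<beta> * (t / sqrt t') * (\<beta> * (t / sqrt t')) + \<beta> * sqrt (t'' - t\<^sup>2 / t') * (\<beta> * sqrt (t'' - t\<^sup>2 / t'))
       = \<beta> * \<beta> * ((t / sqrt t') * (t / sqrt t') + sqrt (t'' - t\<^sup>2 / t') * sqrt (t'' - t\<^sup>2 / t'))"
      by (simp only: distrib_left mult_ac)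
    then show "\<beta> * (t / sqrt t') * (\<beta> * (t / sqrt t')) + \<beta> * sqrt (t'' - t\<^sup>2 / t') * (\<beta> * sqrt (t'' - t\<^sup>2 / t'))
       = (\<Sum>e\<in>J. \<beta> * v e * (\<beta> * v e))"
      unfolding isqrt t''_def[symmetric] e3 .
  qed auto
  also have "\<dots> = psi \<beta> h t t' t''"
    unfolding psi_eq_double[OF pq(3)] by (simp only: distrib_left mult.assoc)
  finally show ?thesis unfolding t_def t'_def t''_def .
qed

text \<open>With w = 0 the value of \<open>u0\<close> is independent of its second argument, so
  \<open>f\<close> can be replaced by the zero form and the reduction applies with b = d =
  0.\<close>

lemma chi_eq:
  fixes J :: "(nat \<times> nat) set"
  assumes J: "finite J"
  shows "gE J (\<lambda>g. u0 0 (lin J (\<lambda>e. \<beta> * u e) g) (f g)) = chi \<beta> h (\<Sum>e\<in>J. u e * u e)"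
proof -
  obtain p q :: "nat \<times> nat" where pq: "p \<notin> J" "q \<notin> J" "p \<noteq> q" using fresh_pair[OF J] by blast
  have z: "u0 0 x y = u0 0 x 0" for x y by (simp add: u0_def)
  have "gE J (\<lambda>g. u0 0 (lin J (\<lambda>e. \<beta> * u e) g) (f g)) = gE J (\<lambda>g. u0 0 (lin J (\<lambda>e. \<beta> * u e) g) (lin J (\<lambda>e. 0) g))"
    unfolding z[of _ "f _"] by (simp add: lin_def)
  also have "\<dots> = gE {p, q} (\<lambda>g. u0 0 ((\<beta> * sqrt (\<Sum>e\<in>J. u e * u e)) * g p) (0 * g p + 0 * g q))"
    by (rule gE_u0_reduce[OF J pq])
      (auto simp: sum_distrib_left mult_ac sum_nonneg simp flip: real_sqrt_mult)
  also have "\<dots> = chi \<beta> h (\<Sum>e\<in>J. u e * u e)"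
    unfolding chi_eq_double[OF pq(3)] by (simp add: mult.assoc)
  finally show ?thesis .
qed

end

section \<open>Comparison with independent copies\<close>

lemma gE_union:
  assumes "finite I" "finite J" "I \<inter> J = {}" "F \<in> tame (I \<union> J)"
  shows "gE (I \<union> J) F = (\<integral>g. gE J (\<lambda>z. F (merge I J (g, z))) \<partial>gauss_measure I)"
proof -
  interpret product_prob_space "\<lambda>e. std_normal_distribution" UNIV
    by (rule product_prob_space_gauss_measure)
  show ?thesis
    using product_integral_fold[OF assms(3,1,2) tame_integrable[OF assms(4), unfolded gauss_measure_def]]
    unfolding gE_def gauss_measure_def .
qed

lemma merge_in: "e \<in> I \<Longrightarrow> merge I J (g, z) e = g e"
  by (simp add: merge_def)

lemma merge_right: "I \<inter> J = {} \<Longrightarrow> e \<in> J \<Longrightarrow> merge I J (g, z) e = z e"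
proof -
  assume "I \<inter> J = {}" "e \<in> J"
  then have "e \<notin> I" by blast
  then show ?thesis using \<open>e \<in> J\<close> by (simp add: merge_def)
qed

lemma gE_product:
  assumes "finite I" "finite J" "I \<inter> J = {}" "F \<in> tame I" "G \<in> tame J"
  shows "gE (I \<union> J) (\<lambda>g. F g * G g) = gE I F * gE J G"
proof -
  have t: "(\<lambda>g. F g * G g) \<in> tame (I \<union> J)"
    by (rule tame_mult[OF tame_mono[OF assms(4)] tame_mono[OF assms(5)]]) auto
  have F: "F (merge I J (g, z)) = F g" for g z
    by (rule tame_cong_outside[OF assms(4)]) (rule merge_in)
  have G: "G (merge I J (g, z)) = G z" for g z
    by (rule tame_cong_outside[OF assms(5)]) (rule merge_right[OF assms(3)])
  show ?thesis unfolding gE_union[OF assms(1-3) t] F G gE_cmult by (simp add: gE_def)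
qed

section \<open>One site against one Gaussian copy\<close>

context amp begin

lemma gE_rdiv:
  assumes "p \<le> Suc N" "\<And>l. l \<in> row N p \<Longrightarrow> u l \<in> tame (pairs N)" "H \<in> tame (pairs N)"
  shows "gE (pairs N) (\<lambda>g. rdiv N p u g * H g) = (\<Sum>l\<in>row N p. gE (pairs N) (\<lambda>g. u l g * pd (edge p l) H g))"
  unfolding rdiv_def using assms row_pairs[OF assms(1)]
  by (subst gE_divergence) (auto simp: sum.reindex[OF inj_edge])

lemma edge_row_not_sites: "p = 0 \<or> p = Suc N \<Longrightarrow> l \<in> row N p \<Longrightarrow> edge p l \<notin> site_pairs N"
  by (auto simp: edge_def site_pairs_def row_def min_def max_def)

text \<open>The iterates depend on site couplings only, so the correction terms of the divergence
  vanish and, given the disorder, the copy is a linear form in the couplings of its auxiliary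
  vertex.\<close>

lemma rfield_row:
  assumes "p = 0 \<or> p = Suc N"
  shows "rfield c N m1 k p = (\<lambda>g. lin (edge p ` row N p) (\<lambda>e. \<beta> * (isqrt N * mag c N m1 (Suc k) (other p e) g)) g)"
proof
  fix g
  have "rdiv N p (mag c N m1 (Suc k)) g = (\<Sum>l\<in>row N p. g (edge p l) * mag c N m1 (Suc k) l g)"
    unfolding rdiv_sum
  proof (rule sum.cong[OF refl])
    fix l assume l: "l \<in> row N p"
    then have "pd (edge p l) (mag c N m1 (Suc k) l) = (\<lambda>g. 0)"
      by (intro pd_outside[OF mag_tame_sites edge_row_not_sites[OF assms l]]) (auto simp: row_def)
    then show "g (edge p l) * mag c N m1 (Suc k) l g - pd (edge p l) (mag c N m1 (Suc k) l) g = g (edge p l) * mag c N m1 (Suc k) l g"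
      by simp
  qed
  then show "rfield c N m1 k p g = lin (edge p ` row N p) (\<lambda>e. \<beta> * (isqrt N * mag c N m1 (Suc k) (other p e) g)) g"
    unfolding rfield_def lin_def by (simp add: sum.reindex[OF inj_edge] sum_distrib_left mult_ac)
qed

lemma rfield_tame_row:
  assumes "p = 0 \<or> p = Suc N"
  shows "rfield c N m1 k p \<in> tame (site_pairs N \<union> edge p ` row N p)"
proof -
  have "(\<lambda>g. \<Sum>e\<in>edge p ` row N p. \<beta> * (isqrt N * mag c N m1 (Suc k) (other p e) g) * g e) \<in> tame (site_pairs N \<union> edge p ` row N p)"
  proof (intro tame_sum tame_mult tame_const tame_coord)
    fix e assume "e \<in> edge p ` row N p"
    then have "other p e \<in> {1..N}" by (auto simp: row_def)
    then show "mag c N m1 (Suc k) (other p e) \<in> tame (site_pairs N \<union> edge p ` row N p)"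
      by (intro tame_mono[OF mag_tame_sites]) auto
  qed auto
  then show ?thesis unfolding rfield_row[OF assms] lin_def .
qed

text \<open>The copy has no defect: the commutator leaves a divergence of derivatives that all
  vanish.\<close>

lemma pd_rfield_row0:
  assumes "l \<in> row N 0"
  shows "pd (edge 0 l) (rfield c N m1 k 0) = (\<lambda>g. \<beta> * isqrt N * mag c N m1 (Suc k) l g)"
proof -
  have l: "l \<in> {1..N}" using assms by (simp add: row_def)
  have z: "pd (edge 0 l) (mag c N m1 (Suc k) l') = (\<lambda>g. 0)" if "l' \<in> {1..N}" for l'
    by (rule pd_outside[OF mag_tame_sites[OF that] edge_row_not_sites]) (use assms in auto)
  have r: "edge 0 ` row N 0 \<subseteq> pairs N" by (intro row_pairs) auto
  have "pd (edge 0 l) (rdiv N 0 (mag c N m1 (Suc k))) = (\<lambda>g. mag c N m1 (Suc k) l g + divergence (edge 0 ` row N 0) (\<lambda>e. pd (edge 0 l) (mag c N m1 (Suc k) (other 0 e))) g)"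
    unfolding rdiv_def using assms by (subst pd_divergence[OF _ r]) (auto intro!: mag_tame simp: row_def)
  also have "divergence (edge 0 ` row N 0) (\<lambda>e. pd (edge 0 l) (mag c N m1 (Suc k) (other 0 e))) = (\<lambda>g. 0)"
  proof
    fix g
    have "pd (edge 0 l) (mag c N m1 (Suc k) (other 0 e)) = (\<lambda>g. 0)" if "e \<in> edge 0 ` row N 0" for e
      using that by (intro z) (auto simp: row_def)
    then show "divergence (edge 0 ` row N 0) (\<lambda>e. pd (edge 0 l) (mag c N m1 (Suc k) (other 0 e))) g = 0"
      unfolding divergence_def by (intro sum.neutral ballI) simp
  qed
  finally show ?thesis unfolding rfield_def by (subst pd_cmult[OF dvm_tame]) auto
qed

text \<open>After integration by parts the main terms \<open>\<beta>\<^sup>2 / N * (\<Sum>l. m\<^sub>l m\<^sub>l)\<close> coming from the field at \<open>i\<close> and from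
  its Gaussian copy cancel; what is left are derivatives of \<open>F\<close>, defects and the remainder.\<close>

lemma key_estimate:
  assumes v: "valid N m1" and i: "i \<in> {1..N}"
    and W: "W \<in> tame (pairs N)" "W1 \<in> tame (pairs N)" "W2 \<in> tame (pairs N)" "F \<in> tame (pairs N)"
    and b: "\<And>g. \<bar>W g\<bar> \<le> 2" "\<And>g. \<bar>W1 g\<bar> \<le> 2" "\<And>g. \<bar>W2 g\<bar> \<le> 2" "\<And>g. \<bar>F g\<bar> \<le> 2"
    and pdW: "\<And>e. pd e W = (\<lambda>g. W1 g * pd e (rot t (lfield c N m1 k1 i) (rfield c N m1 k1 0)) g
        + W2 g * pd e (rot t (lfield c N m1 k2 i) (rfield c N m1 k2 0)) g)"
    and F0: "\<And>l. l \<in> row N 0 \<Longrightarrow> pd (edge 0 l) F = (\<lambda>g. 0)"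
    and F: "\<And>l. l \<in> row N i \<Longrightarrow> Lq (pairs N) CF ((isqrt N)\<^sup>2) (pd (edge i l) F)"
    and E: "Lq (pairs N) CE (isqrt N) (remainder c N m1 k i)"
    and R1: "\<And>l. l \<in> row N i \<Longrightarrow> Lq (pairs N) CR1 ((isqrt N)\<^sup>2) (defect c N m1 k1 i l)"
    and R2: "\<And>l. l \<in> row N i \<Longrightarrow> Lq (pairs N) CR2 ((isqrt N)\<^sup>2) (defect c N m1 k2 i l)"
    and Z1: "\<And>l. l \<in> row N i \<Longrightarrow> Lq (pairs N) CZ1 ((isqrt N)\<^sup>2) (pd (edge i l) (rfield c N m1 k1 0))"
    and Z2: "\<And>l. l \<in> row N i \<Longrightarrow> Lq (pairs N) CZ2 ((isqrt N)\<^sup>2) (pd (edge i l) (rfield c N m1 k2 0))"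
    and nn: "0 \<le> CF 1" "0 \<le> CR1 1" "0 \<le> CR2 1" "0 \<le> CZ1 1" "0 \<le> CZ2 1"
  shows "\<bar>gE (pairs N) (\<lambda>g. rot' t (lfield c N m1 k i) (rfield c N m1 k 0) g * (W g * F g))\<bar>
    \<le> (4 * sqrt (CE 1) + \<bar>\<beta>\<bar> * (2 * sqrt (CF 1) + 4 * sqrt (CR1 1) + 4 * sqrt (CZ1 1) + 4 * sqrt (CR2 1) + 4 * sqrt (CZ2 1))
        + 8 * \<beta>\<^sup>2) * isqrt N"
proof -
  let ?E = "gE (pairs N)"
  define s where "s = isqrt N"
  define m where "m = mag c N m1 (Suc k)"
  define H where "H = (\<lambda>g. W g * F g)"
  define A where "A = 2 * sqrt (CF 1) + 4 * sqrt (CR1 1) + 4 * sqrt (CZ1 1) + 4 * sqrt (CR2 1) + 4 * sqrt (CZ2 1)"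
  have N: "N \<ge> 1" using valid_N[OF v] .
  have s: "0 < s" "s \<le> 1" using isqrt_pos[OF N] isqrt_le[OF N] by (auto simp: s_def)
  have tH: "H \<in> tame (pairs N)" unfolding H_def by (intro tame_mult W)
  have tm: "m l \<in> tame (pairs N)" if "l \<in> {1..N}" for l unfolding m_def using that by (rule mag_tame)
  have mb: "\<bar>m l g\<bar> \<le> 1" if "l \<in> {1..N}" for l g unfolding m_def by (rule mag_abs_le[OF v that])
  have tff: "lfield c N m1 j i \<in> tame (pairs N)" for j by (rule lfield_tame[OF i])
  have tz: "rfield c N m1 j 0 \<in> tame (pairs N)" for j by (rule rfield_tame) simp
  \<comment> \<open>Vertex 0 is coupled to all sites, site i to all but itself. The additional term
    l = i has no partner and becomes \<open>Q\<close>.\<close>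
  have row0: "row N 0 = insert i (row N i)" using i by (auto simp: row_def)
  have ti: "i \<notin> row N i" by (simp add: row_def)
  have rowN: "l \<in> {1..N}" "l \<noteq> i" if "l \<in> row N i" for l using that by (auto simp: row_def)
  have r0: "l \<in> row N 0" if "l \<in> {1..N}" for l using that by (auto simp: row_def)
  define mj where "mj j l = mag c N m1 (Suc j) l" for j l
  have mjb: "\<bar>mj j l g\<bar> \<le> 1" if "l \<in> {1..N}" for j l g unfolding mj_def by (rule mag_abs_le[OF v that])
  have pr: "pd e (rot t (lfield c N m1 j i) (rfield c N m1 j 0)) = (\<lambda>g. cos t * pd e (lfield c N m1 j i) g + sin t * pd e (rfield c N m1 j 0) g)" for e j
    unfolding rot_def by (simp add: pd_add[OF tame_mult[OF tame_const tff] tame_mult[OF tame_const tz]] pd_cmult[OF tff] pd_cmult[OF tz])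
  have p0: "pd (edge 0 l) H = (\<lambda>g. F g * (W1 g * (sin t * (\<beta> * s * mj k1 l g)) + W2 g * (sin t * (\<beta> * s * mj k2 l g))))"
    if l: "l \<in> {1..N}" for l
  proof -
    have "pd (edge 0 l) (lfield c N m1 j i) = (\<lambda>g. 0)" for j
      using r0[OF l] by (intro pd_outside[OF lfield_tame_sites[OF i]] edge_row_not_sites) auto
    then show ?thesis
      unfolding H_def pd_mult[OF W(1,4)] pdW pr F0[OF r0[OF l]] pd_rfield_row0[OF r0[OF l]]
      by (simp add: s_def mj_def mult_ac)
  qed
  have pi: "pd (edge i l) H = (\<lambda>g. W g * pd (edge i l) F g
      + F g * (W1 g * (cos t * (defect c N m1 k1 i l g + \<beta> * s * mj k1 l g) + sin t * pd (edge i l) (rfield c N m1 k1 0) g)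
             + W2 g * (cos t * (defect c N m1 k2 i l g + \<beta> * s * mj k2 l g) + sin t * pd (edge i l) (rfield c N m1 k2 0) g)))" for l
    unfolding H_def pd_mult[OF W(1,4)] pdW pr defect_def s_def mj_def by (simp add: fun_eq_iff algebra_simps)
  define G where "G l = (\<lambda>g. m l g * (cos t * pd (edge 0 l) H g - sin t * pd (edge i l) H g))" for l
  have G: "\<bar>?E (G l)\<bar> \<le> A * s\<^sup>2" if l: "l \<in> row N i" for l
  proof -
    note l' = rowN[OF l]
    let ?c = "- sin t * cos t" and ?d = "- sin t * sin t"
    have tri: "\<bar>- sin t\<bar> \<le> 1" "\<bar>?c\<bar> \<le> 1" "\<bar>?d\<bar> \<le> 1"
      using abs_mult_le[of "- sin t" 1 "cos t" 1] abs_mult_le[of "- sin t" 1 "sin t" 1] by auto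
    define P0 P1 P2 P3 P4 where "P0 = (\<lambda>g. (- sin t * m l g * W g) * pd (edge i l) F g)"
      and "P1 = (\<lambda>g. (?c * m l g * F g * W1 g) * defect c N m1 k1 i l g)"
      and "P2 = (\<lambda>g. (?d * m l g * F g * W1 g) * pd (edge i l) (rfield c N m1 k1 0) g)"
      and "P3 = (\<lambda>g. (?c * m l g * F g * W2 g) * defect c N m1 k2 i l g)"
      and "P4 = (\<lambda>g. (?d * m l g * F g * W2 g) * pd (edge i l) (rfield c N m1 k2 0) g)"
    note tR1 = Lq_tame[OF R1[OF l]] and tR2 = Lq_tame[OF R2[OF l]]
    have tP: "P0 \<in> tame (pairs N)" "P1 \<in> tame (pairs N)" "P2 \<in> tame (pairs N)" "P3 \<in> tame (pairs N)" "P4 \<in> tame (pairs N)"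
      unfolding P0_def P1_def P2_def P3_def P4_def
      by (intro tame_mult tame_const tm l' W tR1 tR2 tame_pd tz)+
    \<comment> \<open>The terms with \<open>\<beta> * s * mj\<close> come with sin t cos t from both
      derivatives, in opposite signs, and cancel here. What is left contains a derivative of
      \<open>F\<close>, a defect, or a derivative of the copy in a site coupling.\<close>
    have "G l = (\<lambda>g. P0 g + P1 g + P2 g + P3 g + P4 g)"
      unfolding G_def p0[OF l'(1)] pi P0_def P1_def P2_def P3_def P4_def
      by (simp add: fun_eq_iff algebra_simps)
    then have "?E (G l) = ?E P0 + ?E P1 + ?E P2 + ?E P3 + ?E P4"
      using tP by (simp add: gE_add tame_add)
    moreover have "\<bar>?E P0\<bar> \<le> 2 * (sqrt (CF 1) * s\<^sup>2)"
      unfolding P0_def s_def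
      using abs_mult_le[OF abs_mult_le[OF tri(1) mb[OF l'(1)]] b(1)] by (intro Lq_gE[OF F[OF l]] tame_mult tame_const tm l' W) simp
    moreover have "\<bar>?E P1\<bar> \<le> 4 * (sqrt (CR1 1) * s\<^sup>2)"
      unfolding P1_def s_def
      using abs_mult_le[OF abs_mult_le[OF abs_mult_le[OF tri(2) mb[OF l'(1)]] b(4)] b(2)] by (intro Lq_gE[OF R1[OF l]] tame_mult tame_const tm l' W) simp
    moreover have "\<bar>?E P2\<bar> \<le> 4 * (sqrt (CZ1 1) * s\<^sup>2)"
      unfolding P2_def s_def
      using abs_mult_le[OF abs_mult_le[OF abs_mult_le[OF tri(3) mb[OF l'(1)]] b(4)] b(2)] by (intro Lq_gE[OF Z1[OF l]] tame_mult tame_const tm l' W) simp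
    moreover have "\<bar>?E P3\<bar> \<le> 4 * (sqrt (CR2 1) * s\<^sup>2)"
      unfolding P3_def s_def
      using abs_mult_le[OF abs_mult_le[OF abs_mult_le[OF tri(2) mb[OF l'(1)]] b(4)] b(3)] by (intro Lq_gE[OF R2[OF l]] tame_mult tame_const tm l' W) simp
    moreover have "\<bar>?E P4\<bar> \<le> 4 * (sqrt (CZ2 1) * s\<^sup>2)"
      unfolding P4_def s_def
      using abs_mult_le[OF abs_mult_le[OF abs_mult_le[OF tri(3) mb[OF l'(1)]] b(4)] b(3)] by (intro Lq_gE[OF Z2[OF l]] tame_mult tame_const tm l' W) simp
    ultimately have "\<bar>?E (G l)\<bar> \<le> 2 * (sqrt (CF 1) * s\<^sup>2) + 4 * (sqrt (CR1 1) * s\<^sup>2) + 4 * (sqrt (CZ1 1) * s\<^sup>2)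
        + 4 * (sqrt (CR2 1) * s\<^sup>2) + 4 * (sqrt (CZ2 1) * s\<^sup>2)" by linarith
    also have "\<dots> = A * s\<^sup>2" by (simp only: A_def distrib_right mult.assoc)
    finally show ?thesis .
  qed
  have A0: "0 \<le> A" unfolding A_def using nn by (intro add_nonneg_nonneg) auto
  have sumG: "\<bar>\<Sum>l\<in>row N i. ?E (G l)\<bar> \<le> A"
  proof -
    have "\<bar>\<Sum>l\<in>row N i. ?E (G l)\<bar> \<le> (\<Sum>l\<in>row N i. A * s\<^sup>2)"
      using G by (intro order_trans[OF sum_abs] sum_mono)
    also have "\<dots> = A * (real (card (row N i)) * s\<^sup>2)" by simp
    also have "\<dots> \<le> A * (real N * s\<^sup>2)"
      using A0 card_row[of N i] by (intro mult_left_mono mult_right_mono) auto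
    finally show ?thesis using isqrt_sq[OF N] by (simp add: s_def)
  qed
  define Q where "Q = (\<lambda>g. m i g * (cos t * pd (edge 0 i) H g))"
  have tQ: "Q \<in> tame (pairs N)" unfolding Q_def by (intro tame_mult tame_const tm i tame_pd tH)
  \<comment> \<open>A bound of order 1 suffices because the prefactor beta s supplies the rate. The
    8 is 2 for \<open>F\<close> times 2 + 2 for \<open>W1\<close> and \<open>W2\<close>.\<close>
  have Q: "\<bar>?E Q\<bar> \<le> 8 * \<bar>\<beta>\<bar>"
  proof -
    have bs: "\<bar>\<beta> * s * mj j i g\<bar> \<le> \<bar>\<beta>\<bar>" for j g
      using abs_mult_le[OF abs_mult_le[of \<beta> "\<bar>\<beta>\<bar>" s 1] mjb[OF i]] s by simp
    have w: "\<bar>W1 g * (sin t * (\<beta> * s * mj k1 i g)) + W2 g * (sin t * (\<beta> * s * mj k2 i g))\<bar> \<le> 4 * \<bar>\<beta>\<bar>" for g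
      using abs_mult_le[OF b(2) abs_mult_le[OF abs_sin_le_one bs], of g t k1 g]
        abs_mult_le[OF b(3) abs_mult_le[OF abs_sin_le_one bs], of g t k2 g] by linarith
    have "\<bar>Q g\<bar> \<le> 8 * \<bar>\<beta>\<bar>" for g
      unfolding Q_def p0[OF i]
      using abs_mult_le[OF mb[OF i] abs_mult_le[OF abs_cos_le_one abs_mult_le[OF b(4) w]], of g t g g] by simp
    then have "?E Q \<le> ?E (\<lambda>g. 8 * \<bar>\<beta>\<bar>)" "?E (\<lambda>g. - (8 * \<bar>\<beta>\<bar>)) \<le> ?E Q"
      by (intro gE_mono tQ tame_const; auto simp: abs_le_iff minus_le_iff)+
    then show ?thesis by simp
  qed
  have EE: "\<bar>?E (\<lambda>g. H g * remainder c N m1 k i g)\<bar> \<le> 4 * (sqrt (CE 1) * s)"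
    unfolding s_def
  proof (rule Lq_gE[OF E tH])
    show "\<bar>H g\<bar> \<le> 4" for g unfolding H_def using abs_mult_le[OF b(1,4)] by simp
  qed
  have t1: "(\<lambda>g. rdiv N p m g * H g) \<in> tame (pairs N)" if "p \<le> Suc N" for p
    unfolding m_def using that by (intro tame_mult dvm_tame tH)
  have t2: "(\<lambda>g. H g * remainder c N m1 k i g) \<in> tame (pairs N)" by (intro tame_mult tH remainder_tame[OF i])
  have T0: "(\<lambda>g. rdiv N 0 m g * H g) \<in> tame (pairs N)" by (rule t1) simp
  have T1: "(\<lambda>g. rdiv N i m g * H g) \<in> tame (pairs N)" using i by (intro t1) auto
  have "?E (\<lambda>g. rot' t (lfield c N m1 k i) (rfield c N m1 k 0) g * (W g * F g))
     = ?E (\<lambda>g. (\<beta> * s * cos t) * (rdiv N 0 m g * H g) + ((- \<beta> * s * sin t) * (rdiv N i m g * H g) + (- sin t) * (H g * remainder c N m1 k i g)))"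
    unfolding rot'_def lfield_eq rfield_def s_def m_def H_def by (simp add: algebra_simps)
  also have "\<dots> = (\<beta> * s * cos t) * ?E (\<lambda>g. rdiv N 0 m g * H g) + ((- \<beta> * s * sin t) * ?E (\<lambda>g. rdiv N i m g * H g)
        + (- sin t) * ?E (\<lambda>g. H g * remainder c N m1 k i g))"
    unfolding gE_add[OF tame_mult[OF tame_const T0] tame_add[OF tame_mult[OF tame_const T1] tame_mult[OF tame_const t2]]]
      gE_add[OF tame_mult[OF tame_const T1] tame_mult[OF tame_const t2]] gE_cmult ..
  also have "\<dots> = \<beta> * s * ((\<Sum>l\<in>row N i. ?E (G l)) + ?E Q) - sin t * ?E (\<lambda>g. H g * remainder c N m1 k i g)"
  proof -
    have d0: "?E (\<lambda>g. rdiv N 0 m g * H g) = ?E (\<lambda>g. m i g * pd (edge 0 i) H g) + (\<Sum>l\<in>row N i. ?E (\<lambda>g. m l g * pd (edge 0 l) H g))"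
    proof -
      have "?E (\<lambda>g. rdiv N 0 m g * H g) = (\<Sum>l\<in>row N 0. ?E (\<lambda>g. m l g * pd (edge 0 l) H g))"
        by (rule gE_rdiv[OF _ _ tH]) (auto simp: row_def intro: tm)
      then show ?thesis unfolding row0 using ti by simp
    qed
    have di: "?E (\<lambda>g. rdiv N i m g * H g) = (\<Sum>l\<in>row N i. ?E (\<lambda>g. m l g * pd (edge i l) H g))"
      using i by (intro gE_rdiv[OF _ _ tH]) (auto simp: row_def intro: tm)
    have g: "?E (G l) = cos t * ?E (\<lambda>g. m l g * pd (edge 0 l) H g) - sin t * ?E (\<lambda>g. m l g * pd (edge i l) H g)" if "l \<in> row N i" for l
    proof -
      have a: "(\<lambda>g. m l g * pd e H g) \<in> tame (pairs N)" for e by (intro tame_mult tm rowN that tame_pd tH)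
      have "G l = (\<lambda>g. cos t * (m l g * pd (edge 0 l) H g) - sin t * (m l g * pd (edge i l) H g))"
        unfolding G_def by (simp add: algebra_simps)
      then show ?thesis by (simp only: gE_diff[OF tame_mult[OF tame_const a] tame_mult[OF tame_const a]] gE_cmult)
    qed
    have q: "?E Q = cos t * ?E (\<lambda>g. m i g * pd (edge 0 i) H g)"
    proof -
      have "Q = (\<lambda>g. cos t * (m i g * pd (edge 0 i) H g))" unfolding Q_def by (simp add: algebra_simps)
      then show ?thesis by (simp only: gE_cmult)
    qed
    have sum: "(\<Sum>l\<in>row N i. ?E (G l)) = cos t * (\<Sum>l\<in>row N i. ?E (\<lambda>g. m l g * pd (edge 0 l) H g)) - sin t * (\<Sum>l\<in>row N i. ?E (\<lambda>g. m l g * pd (edge i l) H g))"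
      unfolding sum_distrib_left sum_subtractf[symmetric] by (intro sum.cong refl g)
    have alg: "x * ct * (q0 + S0) + ((- \<beta> * s * st) * Si + (- st) * y) = x * ((ct * S0 - st * Si) + ct * q0) - st * y"
      if "x = \<beta> * s" for x ct st q0 S0 Si y :: real
      unfolding that by (simp add: algebra_simps)
    show ?thesis unfolding d0 di q sum by (rule alg) simp
  qed
  also have "\<bar>\<dots>\<bar> \<le> \<bar>\<beta>\<bar> * s * (A + 8 * \<bar>\<beta>\<bar>) + 4 * (sqrt (CE 1) * s)"
  proof -
    have "\<bar>\<beta> * s * ((\<Sum>l\<in>row N i. ?E (G l)) + ?E Q)\<bar> \<le> (\<bar>\<beta>\<bar> * s) * (A + 8 * \<bar>\<beta>\<bar>)"
      using sumG Q s by (intro abs_mult_le) (auto simp: abs_mult)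
    moreover have "\<bar>sin t * ?E (\<lambda>g. H g * remainder c N m1 k i g)\<bar> \<le> 1 * (4 * (sqrt (CE 1) * s))"
      using EE by (intro abs_mult_le) auto
    ultimately show ?thesis by linarith
  qed
  also have "\<dots> = (4 * sqrt (CE 1) + \<bar>\<beta>\<bar> * A + 8 * \<beta>\<^sup>2) * s"
    by (simp add: algebra_simps power2_eq_square flip: abs_mult)
  finally show ?thesis unfolding A_def s_def .
qed

end

section \<open>Averages over the sites\<close>

context amp begin

definition cu :: "(nat \<Rightarrow> real) \<Rightarrow> (nat \<Rightarrow> real) \<Rightarrow> nat \<Rightarrow> real" where
  "cu C D q = (cm (\<lambda>_. 1) C q + cm (\<lambda>_. 1) D q) * 4 ^ (2 * q) * 2 ^ (2 * q)"

lemma cu_nonneg: "(\<And>q. 0 \<le> C q) \<Longrightarrow> (\<And>q. 0 \<le> D q) \<Longrightarrow> 0 \<le> cu C D q"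
  unfolding cu_def by (intro mult_nonneg_nonneg add_nonneg_nonneg cm_nonneg) auto

lemma Lq_pd_u0:
  assumes "X \<in> tame I" "Y \<in> tame I" "0 \<le> w" "w \<le> 1" "Lq I C x (pd e X)" "Lq I D x (pd e Y)"
  shows "Lq I (cu C D) x (pd e (\<lambda>g. u0 w (X g) (Y g)))"
proof -
  have 1: "Lq I (cm (\<lambda>_. 1) C) (2 * x) (\<lambda>g. u1 w (X g) (Y g) * pd e X g)"
    by (intro Lq_mult Lq_bounded u_tame u_abs assms) auto
  have 2: "Lq I (cm (\<lambda>_. 1) D) (2 * x) (\<lambda>g. u2 w (X g) (Y g) * pd e Y g)"
    by (intro Lq_mult Lq_bounded u_tame u_abs assms) auto
  have "(0::real) < 2" by simp
  from Lq_rescale[OF Lq_add2[OF 1 2] this] show ?thesis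
    unfolding cu_def[abs_def] pd_u(1)[OF assms(1,2)] .
qed

definition avg :: "nat \<Rightarrow> (nat \<Rightarrow> real) \<Rightarrow> real" where "avg N a = (1 / real N) * (\<Sum>i=1..N. a i)"

lemma avg_abs_le:
  assumes "N \<ge> 1" "\<And>i. i \<in> {1..N} \<Longrightarrow> \<bar>a i\<bar> \<le> b"
  shows "\<bar>avg N a\<bar> \<le> b"
proof -
  have "\<bar>\<Sum>i=1..N. a i\<bar> \<le> (\<Sum>i=1..N. b)"
    using assms(2) by (intro order_trans[OF sum_abs] sum_mono)
  then have "\<bar>\<Sum>i=1..N. a i\<bar> \<le> real N * b" by simp
  then show ?thesis unfolding avg_def using assms(1) by (simp add: abs_mult field_simps)
qed

text \<open>The weights \<open>a\<close> and the switch \<open>w\<close> treat both claims at once: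
  a = 1 and w = 1 give the overlap of two new iterates, a = m1 and w = 0 that of a new iterate with
  the start.\<close>

definition site_avg :: "onsager_choice \<Rightarrow> nat \<Rightarrow> (nat \<Rightarrow> real) \<Rightarrow> (nat \<Rightarrow> real) \<Rightarrow> real \<Rightarrow> nat \<Rightarrow> nat \<Rightarrow> disorder \<Rightarrow> real" where
  "site_avg c N m1 a w k1 k2 = (\<lambda>g. avg N (\<lambda>i. a i * u0 w (lfield c N m1 k1 i g) (lfield c N m1 k2 i g)))"

text \<open>The same copy stands in for every site, so the weights factor out as
  \<open>avg N a\<close>.\<close>

definition replica_avg :: "onsager_choice \<Rightarrow> nat \<Rightarrow> (nat \<Rightarrow> real) \<Rightarrow> (nat \<Rightarrow> real) \<Rightarrow> real \<Rightarrow> nat \<Rightarrow> nat \<Rightarrow> nat \<Rightarrow> disorder \<Rightarrow> real" where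
  "replica_avg c N m1 a w k1 k2 p = (\<lambda>g. avg N a * u0 w (rfield c N m1 k1 p g) (rfield c N m1 k2 p g))"

lemma site_avg_tame_sites: "site_avg c N m1 a w k1 k2 \<in> tame (site_pairs N)"
  unfolding site_avg_def avg_def by (intro tame_mult tame_const tame_sum u_tame lfield_tame_sites) auto

lemma site_avg_tame: "site_avg c N m1 a w k1 k2 \<in> tame (pairs N)"
  by (rule tame_mono[OF site_avg_tame_sites site_pairs_pairs])

lemma replica_avg_tame: "p \<le> Suc N \<Longrightarrow> replica_avg c N m1 a w k1 k2 p \<in> tame (pairs N)"
  unfolding replica_avg_def by (intro tame_mult tame_const u_tame rfield_tame)

lemma replica_avg_tame_row: "p = 0 \<or> p = Suc N \<Longrightarrow> replica_avg c N m1 a w k1 k2 p \<in> tame (site_pairs N \<union> edge p ` row N p)"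
  unfolding replica_avg_def by (intro tame_mult tame_const u_tame rfield_tame_row)

lemma site_avg_abs:
  assumes "N \<ge> 1" "\<And>i. i \<in> {1..N} \<Longrightarrow> \<bar>a i\<bar> \<le> 1" "0 \<le> w" "w \<le> 1"
  shows "\<bar>site_avg c N m1 a w k1 k2 g\<bar> \<le> 1"
  unfolding site_avg_def
proof (rule avg_abs_le[OF assms(1)])
  fix i assume "i \<in> {1..N}"
  then show "\<bar>a i * u0 w (lfield c N m1 k1 i g) (lfield c N m1 k2 i g)\<bar> \<le> 1"
    using abs_mult_le[OF assms(2) u_abs(1)[OF assms(3,4)]] by simp
qed

lemma replica_avg_abs:
  assumes "N \<ge> 1" "\<And>i. i \<in> {1..N} \<Longrightarrow> \<bar>a i\<bar> \<le> 1" "0 \<le> w" "w \<le> 1"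
  shows "\<bar>replica_avg c N m1 a w k1 k2 p g\<bar> \<le> 1"
  unfolding replica_avg_def using abs_mult_le[OF avg_abs_le[OF assms(1,2)] u_abs(1)[OF assms(3,4)]] by simp

lemma row_disjoint:
  "site_pairs N \<inter> edge 0 ` row N 0 = {}" "site_pairs N \<inter> edge (Suc N) ` row N (Suc N) = {}"
  "edge 0 ` row N 0 \<inter> edge (Suc N) ` row N (Suc N) = {}"
  by (auto simp: site_pairs_def edge_def row_def min_def max_def)

text \<open>With s = 1 / sqrt N, a derivative in g_il is of order s at the two sites i and l and of
  order s^2 at the others, so the sum over the sites is bounded and the weight 1 / N gives s^2. The
  copy is untouched by site couplings and has order s^2 directly.\<close>

lemma replica_pd_bound:
  assumes v: "valid N m1" and a: "\<And>i. i \<in> {1..N} \<Longrightarrow> \<bar>a i\<bar> \<le> 1" and w: "0 \<le> w" "w \<le> 1"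
    and i: "i \<in> {1..N}" and l: "l \<in> row N i"
    and nn: "\<And>q. 0 \<le> D1 q" "\<And>q. 0 \<le> D2 q"
    and D1: "\<And>p. p \<in> {1..N} \<Longrightarrow> Lq (pairs N) D1 (isqrt N ^ decay p [edge i l]) (pd (edge i l) (lfield c N m1 k1 p))"
    and D2: "\<And>p. p \<in> {1..N} \<Longrightarrow> Lq (pairs N) D2 (isqrt N ^ decay p [edge i l]) (pd (edge i l) (lfield c N m1 k2 p))"
    and E1: "Lq (pairs N) E1 ((isqrt N)\<^sup>2) (pd (edge i l) (rfield c N m1 k1 (Suc N)))"
    and E2: "Lq (pairs N) E2 ((isqrt N)\<^sup>2) (pd (edge i l) (rfield c N m1 k2 (Suc N)))"
  shows "Lq (pairs N) (\<lambda>q. (cu D1 D2 q + cu E1 E2 q) * 4 ^ (2 * q) * 8 ^ (2 * q)) ((isqrt N)\<^sup>2)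
    (pd (edge i l) (\<lambda>g. site_avg c N m1 a w k1 k2 g - replica_avg c N m1 a w k1 k2 (Suc N) g))"
proof -
  define s where "s = isqrt N"
  define e where "e = edge i l"
  have N: "N \<ge> 1" using valid_N[OF v] .
  have s: "0 < s" "s \<le> 1" using isqrt_pos[OF N] isqrt_le[OF N] by (auto simp: s_def)
  have Ns: "real N * s\<^sup>2 = 1" using isqrt_sq[OF N] by (simp add: s_def)
  have l': "l \<in> {1..N}" "l \<noteq> i" using l by (auto simp: row_def)
  have Vte: "ends [e] = {i, l}" by (auto simp: ends_def e_def edge_def min_def max_def)
  define U where "U p = (\<lambda>g. u0 w (lfield c N m1 k1 p g) (lfield c N m1 k2 p g))" for p
  have tU: "U p \<in> tame (pairs N)" if "p \<in> {1..N}" for p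
    unfolding U_def using that by (intro u_tame lfield_tame)
  have cn: "0 \<le> cu D1 D2 q" for q by (rule cu_nonneg[OF nn])
  have U: "Lq (pairs N) (cu D1 D2) (s ^ decay p [e]) (\<lambda>g. a p * pd e (U p) g)" if p: "p \<in> {1..N}" for p
  proof -
    have "Lq (pairs N) (cu D1 D2) (s ^ decay p [e]) (pd e (U p))"
      unfolding U_def s_def e_def using p by (intro Lq_pd_u0 lfield_tame w D1 D2)
    from Lq_cmult[OF this a[OF p]] show ?thesis by simp
  qed
  have pdA: "pd e (site_avg c N m1 a w k1 k2) = (\<lambda>g. (1 / real N) * (\<Sum>p=1..N. a p * pd e (U p) g))"
  proof -
    have t: "(\<lambda>g. a p * U p g) \<in> tame (pairs N)" if "p \<in> {1..N}" for p using tU that by (intro tame_mult tame_const)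
    have "pd e (site_avg c N m1 a w k1 k2) = pd e (\<lambda>g. (1 / real N) * (\<Sum>p=1..N. a p * U p g))"
      unfolding site_avg_def avg_def U_def ..
    also have "\<dots> = (\<lambda>g. (1 / real N) * (\<Sum>p=1..N. pd e (\<lambda>g. a p * U p g) g))"
      using t by (subst pd_cmult[OF tame_sum], force, subst pd_sum[of _ _ "pairs N"], force) (rule refl)
    also have "\<dots> = (\<lambda>g. (1 / real N) * (\<Sum>p=1..N. a p * pd e (U p) g))"
      using tU by (intro ext arg_cong2[where f = "(*)"] refl sum.cong) (simp add: pd_cmult[OF tU])
    finally show ?thesis .
  qed
  define V where "V = {1..N} \<inter> {i, l}"
  have cV: "real (card V) \<le> 2"
    using card_mono[of "{i, l}" V] l' by (simp add: V_def card_insert_if)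
  have n2: "(0::real) < 2" by simp
  have 1: "Lq (pairs N) (cu D1 D2) (2 * s) (\<lambda>g. \<Sum>p\<in>V. a p * pd e (U p) g)"
  proof (rule Lq_sum[OF _ cV n2])
    fix p assume "p \<in> V"
    then have "decay p [e] = 1" "p \<in> {1..N}" by (auto simp: decay_def Vte V_def)
    then show "Lq (pairs N) (cu D1 D2) s (\<lambda>g. a p * pd e (U p) g)" using U[of p] by simp
  qed (use s cn in \<open>auto simp: V_def\<close>)
  have cW: "real (card ({1..N} - {i, l})) \<le> real N"
    using card_mono[of "{1..N}" "{1..N} - {i, l}"] by simp
  have 2: "Lq (pairs N) (cu D1 D2) (real N * s\<^sup>2) (\<lambda>g. \<Sum>p\<in>{1..N} - {i, l}. a p * pd e (U p) g)"
  proof (rule Lq_sum[OF _ cW])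
    fix p assume "p \<in> {1..N} - {i, l}"
    then have "decay p [e] = 2" "p \<in> {1..N}" by (auto simp: decay_def Vte)
    then show "Lq (pairs N) (cu D1 D2) (s\<^sup>2) (\<lambda>g. a p * pd e (U p) g)" using U[of p] by simp
  qed (use s cn N in auto)
  have b1: "Lq (pairs N) (cu D1 D2) 2 (\<lambda>g. \<Sum>p\<in>V. a p * pd e (U p) g)"
    by (rule Lq_mono[OF 1]) (use s in auto)
  have b2: "Lq (pairs N) (cu D1 D2) 2 (\<lambda>g. \<Sum>p\<in>{1..N} - {i, l}. a p * pd e (U p) g)"
    by (rule Lq_mono[OF 2]) (use Ns in auto)
  have "(\<lambda>g. \<Sum>p=1..N. a p * pd e (U p) g) = (\<lambda>g. (\<Sum>p\<in>V. a p * pd e (U p) g) + (\<Sum>p\<in>{1..N} - {i, l}. a p * pd e (U p) g))"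
    unfolding V_def by (intro ext sum.Int_Diff) simp
  \<comment> \<open>Both sums are bounded at scale 2, which \<open>Lq_add\<close> multiplies by
    4.\<close>
  with Lq_add[OF b1 b2] have 3: "Lq (pairs N) (cu D1 D2) 8 (\<lambda>g. \<Sum>p=1..N. a p * pd e (U p) g)" by simp
  have "\<bar>1 / real N\<bar> \<le> s\<^sup>2" using N by (simp add: s_def isqrt_def power_divide)
  from Lq_cmult[OF 3 this] have A: "Lq (pairs N) (cu D1 D2) (8 * s\<^sup>2) (pd e (site_avg c N m1 a w k1 k2))"
    unfolding pdA using s by (simp add: mult.commute)
  have tz: "(\<lambda>g. u0 w (rfield c N m1 k1 (Suc N) g) (rfield c N m1 k2 (Suc N) g)) \<in> tame (pairs N)"
    by (intro u_tame rfield_tame) auto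
  have Z: "Lq (pairs N) (cu E1 E2) (s\<^sup>2) (pd e (\<lambda>g. u0 w (rfield c N m1 k1 (Suc N) g) (rfield c N m1 k2 (Suc N) g)))"
    unfolding s_def e_def by (intro Lq_pd_u0 rfield_tame w E1 E2) auto
  have "\<bar>avg N a\<bar> \<le> 1" by (rule avg_abs_le[OF N a])
  then have "Lq (pairs N) (cu E1 E2) (8 * s\<^sup>2) (\<lambda>g. avg N a * pd e (\<lambda>g. u0 w (rfield c N m1 k1 (Suc N) g) (rfield c N m1 k2 (Suc N) g)) g)"
    by (intro Lq_cmult[OF Z]) auto
  then have B: "Lq (pairs N) (cu E1 E2) (8 * s\<^sup>2) (pd e (replica_avg c N m1 a w k1 k2 (Suc N)))" 
    unfolding replica_avg_def pd_cmult[OF tz] .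
  have "(0::real) < 8" by simp
  from Lq_rescale[OF Lq_diff2[OF A B] this]
  show ?thesis
    unfolding e_def[symmetric] s_def[symmetric] pd_diff[OF site_avg_tame replica_avg_tame[OF order_refl]] .
qed

text \<open>By linearity the first factor splits over the sites, with \<open>u0\<close> at each site
  compared to \<open>u0\<close> at the same copy. The second factor is the test function of
  \<open>key_estimate\<close>: its derivatives along the row of 0 vanish, and along the row of i
  they are of order 1 / N.\<close>

lemma replica_bound:
  "\<exists>K\<ge>0. \<forall>c N m1 a w. valid N m1 \<longrightarrow> (\<forall>i\<in>{1..N}. \<bar>a i\<bar> \<le> 1) \<longrightarrow> 0 \<le> w \<longrightarrow> w \<le> 1 \<longrightarrow>
    \<bar>gE (pairs N) (\<lambda>g. (site_avg c N m1 a w k1 k2 g - replica_avg c N m1 a w k1 k2 0 g) * (site_avg c N m1 a w k1 k2 g - replica_avg c N m1 a w k1 k2 (Suc N) g))\<bar>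
      \<le> K * isqrt N"
proof -
  \<comment> \<open>All bounds for one index are collected in one predicate, whose constants are
    then obtained separately for \<open>k1\<close> and \<open>k2\<close>.\<close>
  define site_bounds where "site_bounds CE DF DZ DR k c N m1 i l \<longleftrightarrow> Lq (pairs N) CE (isqrt N) (remainder c N m1 k i) \<and>
       (l \<in> row N i \<longrightarrow> (\<forall>p\<in>{1..N}. Lq (pairs N) DF (isqrt N ^ decay p [edge i l]) (pd (edge i l) (lfield c N m1 k p))) \<and>
          (\<forall>p\<in>{0, Suc N}. Lq (pairs N) DZ ((isqrt N)\<^sup>2) (pd (edge i l) (rfield c N m1 k p))) \<and>
          Lq (pairs N) DR ((isqrt N)\<^sup>2) (defect c N m1 k i l))" for CE DF DZ DR k c N m1 i l
  have P: "\<exists>CE DF DZ DR. (\<forall>q. 0 \<le> CE q \<and> 0 \<le> DF q \<and> 0 \<le> DZ q \<and> 0 \<le> DR q) \<and>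
    (\<forall>c N m1 i l. valid N m1 \<longrightarrow> i \<in> {1..N} \<longrightarrow> site_bounds CE DF DZ DR k c N m1 i l)" for k
  proof -
    obtain C C2 where M: "mag_bounds (Suc k) C" and E: "remainder_bounds k C2" using mag_bounds_remainder_bounds by blast
    obtain DF where F_raw: "\<forall>r q. 0 \<le> DF r q" "\<forall>c N m1 p. valid N m1 \<longrightarrow> p \<in> {1..N} \<longrightarrow> decay_bounds N DF p (lfield c N m1 k p)"
      using lfield_bound[OF M E] by (elim exE conjE) (rule that)
    obtain DZ where Z_raw: "\<forall>r q. 0 \<le> DZ r q" "\<forall>c N m1 p. valid N m1 \<longrightarrow> p \<le> Suc N \<longrightarrow> decay_bounds N DZ p (rfield c N m1 k p)"
      using rfield_bound[OF M] by (elim exE conjE) (rule that)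
    obtain DR where R_raw: "\<forall>r q. 0 \<le> DR r q" "\<forall>c N m1 B i l. valid N m1 \<longrightarrow> set B \<subseteq> site_pairs N \<longrightarrow> i \<in> {1..N} \<longrightarrow> l \<in> {1..N} \<longrightarrow> i \<noteq> l \<longrightarrow>
     Lq (pairs N) (DR (length B)) (if i \<in> ends B then isqrt N ^ (length B + 1) else isqrt N ^ (length B + 2)) (pds B (defect c N m1 k i l))"
      using defect_bound[OF M E] by (elim exE conjE) (rule that)
    show ?thesis
    proof (rule exI[of _ "C2 0"], rule exI[of _ "DF 1"], rule exI[of _ "DZ 1"], rule exI[of _ "DR 0"], unfold site_bounds_def, intro conjI allI impI ballI)
      show "0 \<le> C2 0 q" for q using E by (simp add: remainder_bounds_def)
      show "0 \<le> DF 1 q" for q by (rule F_raw(1)[rule_format])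
      show "0 \<le> DZ 1 q" for q by (rule Z_raw(1)[rule_format])
      show "0 \<le> DR 0 q" for q by (rule R_raw(1)[rule_format])
      fix c N m1 i l assume v: "valid N m1" and i: "i \<in> {1..N}"
      show "Lq (pairs N) (C2 0) (isqrt N) (remainder c N m1 k i)" using remainder_boundsD[OF E v, of "[]" i c] i by simp
      assume l: "l \<in> row N i"
      have l': "l \<in> {1..N}" "i \<noteq> l" using l by (auto simp: row_def)
      have e: "edge i l \<in> site_pairs N" by (rule edge_sites[OF i l])
      show "Lq (pairs N) (DR 0) ((isqrt N)\<^sup>2) (defect c N m1 k i l)"
        using R_raw(2)[rule_format, OF v _ i l', of "[]" c] by (simp add: ends_def power2_eq_square)
      show "Lq (pairs N) (DF 1) (isqrt N ^ decay p [edge i l]) (pd (edge i l) (lfield c N m1 k p))" if "p \<in> {1..N}" for p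
        using decay_boundsD[OF F_raw(2)[rule_format, OF v that], of "[edge i l]" c] e by simp
      show "Lq (pairs N) (DZ 1) ((isqrt N)\<^sup>2) (pd (edge i l) (rfield c N m1 k p))" if p: "p \<in> {0, Suc N}" for p
      proof -
        have "p \<notin> ends [edge i l]" using i l' p by (auto simp: ends_def edge_def min_def max_def)
        then have "decay p [edge i l] = 2" by (simp add: decay_def)
        then show ?thesis using decay_boundsD[OF Z_raw(2)[rule_format, OF v, of p c], of "[edge i l]"] e p by auto
      qed
    qed
  qed
  obtain CE1 DF1 DZ1 DR1 where n1_raw: "\<forall>q. 0 \<le> CE1 q \<and> 0 \<le> DF1 q \<and> 0 \<le> DZ1 q \<and> 0 \<le> DR1 q" and
    b1_raw: "\<forall>c N m1 i l. valid N m1 \<longrightarrow> i \<in> {1..N} \<longrightarrow> site_bounds CE1 DF1 DZ1 DR1 k1 c N m1 i l"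
    using P[of k1] by (elim exE conjE) (rule that)
  note n1 = n1_raw[rule_format] and b1 = b1_raw[rule_format, unfolded site_bounds_def]
  obtain CE2 DF2 DZ2 DR2 where n2_raw: "\<forall>q. 0 \<le> CE2 q \<and> 0 \<le> DF2 q \<and> 0 \<le> DZ2 q \<and> 0 \<le> DR2 q" and
    b2_raw: "\<forall>c N m1 i l. valid N m1 \<longrightarrow> i \<in> {1..N} \<longrightarrow> site_bounds CE2 DF2 DZ2 DR2 k2 c N m1 i l"
    using P[of k2] by (elim exE conjE) (rule that)
  note n2 = n2_raw[rule_format] and b2 = b2_raw[rule_format, unfolded site_bounds_def]
  define CF where "CF q = (cu DF1 DF2 q + cu DZ1 DZ2 q) * 4 ^ (2 * q) * 8 ^ (2 * q)" for q
  have CFn: "0 \<le> CF q" for q unfolding CF_def using n1 n2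
    by (intro mult_nonneg_nonneg add_nonneg_nonneg cu_nonneg) auto
  define X where "X CE = 4 * sqrt (CE 1) + \<bar>\<beta>\<bar> * (2 * sqrt (CF 1) + 4 * sqrt (DR1 1) + 4 * sqrt (DZ1 1) + 4 * sqrt (DR2 1) + 4 * sqrt (DZ2 1))
        + 8 * \<beta>\<^sup>2" for CE :: "nat \<Rightarrow> real"
  define K where "K = 2 * (X CE1 + X CE2)"
  have Xn: "0 \<le> X CE" if "\<And>q. 0 \<le> CE q" for CE
    unfolding X_def using that[of 1] n1[of 1] n2[of 1] CFn[of 1]
    by (intro add_nonneg_nonneg mult_nonneg_nonneg) auto
  show ?thesis
  proof (intro exI[of _ K] conjI allI impI)
    show "0 \<le> K" unfolding K_def using Xn[of CE1] Xn[of CE2] n1 n2 by simp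
    fix c :: onsager_choice and N :: nat and m1 a :: "nat \<Rightarrow> real" and w :: real
    assume v: "valid N m1" and "\<forall>i\<in>{1..N}. \<bar>a i\<bar> \<le> 1" and w: "0 \<le> w" "w \<le> (1::real)"
    then have a: "\<And>i. i \<in> {1..N} \<Longrightarrow> \<bar>a i\<bar> \<le> 1" by blast
    have N: "N \<ge> 1" using valid_N[OF v] .
    let ?A = "site_avg c N m1 a w k1 k2" and ?B = "replica_avg c N m1 a w k1 k2"
    define F where "F = (\<lambda>g. ?A g - ?B (Suc N) g)"
    have tF: "F \<in> tame (pairs N)" unfolding F_def by (intro tame_diff site_avg_tame replica_avg_tame) auto
    have Fb: "\<bar>F g\<bar> \<le> 2" for g
    proof -
      have "\<bar>?A g\<bar> \<le> 1" by (rule site_avg_abs[OF N a w])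
      moreover have "\<bar>?B (Suc N) g\<bar> \<le> 1" by (rule replica_avg_abs[OF N a w])
      ultimately show ?thesis unfolding F_def by linarith
    qed
    have F0: "pd (edge 0 l) F = (\<lambda>g. 0)" if l: "l \<in> row N 0" for l
    proof (rule pd_outside)
      show "F \<in> tame (site_pairs N \<union> edge (Suc N) ` row N (Suc N))"
        unfolding F_def by (intro tame_diff replica_avg_tame_row tame_mono[OF site_avg_tame_sites]) auto
      show "edge 0 l \<notin> site_pairs N \<union> edge (Suc N) ` row N (Suc N)" using row_disjoint l by blast
    qed
    have Fpd: "Lq (pairs N) CF ((isqrt N)\<^sup>2) (pd (edge i l) F)" if i: "i \<in> {1..N}" and l: "l \<in> row N i" for i l
      unfolding F_def CF_def[abs_def]
      using n1 n2 b1[OF v i, of c l] b2[OF v i, of c l] l by (intro replica_pd_bound[OF v a w i l]) auto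
    have diff: "\<bar>gE (pairs N) (\<lambda>g. u0 w (lfield c N m1 k1 i g) (lfield c N m1 k2 i g) * F g)
        - gE (pairs N) (\<lambda>g. u0 w (rfield c N m1 k1 0 g) (rfield c N m1 k2 0 g) * F g)\<bar> \<le> K * isqrt N" if i: "i \<in> {1..N}" for i
    proof -
      have tf: "lfield c N m1 k i \<in> tame (pairs N)" for k by (rule lfield_tame[OF i])
      have tz: "rfield c N m1 k 0 \<in> tame (pairs N)" for k by (rule rfield_tame) simp
      note r = rot_tame[OF tf tz]
      note B1 = b1[OF v i, of c] and B2 = b2[OF v i, of c]
      have "\<bar>gE (pairs N) (\<lambda>g. rot' t (lfield c N m1 k1 i) (rfield c N m1 k1 0) g *
          (u1 w (rot t (lfield c N m1 k1 i) (rfield c N m1 k1 0) g) (rot t (lfield c N m1 k2 i) (rfield c N m1 k2 0) g) * F g))\<bar> \<le> X CE1 * isqrt N" for t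
        unfolding X_def
        by (rule key_estimate[OF v i u_tame(2)[OF r r] u_tame(4)[OF r r] u_tame(5)[OF r r] tF
              u_abs(2)[OF w] u_abs(4)[OF w] u_abs(5)[OF w] Fb pd_u(2)[OF r r] F0 Fpd[OF i]])
          (use B1 B2 n1 n2 CFn in auto)
      moreover have "\<bar>gE (pairs N) (\<lambda>g. rot' t (lfield c N m1 k2 i) (rfield c N m1 k2 0) g *
          (u2 w (rot t (lfield c N m1 k1 i) (rfield c N m1 k1 0) g) (rot t (lfield c N m1 k2 i) (rfield c N m1 k2 0) g) * F g))\<bar> \<le> X CE2 * isqrt N" for t
        unfolding X_def
        by (rule key_estimate[OF v i u_tame(3)[OF r r] u_tame(5)[OF r r] u_tame(6)[OF r r] tF
              u_abs(3)[OF w] u_abs(5)[OF w] u_abs(6)[OF w] Fb pd_u(3)[OF r r] F0 Fpd[OF i]])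
          (use B1 B2 n1 n2 CFn in auto)
      ultimately have "\<bar>gE (pairs N) (\<lambda>g. u0 w (lfield c N m1 k1 i g) (lfield c N m1 k2 i g) * F g)
        - gE (pairs N) (\<lambda>g. u0 w (rfield c N m1 k1 0 g) (rfield c N m1 k2 0 g) * F g)\<bar> \<le> 2 * (X CE1 * isqrt N + X CE2 * isqrt N)"
        by (rule interpolation[OF w tf tf tz tz tF])
      then show ?thesis by (simp add: K_def algebra_simps)
    qed
    define y where "y i = gE (pairs N) (\<lambda>g. u0 w (lfield c N m1 k1 i g) (lfield c N m1 k2 i g) * F g)" for i
    define z where "z = gE (pairs N) (\<lambda>g. u0 w (rfield c N m1 k1 0 g) (rfield c N m1 k2 0 g) * F g)"
    have ty: "(\<lambda>g. u0 w (lfield c N m1 k1 i g) (lfield c N m1 k2 i g) * F g) \<in> tame (pairs N)" if "i \<in> {1..N}" for i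
      using that by (intro tame_mult u_tame lfield_tame tF)
    have "gE (pairs N) (\<lambda>g. (?A g - ?B 0 g) * F g) = gE (pairs N) (\<lambda>g. ?A g * F g) - gE (pairs N) (\<lambda>g. ?B 0 g * F g)"
      unfolding left_diff_distrib by (intro gE_diff tame_mult site_avg_tame replica_avg_tame tF) auto
    also have "gE (pairs N) (\<lambda>g. ?B 0 g * F g) = avg N a * z"
      unfolding replica_avg_def z_def mult.assoc gE_cmult ..
    also have "gE (pairs N) (\<lambda>g. ?A g * F g) = avg N (\<lambda>i. a i * y i)"
    proof -
      have "(\<lambda>g. ?A g * F g) = (\<lambda>g. (1 / real N) * (\<Sum>i=1..N. a i * (u0 w (lfield c N m1 k1 i g) (lfield c N m1 k2 i g) * F g)))"
        unfolding site_avg_def avg_def by (simp add: sum_distrib_right mult.assoc)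
      then have "gE (pairs N) (\<lambda>g. ?A g * F g) = (1 / real N) * gE (pairs N) (\<lambda>g. \<Sum>i=1..N. a i * (u0 w (lfield c N m1 k1 i g) (lfield c N m1 k2 i g) * F g))"
        by (simp only: gE_cmult)
      also have "\<dots> = (1 / real N) * (\<Sum>i=1..N. a i * y i)"
        using ty by (subst gE_sum[of _ _ "pairs N"]) (auto simp: gE_cmult y_def)
      finally show ?thesis by (simp add: avg_def)
    qed
    also have "avg N (\<lambda>i. a i * y i) - avg N a * z = avg N (\<lambda>i. a i * (y i - z))"
      by (simp add: avg_def sum_subtractf sum_distrib_left sum_distrib_right right_diff_distrib mult_ac)
    also have "\<bar>\<dots>\<bar> \<le> 1 * (K * isqrt N)"
      using diff a by (intro avg_abs_le N abs_mult_le) (auto simp: y_def z_def)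
    finally show "\<bar>gE (pairs N) (\<lambda>g. (?A g - ?B 0 g) * (?A g - ?B (Suc N) g))\<bar> \<le> K * isqrt N"
      by (simp add: F_def)
  qed
qed

end

section \<open>Conditional expectation given the disorder, and conclusion\<close>

context amp begin

definition Psi :: "real \<Rightarrow> real \<Rightarrow> real \<Rightarrow> real \<Rightarrow> real" where
  "Psi w t t' t'' = (if w = 0 then chi \<beta> h t' else psi \<beta> h t t' t'')"

definition ovl :: "onsager_choice \<Rightarrow> nat \<Rightarrow> (nat \<Rightarrow> real) \<Rightarrow> nat \<Rightarrow> nat \<Rightarrow> disorder \<Rightarrow> real" where
  "ovl c N m1 k k' g = iterate_overlap c \<beta> h N m1 k k' g"

lemma ovl_avg: "ovl c N m1 k k' g = avg N (\<lambda>i. mag c N m1 k i g * mag c N m1 k' i g)"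
  by (simp add: ovl_def iterate_overlap_def overlap_def avg_def mag_def)

text \<open>The coefficient vectors \<open>isqrt N * m\<close> have the overlaps as inner products,
  so given \<open>g\<close> the copies have exactly the covariance at which \<open>psi\<close> and
  \<open>chi\<close> are evaluated.\<close>

lemma gE_row_Psi:
  assumes N: "N \<ge> 1" and w: "w = 0 \<or> w = 1" and p: "p = 0 \<or> p = Suc N"
  shows "gE (edge p ` row N p) (\<lambda>z. u0 w (lin (edge p ` row N p) (\<lambda>e. \<beta> * (isqrt N * mag c N m1 (Suc k1) (other p e) g)) z)
      (lin (edge p ` row N p) (\<lambda>e. \<beta> * (isqrt N * mag c N m1 (Suc k2) (other p e) g)) z))
    = Psi w (ovl c N m1 (Suc k1) (Suc k2) g) (ovl c N m1 (Suc k1) (Suc k1) g) (ovl c N m1 (Suc k2) (Suc k2) g)"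
proof -
  let ?R = "edge p ` row N p"
  have row: "row N p = {1..N}" using p by (auto simp: row_def)
  have sum: "(\<Sum>e\<in>?R. (isqrt N * mag c N m1 j (other p e) g) * (isqrt N * mag c N m1 j' (other p e) g)) = ovl c N m1 j j' g" for j j'
  proof -
    have "(\<Sum>e\<in>?R. (isqrt N * mag c N m1 j (other p e) g) * (isqrt N * mag c N m1 j' (other p e) g))
        = (\<Sum>l=1..N. (1 / real N) * (mag c N m1 j l g * mag c N m1 j' l g))"
      unfolding row sum.reindex[OF inj_edge] comp_def other_edge isqrt_sq'[OF N, symmetric] by (simp only: mult_ac)
    then show ?thesis unfolding ovl_avg avg_def sum_distrib_left .
  qed
  have fin: "finite ?R" by simp
  show ?thesis
  proof (cases "w = 0")
    case True
    then show ?thesis unfolding Psi_def using chi_eq[OF fin] sum by simp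
  next
    case False
    then have w1: "w = 1" using w by simp
    show ?thesis unfolding Psi_def w1 psi_eq[OF fin] sum by simp
  qed
qed

text \<open>Given the disorder, the two copies are independent with the same law, so the product of the two
  differences integrates to a square.\<close>

lemma replica_identity:
  assumes N: "N \<ge> 1" and w: "w = 0 \<or> w = 1"
  shows "(\<integral>g. (site_avg c N m1 a w k1 k2 g - avg N a * Psi w (ovl c N m1 (Suc k1) (Suc k2) g)
          (ovl c N m1 (Suc k1) (Suc k1) g) (ovl c N m1 (Suc k2) (Suc k2) g))\<^sup>2 \<partial>disorder_measure N)
    = gE (pairs N) (\<lambda>g. (site_avg c N m1 a w k1 k2 g - replica_avg c N m1 a w k1 k2 0 g) * (site_avg c N m1 a w k1 k2 g - replica_avg c N m1 a w k1 k2 (Suc N) g))"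
proof -
  define S where "S = site_pairs N"
  define R where "R p = edge p ` row N p" for p
  define J where "J = R 0 \<union> R (Suc N)"
  let ?A = "site_avg c N m1 a w k1 k2" and ?B = "replica_avg c N m1 a w k1 k2"
  let ?G = "\<lambda>g. (?A g - ?B 0 g) * (?A g - ?B (Suc N) g)"
  define b where "b p g z = avg N a * u0 w (lin (R p) (\<lambda>e. \<beta> * (isqrt N * mag c N m1 (Suc k1) (other p e) g)) z)
      (lin (R p) (\<lambda>e. \<beta> * (isqrt N * mag c N m1 (Suc k2) (other p e) g)) z)" for p g z
  define P where "P g = Psi w (ovl c N m1 (Suc k1) (Suc k2) g) (ovl c N m1 (Suc k1) (Suc k1) g) (ovl c N m1 (Suc k2) (Suc k2) g)" for g
  have finS: "finite S" unfolding S_def by (rule finite_subset[OF site_pairs_pairs]) simp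
  have finR: "finite (R p)" for p by (simp add: R_def)
  have finJ: "finite J" by (simp add: J_def finR)
  have disj: "S \<inter> J = {}" "R 0 \<inter> R (Suc N) = {}"
    using row_disjoint[of N] unfolding S_def J_def R_def by blast+
  have pairs: "pairs N = (S \<union> J) \<union> {(0, Suc N)}"
  proof (intro equalityI subsetI)
    fix e assume "e \<in> pairs N"
    then obtain x y where e: "e = (x, y)" "x < y" "y \<le> Suc N" by (auto simp: pairs_def)
    consider "x = 0" "y = Suc N" | "x = 0" "y \<noteq> Suc N" | "x \<noteq> 0" "y = Suc N" | "x \<noteq> 0" "y \<noteq> Suc N" by blast
    then show "e \<in> (S \<union> J) \<union> {(0, Suc N)}"
    proof cases
      case 2
      then have "e = edge 0 y" "y \<in> row N 0" using e by (auto simp: edge_def row_def)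
      then show ?thesis by (auto simp: J_def R_def)
    next
      case 3
      then have "e = edge (Suc N) x" "x \<in> row N (Suc N)" using e by (auto simp: edge_def row_def)
      then show ?thesis by (auto simp: J_def R_def)
    qed (use e in \<open>auto simp: S_def site_pairs_def\<close>)
  next
    fix e assume "e \<in> (S \<union> J) \<union> {(0, Suc N)}"
    then show "e \<in> pairs N"
      using row_pairs[of 0 N] row_pairs[of "Suc N" N] site_pairs_pairs[of N] unfolding S_def J_def R_def by (auto simp: pairs_def)
  qed
  have tG: "?G \<in> tame (S \<union> J)"
    unfolding S_def J_def R_def
    by (intro tame_mult tame_diff tame_mono[OF site_avg_tame_sites] tame_mono[OF replica_avg_tame_row]) auto
  have mg: "mag c N m1 k (other p e) (merge S J (g, z)) = mag c N m1 k (other p e) g" if "e \<in> R p" for k p e g z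
  proof (rule tame_cong_outside[of "mag c N m1 k (other p e)" S])
    show "mag c N m1 k (other p e) \<in> tame S" unfolding S_def using that by (intro mag_tame_sites) (auto simp: R_def row_def)
  qed (rule merge_in)
  have mA: "?A (merge S J (g, z)) = ?A g" for g z
    by (rule tame_cong_outside[OF site_avg_tame_sites]) (simp add: merge_in S_def)
  have mZ: "rfield c N m1 k p (merge S J (g, z)) = lin (R p) (\<lambda>e. \<beta> * (isqrt N * mag c N m1 (Suc k) (other p e) g)) z"
    if p: "p = 0 \<or> p = Suc N" for k p g z
    unfolding rfield_row[OF p] lin_def R_def[symmetric]
  proof (rule sum.cong[OF refl])
    fix e assume e: "e \<in> R p"
    then have "e \<in> J" using p by (auto simp: J_def)
    then show "\<beta> * (isqrt N * mag c N m1 (Suc k) (other p e) (merge S J (g, z))) * merge S J (g, z) e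
        = \<beta> * (isqrt N * mag c N m1 (Suc k) (other p e) g) * z e"
      by (simp only: mg[OF e] merge_right[OF disj(1)])
  qed
  have mB: "?B p (merge S J (g, z)) = b p g z" if "p = 0 \<or> p = Suc N" for p g z
    unfolding replica_avg_def b_def mZ[OF that] ..
  have tb: "b p g \<in> tame (R p)" for p g
    unfolding b_def[abs_def] by (intro tame_mult tame_const u_tame lin_tame)
  \<comment> \<open>Both auxiliary vertices yield the same conditional expectation, so the product
    over the two rows becomes a square. This local fact is unrelated to the predicate of the same
    name.\<close>
  have remainder_bounds: "gE (R p) (\<lambda>z. x - b p g z) = x - avg N a * P g" if p: "p = 0 \<or> p = Suc N" for p g x
  proof -
    have "gE (R p) (b p g) = avg N a * P g"
      unfolding b_def[abs_def] gE_cmult P_def R_def gE_row_Psi[OF N w p] ..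
    then show ?thesis by (simp add: gE_diff[OF tame_const tb])
  qed
  have "gE (pairs N) ?G = gE (S \<union> J) ?G"
    unfolding pairs by (rule gE_superset[OF _ _ tG]) (auto simp: finS finJ)
  also have "\<dots> = (\<integral>g. gE J (\<lambda>z. ?G (merge S J (g, z))) \<partial>gauss_measure S)"
    by (rule gE_union[OF finS finJ disj(1) tG])
  also have "\<dots> = (\<integral>g. (?A g - avg N a * P g)\<^sup>2 \<partial>gauss_measure S)"
  proof (rule Bochner_Integration.integral_cong[OF refl])
    fix g
    have "gE J (\<lambda>z. ?G (merge S J (g, z))) = gE J (\<lambda>z. (?A g - b 0 g z) * (?A g - b (Suc N) g z))"
      by (simp only: mA mB simp_thms)
    also have "\<dots> = gE (R 0) (\<lambda>z. ?A g - b 0 g z) * gE (R (Suc N)) (\<lambda>z. ?A g - b (Suc N) g z)"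
      unfolding J_def by (rule gE_product[OF finR finR disj(2)]) (intro tame_diff tame_const tb)+
    finally show "gE J (\<lambda>z. ?G (merge S J (g, z))) = (?A g - avg N a * P g)\<^sup>2"
      by (simp add: remainder_bounds power2_eq_square)
  qed
  also have "gauss_measure S = disorder_measure N" by (simp add: gauss_measure_def disorder_measure_def S_def)
  finally show ?thesis by (simp add: P_def)
qed

lemma overlap_estimate:
  "\<exists>K\<ge>0. \<forall>c N m1 a w. valid N m1 \<longrightarrow> (\<forall>i\<in>{1..N}. \<bar>a i\<bar> \<le> 1) \<longrightarrow> w = 0 \<or> w = 1 \<longrightarrow>
    (\<integral>g. (site_avg c N m1 a w k1 k2 g - avg N a * Psi w (ovl c N m1 (Suc k1) (Suc k2) g)
          (ovl c N m1 (Suc k1) (Suc k1) g) (ovl c N m1 (Suc k2) (Suc k2) g))\<^sup>2 \<partial>disorder_measure N) \<le> K * isqrt N"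
proof -
  obtain K where K: "0 \<le> K" "\<forall>c N m1 a w. valid N m1 \<longrightarrow> (\<forall>i\<in>{1..N}. \<bar>a i\<bar> \<le> 1) \<longrightarrow> 0 \<le> w \<longrightarrow> w \<le> 1 \<longrightarrow>
    \<bar>gE (pairs N) (\<lambda>g. (site_avg c N m1 a w k1 k2 g - replica_avg c N m1 a w k1 k2 0 g) * (site_avg c N m1 a w k1 k2 g - replica_avg c N m1 a w k1 k2 (Suc N) g))\<bar>
      \<le> K * isqrt N"
    using replica_bound[of k1 k2] by (elim exE conjE) (rule that)
  show ?thesis
  proof (intro exI[of _ K] conjI allI impI)
    fix c :: onsager_choice and N :: nat and m1 a :: "nat \<Rightarrow> real" and w :: real
    assume v: "valid N m1" and a: "\<forall>i\<in>{1..N}. \<bar>a i\<bar> \<le> 1" and w: "w = 0 \<or> w = 1"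
    have w': "0 \<le> w" "w \<le> 1" using w by auto
    show "(\<integral>g. (site_avg c N m1 a w k1 k2 g - avg N a * Psi w (ovl c N m1 (Suc k1) (Suc k2) g)
          (ovl c N m1 (Suc k1) (Suc k1) g) (ovl c N m1 (Suc k2) (Suc k2) g))\<^sup>2 \<partial>disorder_measure N) \<le> K * isqrt N"
      unfolding replica_identity[OF valid_N[OF v] w]
      by (rule order_trans[OF abs_ge_self K(2)[rule_format, OF v _ w']]) (use a in blast)
  qed (rule K(1))
qed

end

theorem theorem7:
  fixes \<beta> h :: real and k k' :: nat
  assumes "k \<ge> 1" and "k' \<ge> 1"
  shows "\<exists>C>0. \<forall>(c :: onsager_choice) (N :: nat) (m1 :: nat \<Rightarrow> real).
    N \<ge> 1 \<longrightarrow> (\<forall>i\<in>{1..N}. m1 i \<in> {-1..1}) \<longrightarrow>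
      (LINT g|disorder_measure N.
         (iterate_overlap c \<beta> h N m1 (k + 1) (k' + 1) g
           - psi \<beta> h (iterate_overlap c \<beta> h N m1 k k' g)
                     (iterate_overlap c \<beta> h N m1 k k g)
                     (iterate_overlap c \<beta> h N m1 k' k' g))\<^sup>2) \<le> C / sqrt (real N)
      \<and> (LINT g|disorder_measure N.
         (iterate_overlap c \<beta> h N m1 (k + 1) 1 g
           - chi \<beta> h (iterate_overlap c \<beta> h N m1 k k g)
             * ((1 / real N) * (\<Sum>i = 1..N. m1 i)))\<^sup>2) \<le> C / sqrt (real N)"
proof -
  interpret amp \<beta> h .
  \<comment> \<open>The field with index j is built from iterate j + 1 = k and produces iterate j +
    2 = k + 1, hence the shift.\<close>
  obtain j j' where j: "k = Suc j" "k' = Suc j'" using assms by (metis Suc_le_D One_nat_def)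
  obtain K where K: "0 \<le> K" "\<forall>c N m1 a w. valid N m1 \<longrightarrow> (\<forall>i\<in>{1..N}. \<bar>a i\<bar> \<le> 1) \<longrightarrow> w = 0 \<or> w = 1 \<longrightarrow>
    (\<integral>g. (site_avg c N m1 a w j j' g - avg N a * Psi w (ovl c N m1 (Suc j) (Suc j') g)
          (ovl c N m1 (Suc j) (Suc j) g) (ovl c N m1 (Suc j') (Suc j') g))\<^sup>2 \<partial>disorder_measure N) \<le> K * isqrt N"
    using overlap_estimate[of j j'] by (elim exE conjE) (rule that)
  show ?thesis
  \<comment> \<open>\<open>K\<close> may be zero, whereas the claim asks for a positive
    constant.\<close>
  proof (intro exI[of _ "K + 1"] conjI allI impI)
    show "0 < K + 1" using K(1) by simp
    fix c :: onsager_choice and N :: nat and m1 :: "nat \<Rightarrow> real"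
    assume N: "N \<ge> 1" and m1: "\<forall>i\<in>{1..N}. m1 i \<in> {-1..1}"
    have v: "valid N m1" using N m1 by (auto simp: valid_def abs_le_iff minus_le_iff)
    have m1': "\<bar>m1 i\<bar> \<le> 1" if "i \<in> {1..N}" for i using v that by (simp add: valid_def)
    have le: "K * isqrt N \<le> (K + 1) / sqrt (real N)"
      using N by (simp add: isqrt_def divide_right_mono)
    have th: "mag c N m1 (Suc (Suc q)) i g = th (lfield c N m1 q i g)" for q i g by (simp add: mag_simps th_def)
    have "avg N (\<lambda>_. 1) = 1" using N by (simp add: avg_def)
    moreover have "site_avg c N m1 (\<lambda>_. 1) 1 j j' g = ovl c N m1 (k + 1) (k' + 1) g" for g
      unfolding site_avg_def ovl_avg j by (simp add: th u0_def)
    ultimately have "(\<integral>g. (ovl c N m1 (k + 1) (k' + 1) g - psi \<beta> h (ovl c N m1 k k' g) (ovl c N m1 k k g) (ovl c N m1 k' k' g))\<^sup>2 \<partial>disorder_measure N) \<le> K * isqrt N"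
      using K(2)[THEN spec[where x = c], THEN spec[where x = N], THEN spec[where x = m1], THEN spec[where x = "\<lambda>_. 1"],
          THEN spec[where x = 1]] v by (simp add: Psi_def j)
    from order_trans[OF this le] show "(LINT g|disorder_measure N.
         (iterate_overlap c \<beta> h N m1 (k + 1) (k' + 1) g
           - psi \<beta> h (iterate_overlap c \<beta> h N m1 k k' g)
                     (iterate_overlap c \<beta> h N m1 k k g)
                     (iterate_overlap c \<beta> h N m1 k' k' g))\<^sup>2) \<le> (K + 1) / sqrt (real N)"
      unfolding ovl_def .
    \<comment> \<open>The weights \<open>m1\<close> supply the second vector of the overlap, and w =
      0 leaves a single tanh.\<close>
    have "site_avg c N m1 m1 0 j j' g = ovl c N m1 (k + 1) 1 g" for g
      unfolding site_avg_def ovl_avg j by (simp add: th u0_def mag_simps(2) mult.commute)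
    then have "(\<integral>g. (ovl c N m1 (k + 1) 1 g - chi \<beta> h (ovl c N m1 k k g) * avg N m1)\<^sup>2 \<partial>disorder_measure N) \<le> K * isqrt N"
      using K(2)[THEN spec[where x = c], THEN spec[where x = N], THEN spec[where x = m1], THEN spec[where x = m1],
          THEN spec[where x = 0]] v m1' by (simp add: Psi_def j mult.commute)
    from order_trans[OF this le] show "(LINT g|disorder_measure N.
         (iterate_overlap c \<beta> h N m1 (k + 1) 1 g
           - chi \<beta> h (iterate_overlap c \<beta> h N m1 k k g)
             * ((1 / real N) * (\<Sum>i = 1..N. m1 i)))\<^sup>2) \<le> (K + 1) / sqrt (real N)"
      unfolding ovl_def avg_def .
  qed
qed

end
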